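(* Let $\mu_1,\mu_2$ be centred Gaussian Radon measures on real Banach spaces $E_1,E_2$ with reproducing kernel Hilbert spaces $H_1,H_2$, and let $T:H_1\to H_2$ be a linear contraction, with Hilbert space adjoint $T^*:H_2\to H_1$. Let $P_T:L^2(E_2,\mu_2)\to L^2(E_1,\mu_1)$ be the associated contraction, let $I^{(k)}:=\bigoplus_{n=0}^\infty \frac{1}{\sqrt{n!}}I_n^{(k)}:\Gamma(H_k)\to L^2(E_k,\mu_k)$ ($k=1,2$) be the Wiener–Itô isometries, and let $\Gamma(T^* ):=\bigoplus_{n=0}^\infty (T^* )^{\otimes n}|_{H_2^{\odot n}}:\Gamma(H_2)\to\Gamma(H_1)$ be the symmetric second quantisation of $T^*$ (all defined in the context). Then $$P_T\circ I^{(2)} = I^{(1)}\circ \Gamma(T^* )\quad\text{as operators } \Gamma(H_2)\to L^2(E_1,\mu_1).$$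
   Context: Reproducing kernel Hilbert space. For a centred Gaussian Radon measure $\mu$ on a real Banach space $E$, its covariance operator $Q:E^*\to E$ is $Qx^*=\int_E\langle x,x^*\rangle x\,\mu(dx)$. The reproducing kernel Hilbert space $H$ of $\mu$ is the completion of the range of $Q$ for the inner product $(Qx^*,Qy^* )\mapsto\langle Qx^*,y^*\rangle$. The identity on the range of $Q$ extends to a bounded injective operator $j:H\to E$ and $Q=j\circ j^*$ (where $H^*$ is identified with $H$). For $h=j^*x^*$ put $\phi_h(x)=\langle x,x^*\rangle$; the map $h\mapsto\phi_h$ extends uniquely to an isometry from $H$ into $L^2(E,\mu)$. Write $j_k$ for the map $j$ belonging to $\mu_k$. The operator $P_T$. The contraction $T:H_1\to H_2$ has a linear Borel measurable extension $\bar T:E_1\to E_2$ (meaning $\bar T\circ j_1=j_2\circ T$) such that the image measure $\bar T(\mu_1)$ is a Gaussian Radon measure and $\bar T(\mu_1)*\rho=\mu_2$ for some Gaussian Radon measure $\rho$ on $E_2$. For bounded Borel $f:E_2\to\mathbb{R}$ put $P_Tf(x)=\int_{E_2}f(\bar T x+y)\,d\rho(y)$, $x\in E_1$; $P_T$ extends uniquely to a linear contraction $L^2(E_2,\mu_2)\to L^2(E_1,\mu_1)$. Fock space. $S_n$ is the permutation group on $n$ elements and $\Sigma_n:H^{\otimes n}\to H^{\otimes n}$ is the symmetrising projection $\Sigma_n(h_1\otimes\cdots\otimes h_n)=\frac{1}{n!}\sum_{\sigma\in S_n}h_{\sigma(1)}\otimes\cdots\otimes h_{\sigma(n)}$. Its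 range is $H^{\odot n}$ (with $H^{\odot 0}=\mathbb{R}$). The symmetric Fock space is $\Gamma(H)=\bigoplus_{n\ge0}H^{\odot n}$ with norm $\|(h_n)\|^2=\sum_n\|h_n\|^2_{H^{\odot n}}$. Stochastic integrals. The Hermite polynomials $H_n$ (as polynomials) are defined by $\exp(tx-\frac12t^2)=\sum_{n\ge0}\frac{t^n}{n!}H_n(x)$. Let $(h_n)_{n\ge1}$ be an orthonormal basis of $H$. The $n$-fold stochastic integral $I_n:H^{\odot n}\to L^2(E,\mu)$ is the bounded linear map determined by $$I_n\big(\Sigma_n(h_{j_1}^{\otimes k_1}\otimes\cdots\otimes h_{j_m}^{\otimes k_m})\big)=\prod_{l=1}^m H_{k_l}(\phi_{h_{j_l}}),\qquad j_1<\dots<j_m,\ k_1+\dots+k_m=n.$$ Then $\frac1{\sqrt{n!}}I_n$ is an isometry onto the closed linear span $\mathscr{H}_n$ of $\{H_n(\phi_h):\|h\|=1\}$, and $\bigoplus_n\frac1{\sqrt{n!}}I_n$ is an isometric isomorphism $\Gamma(H)\to L^2(E,\mu)$. The superscript $(k)$ indicates the objects associated with $\mu_k$. *)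

theory Defs
  imports
    "HOL-Probability.Probability"
    "HOL-Combinatorics.Permutations"
    "HOL-Computational_Algebra.Polynomial"
begin

section \<open>Gaussian Radon measures\<close>

definition radon_prob :: "'a::banach measure \<Rightarrow> bool" where
  "radon_prob \<mu> \<longleftrightarrow> prob_space \<mu> \<and> sets \<mu> = sets borel \<and>
     (\<forall>B\<in>sets borel. emeasure \<mu> B = (SUP K\<in>{K. compact K \<and> K \<subseteq> B}. emeasure \<mu> K))"

text \<open>Point masses are Gaussian, with variance zero.\<close>

definition gaussian_law :: "real measure \<Rightarrow> bool" where
  "gaussian_law \<nu> \<longleftrightarrow> (\<exists>m. \<nu> = return borel m) \<or>
     (\<exists>m s. s > 0 \<and> \<nu> = density lborel (\<lambda>x. ennreal (normal_density m s x)))"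

definition gaussian_radon :: "'a::banach measure \<Rightarrow> bool" where
  "gaussian_radon \<mu> \<longleftrightarrow> radon_prob \<mu> \<and>
     (\<forall>xs :: 'a \<Rightarrow>\<^sub>L real. gaussian_law (distr \<mu> borel (blinfun_apply xs)))"

definition centred_gaussian_radon :: "'a::banach measure \<Rightarrow> bool" where
  "centred_gaussian_radon \<mu> \<longleftrightarrow> gaussian_radon \<mu> \<and>
     (\<forall>xs :: 'a \<Rightarrow>\<^sub>L real. (\<integral>x. blinfun_apply xs x \<partial>\<mu>) = 0)"

text \<open>\<open>(\<mu> * \<rho>)(B) = \<integral> \<rho>(B - x) d\<mu>(x)\<close>. The image of \<open>\<mu> \<Otimes>\<^sub>M \<rho>\<close> under addition is not an
  option: on a nonseparable space addition need not be measurable for the product of the Borel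
  sigma-algebras.\<close>

definition convolve :: "'a::banach measure \<Rightarrow> 'a measure \<Rightarrow> 'a measure" where
  "convolve \<mu> \<rho> = measure_of UNIV (sets borel)
     (\<lambda>B. \<integral>\<^sup>+x. emeasure \<rho> {y. x + y \<in> B} \<partial>\<mu>)"

section \<open>The reproducing kernel Hilbert space\<close>

text \<open>The clauses of \<^const>\<open>has_bochner_integral\<close>, whose type is restricted to second
  countable spaces.\<close>

definition has_bochner_integral_banach ::
  "'a measure \<Rightarrow> ('a \<Rightarrow> 'b::banach) \<Rightarrow> 'b \<Rightarrow> bool" where
  "has_bochner_integral_banach M f v \<longleftrightarrow> f \<in> borel_measurable M \<and>
     (\<exists>s. (\<forall>i::nat. Bochner_Integration.simple_bochner_integrable M (s i)) \<and>
          (\<lambda>i. \<integral>\<^sup>+x. ennreal (norm (f x - s i x)) \<partial>M) \<longlonglongrightarrow> 0 \<and>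
          (\<lambda>i. Bochner_Integration.simple_bochner_integral M (s i)) \<longlonglongrightarrow> v)"

definition covariance_operator ::
  "'a::banach measure \<Rightarrow> (('a \<Rightarrow>\<^sub>L real) \<Rightarrow> 'a) \<Rightarrow> bool" where
  "covariance_operator \<mu> Q \<longleftrightarrow>
     (\<forall>xs. has_bochner_integral_banach \<mu> (\<lambda>x. blinfun_apply xs x *\<^sub>R x) (Q xs))"

text \<open>The Hilbert space \<open>'h\<close> is the completion of the range of \<open>Q\<close>, embedded in it by \<open>inv j\<close>,
  and \<open>j\<close> is the bounded injective extension of the identity on the range of \<open>Q\<close>.\<close>

definition rkhs :: "'a::banach measure \<Rightarrow> ('h::{real_inner,banach} \<Rightarrow>\<^sub>L 'a) \<Rightarrow> bool" where
  "rkhs \<mu> j \<longleftrightarrow> inj (blinfun_apply j) \<and>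
     (\<exists>Q. covariance_operator \<mu> Q \<and>
       range Q \<subseteq> range (blinfun_apply j) \<and>
       (\<forall>xs ys. inner (inv (blinfun_apply j) (Q xs)) (inv (blinfun_apply j) (Q ys))
                  = blinfun_apply ys (Q xs)) \<and>
       closure (inv (blinfun_apply j) ` range Q) = UNIV)"

text \<open>\<open>j\<^sup>*\<close>, with values in \<open>H\<close> through the Riesz identification.\<close>

definition dual_map ::
  "('h::{real_inner,banach} \<Rightarrow>\<^sub>L 'a::banach) \<Rightarrow> ('a \<Rightarrow>\<^sub>L real) \<Rightarrow> 'h" where
  "dual_map j xs = (THE h. \<forall>g. inner g h = blinfun_apply xs (blinfun_apply j g))"

section \<open>Square integrable functions\<close>

text \<open>Elements of \<open>L\<^sup>2\<close> are handled through representatives; all identities between them are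
  almost everywhere identities. An operator with values in \<open>L\<^sup>2\<close> is a function choosing
  representatives.\<close>

definition L2space :: "'a measure \<Rightarrow> ('a \<Rightarrow> real) set" where
  "L2space \<mu> = {f \<in> borel_measurable \<mu>. integrable \<mu> (\<lambda>x. (f x)\<^sup>2)}"

definition L2norm :: "'a measure \<Rightarrow> ('a \<Rightarrow> real) \<Rightarrow> real" where
  "L2norm \<mu> f = sqrt (\<integral>x. (f x)\<^sup>2 \<partial>\<mu>)"

definition L2_linear_on ::
  "'v::real_vector set \<Rightarrow> 'a measure \<Rightarrow> ('v \<Rightarrow> 'a \<Rightarrow> real) \<Rightarrow> bool" where
  "L2_linear_on S \<mu> F \<longleftrightarrow>
     (\<forall>u\<in>S. F u \<in> L2space \<mu>) \<and>
     (\<forall>u\<in>S. \<forall>v\<in>S. AE x in \<mu>. F (u + v) x = F u x + F v x) \<and>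
     (\<forall>c. \<forall>u\<in>S. AE x in \<mu>. F (c *\<^sub>R u) x = c * F u x)"

text \<open>Linearity and contractivity make \<open>P\<close> respect almost everywhere equality.\<close>

definition L2_contraction ::
  "'b measure \<Rightarrow> 'a measure \<Rightarrow> (('b \<Rightarrow> real) \<Rightarrow> 'a \<Rightarrow> real) \<Rightarrow> bool" where
  "L2_contraction \<nu> \<mu> P \<longleftrightarrow>
     (\<forall>f\<in>L2space \<nu>. P f \<in> L2space \<mu> \<and> L2norm \<mu> (P f) \<le> L2norm \<nu> f) \<and>
     (\<forall>f\<in>L2space \<nu>. \<forall>g\<in>L2space \<nu>. AE x in \<mu>. P (\<lambda>y. f y + g y) x = P f x + P g x) \<and>
     (\<forall>c. \<forall>f\<in>L2space \<nu>. AE x in \<mu>. P (\<lambda>y. c * f y) x = c * P f x)"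

text \<open>The isometry \<open>h \<mapsto> \<phi>\<^sub>h\<close> from \<open>H\<close> into \<open>L\<^sup>2(E,\<mu>)\<close>.\<close>

definition wiener_map ::
  "'a::banach measure \<Rightarrow> ('h::{real_inner,banach} \<Rightarrow>\<^sub>L 'a) \<Rightarrow> ('h \<Rightarrow> 'a \<Rightarrow> real) \<Rightarrow> bool" where
  "wiener_map \<mu> j \<phi> \<longleftrightarrow> L2_linear_on UNIV \<mu> \<phi> \<and> (\<forall>h. L2norm \<mu> (\<phi> h) = norm h) \<and>
     (\<forall>xs. AE x in \<mu>. \<phi> (dual_map j xs) x = blinfun_apply xs x)"

section \<open>The operator associated with a contraction\<close>

text \<open>\<open>S\<close> stands for the extension of \<open>T\<close> to a measurable operator on \<open>E\<^sub>1\<close>. As usual for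
  measurable linear operators, linearity is required on a linear subspace \<open>D\<close> of full measure
  containing the range of \<open>j\<^sub>1\<close>, not on all of \<open>E\<^sub>1\<close>: between separable Banach spaces,
  everywhere linear Borel maps are continuous, and a general contraction has no continuous
  extension. The case \<open>D = UNIV\<close> is included.\<close>

definition gaussian_extension ::
  "'a::banach measure \<Rightarrow> ('h::{real_inner,banach} \<Rightarrow>\<^sub>L 'a) \<Rightarrow>
   'b::banach measure \<Rightarrow> ('k::{real_inner,banach} \<Rightarrow>\<^sub>L 'b) \<Rightarrow>
   ('h \<Rightarrow> 'k) \<Rightarrow> ('a \<Rightarrow> 'b) \<Rightarrow> 'b measure \<Rightarrow> bool" where
  "gaussian_extension \<mu>1 j1 \<mu>2 j2 T S \<rho> \<longleftrightarrow>
     S \<in> borel_measurable borel \<and>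
     (\<exists>D. subspace D \<and> (AE x in \<mu>1. x \<in> D) \<and> range (blinfun_apply j1) \<subseteq> D \<and>
        (\<forall>x\<in>D. \<forall>y\<in>D. S (x + y) = S x + S y) \<and>
        (\<forall>c. \<forall>x\<in>D. S (c *\<^sub>R x) = c *\<^sub>R S x)) \<and>
     (\<forall>h. S (blinfun_apply j1 h) = blinfun_apply j2 (T h)) \<and>
     gaussian_radon (distr \<mu>1 borel S) \<and> gaussian_radon \<rho> \<and>
     convolve (distr \<mu>1 borel S) \<rho> = \<mu>2"

definition mehler :: "('a \<Rightarrow> 'b::banach) \<Rightarrow> 'b measure \<Rightarrow> ('b \<Rightarrow> real) \<Rightarrow> 'a \<Rightarrow> real" where
  "mehler S \<rho> f x = (\<integral>y. f (S x + y) \<partial>\<rho>)"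

definition mehler_extension ::
  "'a::banach measure \<Rightarrow> 'b::banach measure \<Rightarrow> ('a \<Rightarrow> 'b) \<Rightarrow> 'b measure \<Rightarrow>
   (('b \<Rightarrow> real) \<Rightarrow> 'a \<Rightarrow> real) \<Rightarrow> bool" where
  "mehler_extension \<mu>1 \<mu>2 S \<rho> P \<longleftrightarrow> L2_contraction \<mu>2 \<mu>1 P \<and>
     (\<forall>f\<in>borel_measurable borel. bounded (range f) \<longrightarrow> (AE x in \<mu>1. P f x = mehler S \<rho> f x))"

section \<open>Fock space\<close>

text \<open>All tensor powers of \<open>H\<close> are realised at once, as mutually orthogonal closed subspaces of one
  Hilbert space \<open>'f\<close> (the full Fock space); \<open>tens [h\<^sub>1, \<dots>, h\<^sub>n]\<close> is
  \<open>h\<^sub>1 \<otimes> \<cdots> \<otimes> h\<^sub>n\<close>, and \<open>tens []\<close> is the unit of the zeroth power, the scalars.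
  Multilinearity of \<open>tens\<close> follows from the inner product formula. The two clauses determine
  \<open>('f, tens)\<close> up to a unique isometric isomorphism.\<close>

definition hilbert_tensor_powers ::
  "('h::{real_inner,banach} list \<Rightarrow> 'f::{real_inner,banach}) \<Rightarrow> bool" where
  "hilbert_tensor_powers tens \<longleftrightarrow>
     (\<forall>hs gs. inner (tens hs) (tens gs) =
        (if length hs = length gs then \<Prod>i<length hs. inner (hs ! i) (gs ! i) else 0)) \<and>
     closure (span (range tens)) = UNIV"

text \<open>Operators on the \<open>n\<close>-th tensor power are extended by zero to the other powers.\<close>

definition symmetriser ::
  "('h::{real_inner,banach} list \<Rightarrow> 'f::{real_inner,banach}) \<Rightarrow> nat \<Rightarrow> 'f \<Rightarrow>\<^sub>L 'f" where
  "symmetriser tens n = (THE A. \<forall>hs. blinfun_apply A (tens hs) =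
     (if length hs = n
      then (1 / fact n) *\<^sub>R (\<Sum>\<sigma> | \<sigma> permutes {..<n}. tens (permute_list \<sigma> hs)) else 0))"

definition sym_power ::
  "('h::{real_inner,banach} list \<Rightarrow> 'f::{real_inner,banach}) \<Rightarrow> nat \<Rightarrow> 'f set" where
  "sym_power tens n = range (blinfun_apply (symmetriser tens n))"

definition sym_fock ::
  "('h::{real_inner,banach} list \<Rightarrow> 'f::{real_inner,banach}) \<Rightarrow> (nat \<Rightarrow> 'f) set" where
  "sym_fock tens = {\<xi>. (\<forall>n. \<xi> n \<in> sym_power tens n) \<and> summable (\<lambda>n. (norm (\<xi> n))\<^sup>2)}"

definition tensor_power_map ::
  "('h::{real_inner,banach} list \<Rightarrow> 'f::{real_inner,banach}) \<Rightarrow>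
   ('k::{real_inner,banach} list \<Rightarrow> 'g::{real_inner,banach}) \<Rightarrow> nat \<Rightarrow> ('h \<Rightarrow> 'k) \<Rightarrow> 'f \<Rightarrow>\<^sub>L 'g" where
  "tensor_power_map tens tens' n R = (THE A. \<forall>hs. blinfun_apply A (tens hs) =
     (if length hs = n then tens' (map R hs) else 0))"

definition second_quantisation ::
  "('h::{real_inner,banach} list \<Rightarrow> 'f::{real_inner,banach}) \<Rightarrow>
   ('k::{real_inner,banach} list \<Rightarrow> 'g::{real_inner,banach}) \<Rightarrow>
   ('h \<Rightarrow> 'k) \<Rightarrow> (nat \<Rightarrow> 'f) \<Rightarrow> nat \<Rightarrow> 'g" where
  "second_quantisation tens tens' R \<xi> = (\<lambda>n. blinfun_apply (tensor_power_map tens tens' n R) (\<xi> n))"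

section \<open>Stochastic integrals\<close>

definition hermite :: "nat \<Rightarrow> real poly" where
  "hermite = (THE H. \<forall>x t. (\<lambda>n. t ^ n / fact n * poly (H n) x) sums exp (t * x - t\<^sup>2 / 2))"

text \<open>The index set \<open>J\<close> allows for finite-dimensional spaces.\<close>

definition orthonormal_basis_on :: "nat set \<Rightarrow> (nat \<Rightarrow> 'h::{real_inner,banach}) \<Rightarrow> bool" where
  "orthonormal_basis_on J e \<longleftrightarrow>
     (\<forall>i\<in>J. \<forall>k\<in>J. inner (e i) (e k) = (if i = k then 1 else 0)) \<and>
     closure (span (e ` J)) = UNIV"

text \<open>\<open>js = [j\<^sub>1, \<dots>, j\<^sub>m]\<close> and \<open>ks = [k\<^sub>1, \<dots>, k\<^sub>m]\<close>, so that the \<open>concat\<close> expression is the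
  list of factors of \<open>h\<^bsub>j\<^sub>1\<^esub>\<^bsup>\<otimes>k\<^sub>1\<^esup> \<otimes> \<cdots> \<otimes> h\<^bsub>j\<^sub>m\<^esub>\<^bsup>\<otimes>k\<^sub>m\<^esup>\<close>.\<close>

definition stochastic_integral ::
  "'a::banach measure \<Rightarrow> ('h::{real_inner,banach} list \<Rightarrow> 'f::{real_inner,banach}) \<Rightarrow>
   nat set \<Rightarrow> (nat \<Rightarrow> 'h) \<Rightarrow> ('h \<Rightarrow> 'a \<Rightarrow> real) \<Rightarrow> nat \<Rightarrow> ('f \<Rightarrow> 'a \<Rightarrow> real) \<Rightarrow> bool" where
  "stochastic_integral \<mu> tens J e \<phi> n I \<longleftrightarrow>
     L2_linear_on (sym_power tens n) \<mu> I \<and>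
     (\<exists>C. \<forall>u\<in>sym_power tens n. L2norm \<mu> (I u) \<le> C * norm u) \<and>
     (\<forall>js ks. sorted_wrt (<) js \<longrightarrow> set js \<subseteq> J \<longrightarrow> length ks = length js \<longrightarrow> sum_list ks = n \<longrightarrow>
        (AE x in \<mu>.
           I (blinfun_apply (symmetriser tens n)
                (tens (concat (map2 (\<lambda>i k. replicate k (e i)) js ks)))) x =
           (\<Prod>l<length js. poly (hermite (ks ! l)) (\<phi> (e (js ! l)) x))))"

text \<open>\<open>W\<close> is the direct sum of the operators \<open>I\<^sub>n / \<surd>n!\<close>; the sum converges in \<open>L\<^sup>2\<close>.\<close>

definition wiener_ito ::
  "'a::banach measure \<Rightarrow> ('h::{real_inner,banach} list \<Rightarrow> 'f::{real_inner,banach}) \<Rightarrow>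
   (nat \<Rightarrow> 'f \<Rightarrow> 'a \<Rightarrow> real) \<Rightarrow> ((nat \<Rightarrow> 'f) \<Rightarrow> 'a \<Rightarrow> real) \<Rightarrow> bool" where
  "wiener_ito \<mu> tens I W \<longleftrightarrow>
     (\<forall>\<xi>\<in>sym_fock tens. W \<xi> \<in> L2space \<mu> \<and>
        (\<lambda>N. L2norm \<mu> (\<lambda>x. W \<xi> x - (\<Sum>n<N. 1 / sqrt (fact n) * I n (\<xi> n) x))) \<longlonglongrightarrow> 0)"

end

theory Submission
  imports Defs
begin

text \<open>Both sides of the identity are bounded and linear on each symmetric power, so by polarisation and
  density it suffices to compare them on \<open>h \<otimes> \<cdots> \<otimes> h\<close> with \<open>h = j\<^sub>2\<^sup>* x\<^sup>*\<close>. There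
  \<open>I\<^sub>n\<close> is the Hermite polynomial of \<open>\<phi>\<^sub>h\<close> with variance parameter \<open>\<parallel>h\<parallel>\<^sup>2\<close>, and the claim becomes
  \<open>\<integral> H\<^sub>n(c + \<langle>y, x\<^sup>*\<rangle>) \<rho>(dy) = H\<^sub>n(c)\<close> with variance parameters \<open>\<parallel>h\<parallel>\<^sup>2\<close> on the left and
  \<open>\<parallel>T\<^sup>* h\<parallel>\<^sup>2\<close> on the right. This follows by comparing generating functions, since the
  convolution identity makes \<open>\<langle>y, x\<^sup>*\<rangle>\<close> Gaussian of variance \<open>\<parallel>h\<parallel>\<^sup>2 - \<parallel>T\<^sup>* h\<parallel>\<^sup>2\<close> under \<open>\<rho>\<close>.

  It remains to see that \<open>\<langle>S x, x\<^sup>*\<rangle> = \<phi>\<^bsub>T\<^sup>* h\<^esub>(x)\<close> almost everywhere. The difference is odd and, by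
  linearity of \<open>S\<close>, invariant under shifts along \<open>j\<^sub>1 j\<^sub>1\<^sup>*\<close>. By the Cameron--Martin formula a bounded
  shift invariant \<open>F\<close> satisfies
  \<open>\<integral> F exp \<langle>x, y\<^sup>*\<rangle> d\<mu> = \<integral> F d\<mu> \<cdot> \<integral> exp \<langle>x, y\<^sup>*\<rangle> d\<mu>\<close> for all \<open>y\<^sup>*\<close>, hence is constant, because a Radon
  measure is determined by these exponential integrals (Hahn--Banach and Stone--Weierstrass).\<close>

text \<open>Several objects are known by specification only, and this shapes the proof.
  \<open>hermite\<close>, \<open>symmetriser\<close>, \<open>tensor_power_map\<close> and
  \<open>dual_map\<close> are definite descriptions and \<open>adjoint\<close> is a choice, so each
  needs a witness first. A map on elementary tensors extends to a contraction as soon as the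
  difference of the Gram kernels is positive semidefinite; for tensor powers this is a Schur product
  argument. \<open>I\<close> is prescribed on symmetrised products of basis vectors,
  \<open>P\<close> on bounded functions, and \<open>S\<close> is linear on a subspace of full
  measure. Hence powers of a general vector are expanded along the basis, Hermite polynomials reach
  \<open>P\<close> by truncation, and a functional composed with \<open>S\<close>, which need not be
  continuous, is recognised by its shifts and its oddness. On nonseparable spaces addition need not
  be jointly measurable, so convolutions are evaluated through one functional at a time. Real
  exponentials are the test functions because the Cameron--Martin density is a multiple of one;
  being unbounded, they give way to cosines and sines where an algebra is required.\<close>

lemma powser_coeffs_unique:
  fixes a b :: "nat \<Rightarrow> real"
  assumes "\<And>t. (\<lambda>n. a n * t ^ n) sums f t" "\<And>t. (\<lambda>n. b n * t ^ n) sums f t"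
  shows "a = b"
proof -
  define c where "c n = a n - b n" for n
  have c: "(\<lambda>n. c n * t ^ n) sums 0" for t
    using sums_diff[OF assms(1)[of t] assms(2)[of t]] by (simp add: c_def algebra_simps)
  have "c n = 0" for n
  proof (induction n rule: less_induct)
    case (less n)
    \<comment> \<open>After division by \<open>t ^ n\<close> the series sums to 0 off the origin and
      to its constant term at the origin; a power series is continuous there.\<close>
    have "(\<lambda>k. c (k + n) * t ^ k) sums (if t = 0 then c n else 0)" for t
    proof (cases "t = 0")
      case True
      then show ?thesis using powser_sums_zero[of "\<lambda>k. c (k + n)"] by simp
    next
      case False
      have "(\<lambda>k. c (k + n) * t ^ (k + n)) sums 0"
        using c[of t] less by (subst sums_iff_shift) simp
      from sums_mult2[OF this, of "1 / t ^ n"] show ?thesis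
        using False by (simp add: power_add field_simps)
    qed
    from powser_limit_0[OF zero_less_one this] have "((\<lambda>t::real. if t = 0 then c n else 0) \<longlongrightarrow> c n) (at 0)"
      by simp
    moreover have "((\<lambda>t::real. if t = 0 then c n else 0) \<longlongrightarrow> 0) (at 0)"
      by (rule Lim_transform_eventually[OF tendsto_const]) (auto simp: eventually_at_filter)
    ultimately show "c n = 0" using LIM_unique by blast
  qed
  then show ?thesis by (simp add: c_def fun_eq_iff)
qed

section \<open>Hermite polynomials with a variance parameter\<close>

text \<open>The Taylor coefficients in \<open>t\<close> of
  \<open>exp (- (a * t\<^sup>2 / 2))\<close>.\<close>

definition gauss_coeff :: "real \<Rightarrow> nat \<Rightarrow> real" where
  "gauss_coeff a i = (if even i then (- a / 2) ^ (i div 2) / fact (i div 2) else 0)"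

lemma gauss_coeff_sums: "(\<lambda>i. gauss_coeff a i * t ^ i) sums exp (- (a * t\<^sup>2 / 2))"
proof -
  have "(\<lambda>n. (- (a * t\<^sup>2 / 2)) ^ n / fact n) sums exp (- (a * t\<^sup>2 / 2))"
    using exp_converges[of "- (a * t\<^sup>2 / 2)"] by (simp add: field_simps)
  from sums_if[OF sums_zero this]
  have "(\<lambda>n. if even n then (- (a * t\<^sup>2 / 2)) ^ (n div 2) / fact (n div 2) else 0)
      sums exp (- (a * t\<^sup>2 / 2))" by simp
  moreover have "(if even n then (- (a * t\<^sup>2 / 2)) ^ (n div 2) / fact (n div 2) else 0)
      = gauss_coeff a n * t ^ n" for n
  proof (cases "even n")
    case True
    have "t ^ n = (t\<^sup>2) ^ (n div 2)" using True by (simp flip: power_mult)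
    moreover have "(- (a * t\<^sup>2 / 2)) ^ (n div 2) = (- a / 2) ^ (n div 2) * (t\<^sup>2) ^ (n div 2)"
      by (simp flip: power_mult_distrib)
    ultimately show ?thesis using True by (simp add: gauss_coeff_def)
  qed (simp add: gauss_coeff_def)
  ultimately show ?thesis by simp
qed

text \<open>Absolute values of the coefficients again belong to a Gaussian series, now with a
  nonpositive parameter. All majorants for Hermite sums come from this.\<close>

lemma abs_gauss_coeff: "\<bar>gauss_coeff a i\<bar> = gauss_coeff (- \<bar>a\<bar>) i"
  by (simp add: gauss_coeff_def power_abs[symmetric]) (simp add: power_abs)

text \<open>For \<open>a > 0\<close> this is \<open>H_n (y / sqrt a)\<close> times the
  \<open>n\<close>-th power of \<open>sqrt a\<close>. Written as a Cauchy coefficient it also covers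
  \<open>a = 0\<close>, where it is \<open>y ^ n\<close>, and the negative parameters of the
  majorants.\<close>

definition scaled_hermite :: "real \<Rightarrow> nat \<Rightarrow> real \<Rightarrow> real" where
  "scaled_hermite a n y = fact n * (\<Sum>i\<le>n. gauss_coeff a i * (y ^ (n - i) / fact (n - i)))"

lemma scaled_hermite_summable_abs:
  shows "summable (\<lambda>i. norm (gauss_coeff a i * t ^ i))"
    "summable (\<lambda>i. norm ((t * y) ^ i / fact i))"
proof -
  show "summable (\<lambda>i. norm (gauss_coeff a i * t ^ i))"
    using gauss_coeff_sums[of "- \<bar>a\<bar>" "\<bar>t\<bar>"]
    by (simp add: abs_mult abs_gauss_coeff power_abs sums_iff)
  show "summable (\<lambda>i. norm ((t * y) ^ i / fact i))"
    using summable_norm_exp[of "t * y"] by (simp add: field_simps)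
qed

lemma scaled_hermite_sums:
  "(\<lambda>n. t ^ n / fact n * scaled_hermite a n y) sums exp (t * y - a * t\<^sup>2 / 2)"
proof -
  have e: "(\<lambda>n. (t * y) ^ n / fact n) sums exp (t * y)"
    using exp_converges[of "t * y"] by (simp add: field_simps)
  have "(\<lambda>k. \<Sum>i\<le>k. gauss_coeff a i * t ^ i * ((t * y) ^ (k - i) / fact (k - i)))
      sums (exp (- (a * t\<^sup>2 / 2)) * exp (t * y))"
    using Cauchy_product_sums[OF scaled_hermite_summable_abs]
      gauss_coeff_sums[of a t] e by (simp add: sums_iff)
  moreover have "(\<Sum>i\<le>k. gauss_coeff a i * t ^ i * ((t * y) ^ (k - i) / fact (k - i)))
     = t ^ k / fact k * scaled_hermite a k y" for k
    unfolding scaled_hermite_def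
    by (simp add: sum_distrib_left power_mult_distrib,
        intro sum.cong refl) (simp add: field_simps flip: power_add)
  ultimately show ?thesis by (simp add: exp_add[symmetric] algebra_simps)
qed

text \<open>Identities between Hermite polynomials are obtained below by comparing generating
  functions, not by recursion.\<close>

lemma scaled_hermite_unique:
  assumes "\<And>t. (\<lambda>n. t ^ n / fact n * c n) sums exp (t * y - a * t\<^sup>2 / 2)"
  shows "c n = scaled_hermite a n y"
proof -
  have "(\<lambda>n. c n / fact n) = (\<lambda>n. scaled_hermite a n y / fact n)"
    using assms scaled_hermite_sums[of _ a y]
    by (intro powser_coeffs_unique) (simp_all add: mult.commute)
  then show ?thesis by (simp add: fun_eq_iff)
qed

lemma poly_hermite: "poly (hermite n) x = scaled_hermite 1 n x"
proof -
  \<comment> \<open>The witness for the definite description: \<open>scaled_hermite 1 n\<close> as a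
    formal polynomial. It is unique because a real polynomial is determined by its values.\<close>
  define H where "H n = smult (fact n) (\<Sum>i\<le>n. monom (gauss_coeff 1 i / fact (n - i)) (n - i))" for n
  have H: "poly (H n) x = scaled_hermite 1 n x" for n x
    by (simp add: H_def scaled_hermite_def poly_sum poly_monom)
  have "hermite = H"
    unfolding hermite_def
  proof (rule the_equality)
    show "\<forall>x t. (\<lambda>n. t ^ n / fact n * poly (H n) x) sums exp (t * x - t\<^sup>2 / 2)"
      using scaled_hermite_sums[of _ 1] by (simp add: H)
    fix K :: "nat \<Rightarrow> real poly"
    assume K: "\<forall>x t. (\<lambda>n. t ^ n / fact n * poly (K n) x) sums exp (t * x - t\<^sup>2 / 2)"
    have "poly (K n) x = poly (H n) x" for n x
      unfolding H by (rule scaled_hermite_unique) (use K in simp)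
    then show "K = H" by (metis poly_eq_poly_eq_iff ext)
  qed
  then show ?thesis by (metis H)
qed

text \<open>The Hermite value that belongs to the zero vector, at which the expansion along a basis
  ends.\<close>

lemma scaled_hermite_0_0: "scaled_hermite 0 n 0 = (if n = 0 then 1 else 0)"
proof -
  have "(if n = 0 then 1 else 0) = scaled_hermite 0 n 0"
  proof (rule scaled_hermite_unique)
    fix t :: real
    show "(\<lambda>n. t ^ n / fact n * (if n = 0 then 1 else 0)) sums exp (t * 0 - 0 * t\<^sup>2 / 2)"
      using sums_single[of 0 "\<lambda>n. t ^ n / fact n"] by (auto simp: if_distrib cong: if_cong)
  qed
  then show ?thesis by simp
qed

lemma abs_scaled_hermite_le: "\<bar>scaled_hermite a n y\<bar> \<le> scaled_hermite (- \<bar>a\<bar>) n \<bar>y\<bar>"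
  unfolding scaled_hermite_def abs_mult
  by (auto intro!: mult_left_mono sum_abs[THEN order_trans] sum_mono
      simp: abs_mult abs_gauss_coeff power_abs)

text \<open>The majorants at \<open>- \<bar>a\<bar>\<close> and \<open>\<bar>y\<bar>\<close> are
  nonnegative and sum to the right-hand side. Independence of \<open>N\<close> is what termwise
  integration needs.\<close>

lemma sum_abs_scaled_hermite_le:
  "(\<Sum>n<N. \<bar>t ^ n / fact n * scaled_hermite a n y\<bar>) \<le> exp (\<bar>t * y\<bar> + \<bar>a\<bar> * t\<^sup>2 / 2)"
proof -
  have s: "(\<lambda>n. \<bar>t\<bar> ^ n / fact n * scaled_hermite (- \<bar>a\<bar>) n \<bar>y\<bar>) sums exp (\<bar>t * y\<bar> + \<bar>a\<bar> * t\<^sup>2 / 2)"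
    using scaled_hermite_sums[of "\<bar>t\<bar>" "- \<bar>a\<bar>" "\<bar>y\<bar>"] by (simp add: abs_mult)
  have le: "\<bar>t ^ n / fact n * scaled_hermite a n y\<bar> \<le> \<bar>t\<bar> ^ n / fact n * scaled_hermite (- \<bar>a\<bar>) n \<bar>y\<bar>" for n
    using abs_scaled_hermite_le[of a n y] by (simp add: abs_mult power_abs divide_right_mono mult_left_mono)
  show ?thesis
    by (rule order_trans[OF sum_mono[OF le]], use sum_le_suminf[of "\<lambda>n. \<bar>t\<bar> ^ n / fact n * scaled_hermite (- \<bar>a\<bar>) n \<bar>y\<bar>" "{..<N}"] s order_trans[OF abs_ge_zero le] in \<open>auto simp: sums_iff\<close>)
qed

text \<open>A single term of the preceding sum at \<open>t = 1\<close>.\<close>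

lemma abs_scaled_hermite_le_exp: "\<bar>scaled_hermite a n y\<bar> \<le> fact n * exp (\<bar>a\<bar> / 2) * exp \<bar>y\<bar>"
proof -
  have "\<bar>scaled_hermite a n y\<bar> / fact n \<le> (\<Sum>k<Suc n. \<bar>1 ^ k / fact k * scaled_hermite a k y\<bar>)"
    using member_le_sum[of n "{..<Suc n}" "\<lambda>k. \<bar>1 ^ k / fact k * scaled_hermite a k y\<bar>"]
    by (simp add: abs_mult)
  also have "\<dots> \<le> exp (\<bar>y\<bar> + \<bar>a\<bar> / 2)"
    using sum_abs_scaled_hermite_le[of 1 a y "Suc n"] by simp
  finally show ?thesis by (simp add: divide_le_eq exp_add mult_ac)
qed

text \<open>The generating function splits into the one with parameter 1 at \<open>s * t\<close> and
  the one with parameter \<open>c\<close> at \<open>t\<close>. This mirrors the binomial expansion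
  of the \<open>m\<close>-th power of \<open>s h + v\<close> for a unit vector \<open>h\<close>
  orthogonal to \<open>v\<close>: the variances add.\<close>

lemma scaled_hermite_binomial:
  fixes s :: real
  shows
  "scaled_hermite (s\<^sup>2 + c) m (s * y + z) =
     (\<Sum>k\<le>m. (m choose k) * s ^ k * scaled_hermite 1 k y * scaled_hermite c (m - k) z)"
proof -
  have sm: "summable (\<lambda>n. norm (t ^ n / fact n * scaled_hermite a n y))" for t a y
    unfolding real_norm_def
    by (rule summableI_nonneg_bounded[OF _ sum_abs_scaled_hermite_le]) simp
  have "(\<Sum>k\<le>m. (m choose k) * s ^ k * scaled_hermite 1 k y * scaled_hermite c (m - k) z)
      = scaled_hermite (s\<^sup>2 + c) m (s * y + z)"
  proof (rule scaled_hermite_unique)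
    fix t :: real
    have "(\<lambda>m. \<Sum>k\<le>m. (s * t) ^ k / fact k * scaled_hermite 1 k y *
               (t ^ (m - k) / fact (m - k) * scaled_hermite c (m - k) z))
        sums (exp (s * t * y - 1 * (s * t)\<^sup>2 / 2) * exp (t * z - c * t\<^sup>2 / 2))"
      using Cauchy_product_sums[OF sm sm, of "s * t" 1 y t c z]
        scaled_hermite_sums[of "s * t" 1 y] scaled_hermite_sums[of t c z]
      by (simp only: sums_iff)
    moreover have "(\<Sum>k\<le>m. (s * t) ^ k / fact k * scaled_hermite 1 k y *
               (t ^ (m - k) / fact (m - k) * scaled_hermite c (m - k) z)) =
        t ^ m / fact m * (\<Sum>k\<le>m. (m choose k) * s ^ k * scaled_hermite 1 k y * scaled_hermite c (m - k) z)" for m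
      unfolding sum_distrib_left
    proof (intro sum.cong refl)
      fix k assume "k \<in> {..m}"
      then have k: "k \<le> m" by simp
      have "t ^ m = t ^ k * t ^ (m - k)" using k by (simp flip: power_add)
      then show "(s * t) ^ k / fact k * scaled_hermite 1 k y * (t ^ (m - k) / fact (m - k) * scaled_hermite c (m - k) z)
        = t ^ m / fact m * ((m choose k) * s ^ k * scaled_hermite 1 k y * scaled_hermite c (m - k) z)"
        using k by (simp add: binomial_fact power_mult_distrib)
    qed
    ultimately show "(\<lambda>m. t ^ m / fact m * (\<Sum>k\<le>m. (m choose k) * s ^ k * scaled_hermite 1 k y * scaled_hermite c (m - k) z))
        sums exp (t * (s * y + z) - (s\<^sup>2 + c) * t\<^sup>2 / 2)"
      by (simp add: exp_add[symmetric] algebra_simps power_mult_distrib add_divide_distrib)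
  qed
  then show ?thesis by simp
qed

section \<open>Continuous functionals separate points\<close>

text \<open>Functionals are represented by their graphs. A value at \<open>z\<close> is admissible
  if it lies above every \<open>r - norm (u - z)\<close> and below every
  \<open>norm (v + z) - s\<close>; the triangle inequality leaves room for the supremum of the lower
  bounds.\<close>

lemma hahn_banach_step:
  fixes G :: "('a::real_normed_vector \<times> real) set"
  assumes G: "subspace G" and le: "\<And>u r. (u, r) \<in> G \<Longrightarrow> r \<le> norm u"
  shows "\<exists>c. \<forall>(u, r) \<in> span (insert (z, c) G). r \<le> norm u"
proof -
  define L where "L = {- norm (u + z) - r |u r. (u, - r) \<in> G}"
  have cross: "r - norm (u - z) \<le> norm (v + z) - s" if "(u, r) \<in> G" "(v, s) \<in> G" for u r v s
  proof -
    have "(u + v, r + s) \<in> G" using subspace_add[OF G that] by simp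
    from le[OF this] have "r + s \<le> norm (u + v)" .
    also have "\<dots> = norm ((u - z) + (v + z))" by simp
    also have "\<dots> \<le> norm (u - z) + norm (v + z)" by (rule norm_triangle_ineq)
    finally show ?thesis by simp
  qed
  define A where "A = {r - norm (u - z) |u r. (u, r) \<in> G}"
  have G0: "(0, 0) \<in> G" using subspace_0[OF G] by (simp add: zero_prod_def)
  have bdd: "bdd_above A" using cross[OF _ G0] by (auto simp: A_def intro!: bdd_aboveI)
  define c where "c = Sup A"
  have c1: "r - norm (u - z) \<le> c" if "(u, r) \<in> G" for u r
    unfolding c_def using bdd that by (intro cSup_upper) (auto simp: A_def)
  have c2: "c \<le> norm (v + z) - s" if "(v, s) \<in> G" for v s
    unfolding c_def using G0 cross[OF _ that] by (intro cSup_least) (auto simp: A_def)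
  have sc: "(k *\<^sub>R u, k * r) \<in> G" if "(u, r) \<in> G" for k u r
    using subspace_scale[OF G that, of k] by simp
  have "r \<le> norm u" if "(u, r) \<in> span (insert (z, c) G)" for u r
  proof -
    from that obtain t where "(u, r) - t *\<^sub>R (z, c) \<in> span G"
      unfolding span_insert by blast
    then have t: "(u - t *\<^sub>R z, r - t * c) \<in> G"
      using span_eq_iff[THEN iffD2, OF G] by simp
    \<comment> \<open>Rescaling by \<open>1 / t\<close> reduces positive \<open>t\<close> to the
      upper bounds \<open>c2\<close>; rescaling by \<open>- 1 / t\<close> reduces negative
      \<open>t\<close> to the lower bounds \<open>c1\<close>.\<close>
    consider "t = 0" | "t > 0" | "t < 0" by linarith
    then show ?thesis
    proof cases
      case 1
      then show ?thesis using le[OF t] by simp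
    next
      case 2
      from c2[OF sc[OF t, of "1 / t"]] 2
      have "c \<le> norm ((1 / t) *\<^sub>R u) - (r / t - c)" by (simp add: algebra_simps diff_divide_distrib)
      then have "r / t \<le> norm u / t" using 2 by simp
      then show ?thesis using 2 by (simp add: divide_le_cancel)
    next
      case 3
      from c1[OF sc[OF t, of "- 1 / t"]] 3
      have "- r / t + c - norm (- ((1 / t) *\<^sub>R u)) \<le> c" by (simp add: algebra_simps diff_divide_distrib)
      then have "- r / t \<le> norm u / - t" using 3 by simp
      then show ?thesis using 3 by (simp add: divide_simps split: if_splits)
    qed
  qed
  then show ?thesis by blast
qed

theorem hahn_banach_norm:
  fixes x :: "'a::real_normed_vector"
  shows "\<exists>f :: 'a \<Rightarrow>\<^sub>L real. blinfun_apply f x = norm x"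
proof -
  define \<A> where "\<A> = {G :: ('a \<times> real) set. subspace G \<and> (x, norm x) \<in> G \<and> (\<forall>(u, r)\<in>G. r \<le> norm u)}"
  have G0: "span {(x, norm x)} \<in> \<A>"
  proof -
    have "k * norm x \<le> norm (k *\<^sub>R x)" for k
      by (simp add: mult_right_mono)
    then have "\<forall>(u, r)\<in>span {(x, norm x)}. r \<le> norm u" by (auto simp: span_singleton)
    then show ?thesis by (auto simp: \<A>_def intro: span_base)
  qed
  have "\<exists>M\<in>\<A>. \<forall>X\<in>\<A>. M \<subseteq> X \<longrightarrow> X = M"
  proof (rule subset_Zorn_nonempty)
    show "\<A> \<noteq> {}" using G0 by blast
    fix C assume C: "C \<noteq> {}" "subset.chain \<A> C"
    then have sub: "C \<subseteq> \<A>" and ch: "\<And>X Y. X \<in> C \<Longrightarrow> Y \<in> C \<Longrightarrow> X \<subseteq> Y \<or> Y \<subseteq> X"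
      by (auto simp: subset_chain_def)
    have "subspace (\<Union>C)"
    proof (rule subspaceI)
      show "0 \<in> \<Union>C" using C(1) sub by (fastforce simp: \<A>_def dest: subspace_0)
      show "c *\<^sub>R y \<in> \<Union>C" if "y \<in> \<Union>C" for c y
        using that sub by (auto simp: \<A>_def intro: subspace_scale)
      show "y + y' \<in> \<Union>C" if "y \<in> \<Union>C" "y' \<in> \<Union>C" for y y'
      proof -
        from that obtain X Y where XY: "X \<in> C" "y \<in> X" "Y \<in> C" "y' \<in> Y" by blast
        with ch[of X Y] obtain Z where "Z \<in> C" "y \<in> Z" "y' \<in> Z" by blast
        then show ?thesis using sub by (auto simp: \<A>_def intro: subspace_add)
      qed
    qed
    then show "\<Union>C \<in> \<A>" using C(1) sub by (fastforce simp: \<A>_def)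
  qed
  then obtain M where M: "M \<in> \<A>" and max: "\<And>X. X \<in> \<A> \<Longrightarrow> M \<subseteq> X \<Longrightarrow> X = M" by blast
  have Ms: "subspace M" and Mx: "(x, norm x) \<in> M" and Mle: "\<And>u r. (u, r) \<in> M \<Longrightarrow> r \<le> norm u"
    using M by (auto simp: \<A>_def)
  \<comment> \<open>The one-sided bound becomes two-sided because \<open>M\<close> contains
    negatives. At the vector 0 it forces the value 0, so single-valuedness need not be built into
    \<open>\<A>\<close>.\<close>
  have Mabs: "\<bar>r\<bar> \<le> norm u" if "(u, r) \<in> M" for u r
    using Mle[OF that] Mle[of "- u" "- r"] subspace_neg[OF Ms that] by simp
  have total: "\<exists>r. (z, r) \<in> M" for z
  proof -
    obtain c where c: "\<forall>(u, r) \<in> span (insert (z, c) M). r \<le> norm u"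
      using hahn_banach_step[OF Ms Mle] by blast
    have "M \<subseteq> span (insert (z, c) M)" by (meson span_superset subset_insertI subset_trans)
    moreover from this c Mx have "span (insert (z, c) M) \<in> \<A>" by (auto simp: \<A>_def)
    ultimately have "span (insert (z, c) M) = M" using max by blast
    then show ?thesis by (metis insertI1 span_base)
  qed
  have uniq: "r = s" if "(z, r) \<in> M" "(z, s) \<in> M" for z r s
    using Mabs[of 0 "r - s"] subspace_diff[OF Ms that] by simp
  define f where "f z = (THE r. (z, r) \<in> M)" for z
  have f: "(z, f z) \<in> M" for z
    unfolding f_def using total[of z] uniq by (metis theI)
  have fI: "f z = r" if "(z, r) \<in> M" for z r using uniq[OF f that] .
  have "bounded_linear f"
  proof (rule bounded_linear_intro[where K = 1])
    show "f (a + b) = f a + f b" for a b using fI subspace_add[OF Ms f[of a] f[of b]] by simp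
    show "f (c *\<^sub>R a) = c *\<^sub>R f a" for a c using fI subspace_scale[OF Ms f[of a], of c] by simp
    show "norm (f a) \<le> norm a * 1" for a using Mabs[OF f[of a]] by simp
  qed
  then show ?thesis using fI[OF Mx] by (intro exI[of _ "Blinfun f"]) (simp add: bounded_linear_Blinfun_apply)
qed

section \<open>Uniqueness of tight measures\<close>

text \<open>The consequence of the Radon property that passes to densities and continuous images and
  suffices for uniqueness. Total mass is left free because measures of the form
  \<open>F d\<mu>\<close> are compared.\<close>

definition tight_measure :: "'a::topological_space measure \<Rightarrow> bool" where
  "tight_measure M \<longleftrightarrow> finite_measure M \<and> sets M = sets borel \<and>
     (\<forall>e>0. \<exists>K. compact K \<and> measure M (- K) < e)"

text \<open>Stone--Weierstrass controls an element \<open>g\<close> of \<open>R\<close> only on a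
  compact set, and \<open>g\<close> may be large outside it. Composition with a polynomial close to
  truncation at 0 and 1 on the range of \<open>g\<close> stays in \<open>R\<close> and is nearly
  bounded by 1 everywhere, so the small complement contributes little.\<close>

lemma integral_eq_of_algebra:
  fixes M N :: "'a::metric_space measure" and R :: "('a \<Rightarrow> real) set"
  assumes M: "tight_measure M" and N: "tight_measure N"
    and cont: "\<And>f. f \<in> R \<Longrightarrow> continuous_on UNIV f" and bdd: "\<And>f. f \<in> R \<Longrightarrow> bounded (range f)"
    and add: "\<And>f g. f \<in> R \<Longrightarrow> g \<in> R \<Longrightarrow> (\<lambda>x. f x + g x) \<in> R"
    and mult: "\<And>f g. f \<in> R \<Longrightarrow> g \<in> R \<Longrightarrow> (\<lambda>x. f x * g x) \<in> R"
    and const: "\<And>c. (\<lambda>x. c) \<in> R"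
    and sep: "\<And>x y. x \<noteq> y \<Longrightarrow> \<exists>f\<in>R. f x \<noteq> f y"
    and eq: "\<And>f. f \<in> R \<Longrightarrow> (\<integral>x. f x \<partial>M) = (\<integral>x. f x \<partial>N)"
    and f: "continuous_on UNIV (f :: 'a \<Rightarrow> real)" "\<And>x. 0 \<le> f x" "\<And>x. f x \<le> 1"
  shows "(\<integral>x. f x \<partial>M) = (\<integral>x. f x \<partial>N)"
proof -
  have poly: "(\<lambda>x. q (g x)) \<in> R" if "real_polynomial_function q" "g \<in> R"
    for q :: "real \<Rightarrow> real" and g :: "'a \<Rightarrow> real"
    using that(1)
  proof (induction rule: real_polynomial_function.induct)
    case (linear h)
    then obtain c where "h = (\<lambda>x. x * c)" using real_bounded_linear by blast
    then show ?case using mult[OF that(2) const[of c]] by simp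
  qed (auto intro: const add mult)
  \<comment> \<open>For each of the two measures the error is \<open>2 * e\<close> times the total
    mass, plus at most \<open>e\<close> from the complement of the compact set.\<close>
  have approx: "\<bar>(\<integral>x. f x \<partial>M) - (\<integral>x. f x \<partial>N)\<bar> \<le> e * (2 * measure M UNIV + 2 * measure N UNIV + 2)"
    if e: "0 < e" "e \<le> 1" for e
  proof -
    obtain K1 K2 where K: "compact K1" "measure M (- K1) < e" "compact K2" "measure N (- K2) < e"
      using M N e unfolding tight_measure_def by meson
    define K where "K = K1 \<union> K2"
    have cK: "compact K" using K by (auto simp: K_def)
    interpret function_ring_on R K
      by standard (use cK cont add mult const sep in \<open>auto intro: continuous_on_subset\<close>)
    obtain g where g: "g \<in> R" "\<forall>x\<in>K. \<bar>f x - g x\<bar> < e"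
      using Stone_Weierstrass_basic[of f e] e f(1) by (auto intro: continuous_on_subset)
    obtain B where B: "\<And>x. \<bar>g x\<bar> \<le> B"
      using bdd[OF g(1)] by (auto simp: bounded_iff)
    define c where "c y = max 0 (min 1 y)" for y :: real
    have "continuous_on {-B..B} c" unfolding c_def by (intro continuous_intros)
    then obtain q where q: "real_polynomial_function q" "\<And>y. y \<in> {-B..B} \<Longrightarrow> \<bar>c y - q y\<bar> < e"
      using Stone_Weierstrass_real_polynomial_function[of "{-B..B}" c e] e by auto
    define h where "h x = q (g x)" for x
    have hR: "h \<in> R" unfolding h_def using poly q g by blast
    \<comment> \<open>Truncation is 1-Lipschitz and fixes the values of \<open>f\<close>, so on
      \<open>K\<close> the errors of \<open>g\<close> and \<open>q\<close> add up. Off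
      \<open>K\<close> two numbers in the unit interval are compared, at the price of the
      indicator.\<close>
    have near: "\<bar>f x - h x\<bar> \<le> 2 * e + indicator (- K) x" for x
    proof -
      have 1: "\<bar>c (g x) - h x\<bar> < e" unfolding h_def using B[of x] by (intro q) auto
      show ?thesis
      proof (cases "x \<in> K")
        case True
        have "\<bar>f x - c (g x)\<bar> < e" using f(2,3)[of x] g(2) True e unfolding c_def by (auto simp: abs_if split: if_splits)
        then show ?thesis using 1 True by simp
      next
        case False
        have "\<bar>f x - c (g x)\<bar> \<le> 1" using f(2,3)[of x] unfolding c_def by (auto simp: abs_if max_def min_def)
        then show ?thesis using 1 False e by simp
      qed
    qed
    have int: "\<bar>(\<integral>x. f x \<partial>L) - (\<integral>x. h x \<partial>L)\<bar> \<le> 2 * e * measure L UNIV + e"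
      if L: "tight_measure L" "measure L (- K) \<le> e" for L :: "'a measure"
    proof -
      have sL[measurable_cong]: "sets L = sets borel" and "finite_measure L" using L(1) by (auto simp: tight_measure_def)
      interpret finite_measure L by fact
      have spL: "space L = UNIV" using sets_eq_imp_space_eq[OF sL] by simp
      have mf[measurable]: "f \<in> borel_measurable L" "h \<in> borel_measurable L"
        using f(1) cont[OF hR] by (auto simp: measurable_cong_sets[OF sL refl] borel_measurable_continuous_onI)
      have sK: "- K \<in> sets L" using cK by (simp add: sL compact_imp_closed borel_comp)
      then have ind: "integrable L (\<lambda>x. indicator (- K) x :: real)"
        by (intro integrable_real_indicator) (auto simp: less_top[symmetric])
      have [simp]: "integrable L f" using f(2,3) by (intro integrable_const_bound[where B = 1]) auto
      obtain B' where "\<And>x. \<bar>h x\<bar> \<le> B'" using bdd[OF hR] by (auto simp: bounded_iff)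
      then have [simp]: "integrable L h" by (intro integrable_const_bound[where B = B']) auto
      have "\<bar>(\<integral>x. f x \<partial>L) - (\<integral>x. h x \<partial>L)\<bar> = \<bar>\<integral>x. f x - h x \<partial>L\<bar>" by simp
      also have "\<dots> \<le> (\<integral>x. \<bar>f x - h x\<bar> \<partial>L)" by (rule integral_abs_bound)
      also have "\<dots> \<le> (\<integral>x. 2 * e + indicator (- K) x \<partial>L)"
        using near ind by (intro integral_mono integrable_abs Bochner_Integration.integrable_diff
            Bochner_Integration.integrable_add) auto
      also have "\<dots> = 2 * e * measure L UNIV + measure L (- K)"
        using ind sK by (subst Bochner_Integration.integral_add) (auto simp: spL)
      finally show ?thesis using L(2) by simp
    qed
    have mono: "measure L (- K) \<le> measure L (- K')" if "tight_measure L" "K' \<subseteq> K" "compact K'" for L K'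
    proof -
      have sL: "sets L = sets borel" and "finite_measure L" using that(1) by (auto simp: tight_measure_def)
      interpret finite_measure L by fact
      show ?thesis using that(2,3) by (intro finite_measure_mono) (auto simp: sL compact_imp_closed intro!: borel_comp)
    qed
    have "measure M (- K) \<le> e" "measure N (- K) \<le> e"
      using mono[OF M, of K1] mono[OF N, of K2] K by (auto simp: K_def)
    from int[OF M this(1)] int[OF N this(2)] eq[OF hR] show ?thesis by (simp add: algebra_simps)
  qed
  define C where "C = 2 * measure M UNIV + 2 * measure N UNIV + 2"
  have C: "C > 0" by (simp add: C_def add_nonneg_pos)
  have "\<bar>(\<integral>x. f x \<partial>M) - (\<integral>x. f x \<partial>N)\<bar> \<le> 0"
  proof (rule field_le_epsilon)
    fix d :: real assume d: "0 < d"
    \<comment> \<open>The minimum with 1 respects the range of \<open>e\<close> for which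
      \<open>approx\<close> is stated.\<close>
    have "min 1 (d / C) * C \<le> d"
    proof -
      have "min 1 (d / C) * C \<le> d / C * C" using C by (intro mult_right_mono) auto
      then show ?thesis using C by simp
    qed
    then show "\<bar>(\<integral>x. f x \<partial>M) - (\<integral>x. f x \<partial>N)\<bar> \<le> 0 + d"
      using approx[of "min 1 (d / C)"] d C by (simp add: C_def)
  qed
  then show ?thesis by simp
qed

text \<open>Closed sets form an intersection-stable generator, and their indicators are limits of
  continuous functions of the distance.\<close>

lemma measure_eqI_continuous:
  fixes M N :: "'a::metric_space measure"
  assumes M: "finite_measure M" "sets M = sets borel" and N: "finite_measure N" "sets N = sets borel"
    and eq: "\<And>f :: 'a \<Rightarrow> real. continuous_on UNIV f \<Longrightarrow> (\<And>x. 0 \<le> f x) \<Longrightarrow> (\<And>x. f x \<le> 1) \<Longrightarrow>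
      (\<integral>x. f x \<partial>M) = (\<integral>x. f x \<partial>N)"
  shows "M = N"
proof -
  have closed_eq: "emeasure M C = emeasure N C" if C: "closed C" for C
  \<comment> \<open>The empty set is separated because \<open>infdist\<close> to it is 0 by
    convention, which would make every \<open>f n\<close> constantly 1.\<close>
  proof (cases "C = {}")
    case False
    define f where "f n x = max 0 (1 - real n * infdist x C)" for n x
    have cont: "continuous_on UNIV (f n)" for n unfolding f_def by (intro continuous_intros)
    have f01: "0 \<le> f n x" "f n x \<le> 1" for n x by (auto simp: f_def infdist_nonneg)
    have lim: "(\<lambda>n. f n x) \<longlonglongrightarrow> indicator C x" for x
    proof (cases "x \<in> C")
      case True
      then show ?thesis by (simp add: f_def)
    next
      case False
      then have pos: "infdist x C > 0" using C \<open>C \<noteq> {}\<close> by (metis in_closed_iff_infdist_zero infdist_nonneg less_eq_real_def)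
      obtain N where N: "1 < real N * infdist x C" using ex_less_of_nat_mult[OF pos] by blast
      have "eventually (\<lambda>n. f n x = 0) sequentially"
      proof (rule eventually_sequentiallyI[of N])
        fix n assume "N \<le> n"
        then have "real N * infdist x C \<le> real n * infdist x C" using pos by (intro mult_right_mono) auto
        then show "f n x = 0" using N by (simp add: f_def)
      qed
      then show ?thesis using False by (simp add: tendsto_eventually)
    qed
    have L: "(\<lambda>n. \<integral>x. f n x \<partial>L) \<longlonglongrightarrow> measure L C" if L: "finite_measure L" "sets L = sets borel" for L :: "'a measure"
    proof -
      interpret finite_measure L by fact
      have [measurable]: "f n \<in> borel_measurable L" for n
        using cont by (auto simp: measurable_cong_sets[OF L(2) refl] borel_measurable_continuous_onI)
      have CL: "C \<in> sets L" using C L by auto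
      have "(\<lambda>n. \<integral>x. f n x \<partial>L) \<longlonglongrightarrow> (\<integral>x. indicator C x \<partial>L)"
        using f01 lim CL by (intro integral_dominated_convergence[where w = "\<lambda>x. 1"]) auto
      also have "(\<integral>x. indicator C x \<partial>L) = measure L C" using CL
        by (simp add: Int_absorb2 sets.sets_into_space)
      finally show ?thesis .
    qed
    have "(\<integral>x. f n x \<partial>M) = (\<integral>x. f n x \<partial>N)" for n by (intro eq cont f01)
    then have "measure M C = measure N C"
      using LIMSEQ_unique[OF L[OF M]] L[OF N] by simp
    then show ?thesis using M N by (simp add: finite_measure.emeasure_eq_measure)
  qed simp
  show ?thesis
  proof (rule measure_eqI_generator_eq[where E = "Collect closed" and \<Omega> = UNIV and A = "\<lambda>_. UNIV"])
    show "Int_stable (Collect closed :: 'a set set)" by (auto simp: Int_stable_def)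
    show "sets M = sigma_sets UNIV (Collect closed)" "sets N = sigma_sets UNIV (Collect closed)"
      using M N by (auto simp: borel_eq_closed)
    show "emeasure M UNIV \<noteq> \<infinity>" using finite_measure.emeasure_finite[OF M(1)] by auto
  qed (use closed_eq in auto)
qed

section \<open>Laplace transforms determine moments and trigonometric integrals\<close>

lemma integral_sums_dominated:
  fixes f :: "nat \<Rightarrow> 'a \<Rightarrow> real"
  assumes [measurable]: "\<And>n. f n \<in> borel_measurable M" and w: "integrable M w"
    and le: "\<And>x N. (\<Sum>n<N. \<bar>f n x\<bar>) \<le> w x" and s: "\<And>x. (\<lambda>n. f n x) sums s x"
  shows "integrable M (f n)" "integrable M s" "(\<lambda>n. \<integral>x. f n x \<partial>M) sums (\<integral>x. s x \<partial>M)"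
proof -
  have fw: "\<bar>f n x\<bar> \<le> w x" for n x
  proof -
    have "0 \<le> (\<Sum>k<n. \<bar>f k x\<bar>)" by (intro sum_nonneg) simp
    then show ?thesis using le[where N = "Suc n" and x = x, unfolded sum.lessThan_Suc] by linarith
  qed
  have [measurable]: "w \<in> borel_measurable M" using w by auto
  have int: "integrable M (f n)" for n
    by (rule Bochner_Integration.integrable_bound[OF w]) (use fw in \<open>auto intro: order_trans[OF _ abs_ge_self]\<close>)
  then show "integrable M (f n)" .
  have [measurable]: "s \<in> borel_measurable M"
    by (rule borel_measurable_LIMSEQ_real[where u = "\<lambda>N x. \<Sum>n<N. f n x"]) (use s in \<open>auto simp: sums_def\<close>)
  have b: "norm (\<Sum>n<N. f n x) \<le> w x" for N x
    using le[where N = N and x = x] sum_abs[of "\<lambda>n. f n x" "{..<N}"]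
    by (simp only: real_norm_def)
  note dc = integral_dominated_convergence[where w = w and s = "\<lambda>N x. \<Sum>n<N. f n x" and f = s and M = M]
    integrable_dominated_convergence[where w = w and s = "\<lambda>N x. \<Sum>n<N. f n x" and f = s and M = M]
  show "integrable M s" using s b w by (intro dc(2)) (auto simp: sums_def)
  have "(\<lambda>N. \<integral>x. (\<Sum>n<N. f n x) \<partial>M) \<longlonglongrightarrow> (\<integral>x. s x \<partial>M)"
    using s b w by (intro dc(1)) (auto simp: sums_def)
  then show "(\<lambda>n. \<integral>x. f n x \<partial>M) sums (\<integral>x. s x \<partial>M)"
    using int by (simp add: sums_def)
qed

text \<open>The bound on the coefficients covers exp, cos and sin at once; the partial sums are
  dominated by \<open>exp \<bar>X\<bar>\<close>, hence by \<open>exp X + exp (- X)\<close>.\<close>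

lemma integral_power_series:
  fixes X :: "'a \<Rightarrow> real"
  assumes [measurable]: "X \<in> borel_measurable M" and int: "\<And>t. integrable M (\<lambda>x. exp (t * X x))"
    and c: "\<And>n. \<bar>c n\<bar> \<le> 1 / fact n" and s: "\<And>y. (\<lambda>n. c n * y ^ n) sums s y"
  shows "(\<lambda>n. c n * (\<integral>x. X x ^ n \<partial>M)) sums (\<integral>x. s (X x) \<partial>M)"
proof -
  have "(\<lambda>n. \<integral>x. c n * X x ^ n \<partial>M) sums (\<integral>x. s (X x) \<partial>M)"
  proof (rule integral_sums_dominated)
    show "integrable M (\<lambda>x. exp (X x) + exp (- X x))"
      using int[of 1] int[of "-1"] by simp
    fix x N
    have "(\<Sum>n<N. \<bar>c n * X x ^ n\<bar>) \<le> (\<Sum>n<N. \<bar>X x\<bar> ^ n / fact n)"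
      using c by (intro sum_mono) (simp add: abs_mult power_abs divide_inverse mult.commute mult_right_mono)
    also have "\<dots> \<le> exp \<bar>X x\<bar>"
    proof -
      have "(\<lambda>n. \<bar>X x\<bar> ^ n / fact n) sums exp \<bar>X x\<bar>"
        using exp_converges[of "\<bar>X x\<bar>"] by (simp add: field_simps)
      then show ?thesis using sum_le_suminf[of "\<lambda>n. \<bar>X x\<bar> ^ n / fact n" "{..<N}"] by (simp add: sums_iff)
    qed
    also have "\<dots> \<le> exp (X x) + exp (- X x)" by (auto simp: abs_if)
    finally show "(\<Sum>n<N. \<bar>c n * X x ^ n\<bar>) \<le> exp (X x) + exp (- X x)" .
  qed (use s in auto)
  then show ?thesis by simp
qed

text \<open>The Laplace transform is a power series in \<open>t\<close> whose coefficients are the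
  moments divided by factorials.\<close>

lemma moments_eq_of_laplace:
  fixes X :: "'a \<Rightarrow> real"
  assumes meas: "X \<in> borel_measurable M" "X \<in> borel_measurable N"
    and int: "\<And>t. integrable M (\<lambda>x. exp (t * X x))" "\<And>t. integrable N (\<lambda>x. exp (t * X x))"
    and eq: "\<And>t. (\<integral>x. exp (t * X x) \<partial>M) = (\<integral>x. exp (t * X x) \<partial>N)"
  shows "(\<integral>x. X x ^ n \<partial>M) = (\<integral>x. X x ^ n \<partial>N)"
proof -
  have L: "(\<lambda>n. (\<integral>x. X x ^ n \<partial>L) / fact n * t ^ n) sums (\<integral>x. exp (t * X x) \<partial>L)"
    if "X \<in> borel_measurable L" "\<And>t. integrable L (\<lambda>x. exp (t * X x))" for t and L :: "'a measure"
  proof -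
    have "(\<lambda>n. 1 / fact n * (\<integral>x. (t * X x) ^ n \<partial>L)) sums (\<integral>x. exp (t * X x) \<partial>L)"
    proof (rule integral_power_series)
      show "integrable L (\<lambda>x. exp (r * (t * X x)))" for r
        using that(2)[of "r * t"] by (simp add: mult.assoc)
      show "(\<lambda>n. 1 / fact n * y ^ n) sums exp y" for y :: real
        using exp_converges[of y] by (simp add: field_simps)
    qed (use that in auto)
    then show ?thesis by (simp add: power_mult_distrib mult_ac)
  qed
  have "(\<lambda>n. (\<integral>x. X x ^ n \<partial>M) / fact n) = (\<lambda>n. (\<integral>x. X x ^ n \<partial>N) / fact n)"
    using L[OF meas(1) int(1)] L[OF meas(2) int(2)] eq by (intro powser_coeffs_unique) auto
  then show ?thesis by (simp add: fun_eq_iff)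
qed

text \<open>The moments serve as the link between real and imaginary exponents, in place of analytic
  continuation.\<close>

lemma integral_cos_sin_eq_of_laplace:
  fixes X :: "'a \<Rightarrow> real"
  assumes meas: "X \<in> borel_measurable M" "X \<in> borel_measurable N"
    and int: "\<And>t. integrable M (\<lambda>x. exp (t * X x))" "\<And>t. integrable N (\<lambda>x. exp (t * X x))"
    and eq: "\<And>t. (\<integral>x. exp (t * X x) \<partial>M) = (\<integral>x. exp (t * X x) \<partial>N)"
  shows "(\<integral>x. cos (X x) \<partial>M) = (\<integral>x. cos (X x) \<partial>N)" "(\<integral>x. sin (X x) \<partial>M) = (\<integral>x. sin (X x) \<partial>N)"
proof -
  note m = moments_eq_of_laplace[OF assms]
  have c: "\<bar>cos_coeff n\<bar> \<le> 1 / fact n" "(\<lambda>n. cos_coeff n * y ^ n) sums cos y" for n y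
    using cos_converges[of y] by (auto simp: cos_coeff_def)
  have s: "\<bar>sin_coeff n\<bar> \<le> 1 / fact n" "(\<lambda>n. sin_coeff n * y ^ n) sums sin y" for n y
    using sin_converges[of y] by (auto simp: sin_coeff_def)
  show "(\<integral>x. cos (X x) \<partial>M) = (\<integral>x. cos (X x) \<partial>N)"
    by (rule sums_unique2[OF integral_power_series[OF meas(1) int(1) c, unfolded m]
          integral_power_series[OF meas(2) int(2) c]])
  show "(\<integral>x. sin (X x) \<partial>M) = (\<integral>x. sin (X x) \<partial>N)"
    by (rule sums_unique2[OF integral_power_series[OF meas(1) int(1) s, unfolded m]
          integral_power_series[OF meas(2) int(2) s]])
qed

section \<open>Trigonometric polynomials in continuous functionals\<close>

text \<open>Unlike exponentials these functions are bounded. Cosine and sine of one functional are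
  paired so that a product of two generators is a sum of two generators, at \<open>f + k\<close> and
  \<open>f - k\<close>.\<close>

inductive_set trig_functions :: "('a::real_normed_vector \<Rightarrow> real) set" where
  trig_base: "(\<lambda>x. a * cos (blinfun_apply f x) + b * sin (blinfun_apply f x)) \<in> trig_functions"
| trig_add: "g \<in> trig_functions \<Longrightarrow> h \<in> trig_functions \<Longrightarrow> (\<lambda>x. g x + h x) \<in> trig_functions"

lemma trig_mult:
  assumes "g \<in> trig_functions" "h \<in> trig_functions"
  shows "(\<lambda>x. g x * h x) \<in> trig_functions"
  using assms(1)
proof (induction rule: trig_functions.induct)
  case (trig_base a f b)
  show ?case
    using assms(2)
  proof (induction rule: trig_functions.induct)
    case (trig_base c k d)
    have "(a * cos (blinfun_apply f x) + b * sin (blinfun_apply f x)) *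
        (c * cos (blinfun_apply k x) + d * sin (blinfun_apply k x)) =
        ((a * c - b * d) / 2 * cos (blinfun_apply (f + k) x) + (a * d + b * c) / 2 * sin (blinfun_apply (f + k) x)) +
        ((a * c + b * d) / 2 * cos (blinfun_apply (f - k) x) + (b * c - a * d) / 2 * sin (blinfun_apply (f - k) x))" for x
      unfolding blinfun.add_left blinfun.diff_left cos_add sin_add cos_diff sin_diff by (simp add: field_simps)
    then show ?case by (simp only:) (intro trig_functions.trig_add trig_functions.trig_base)
  next
    case (trig_add g h)
    from trig_functions.trig_add[OF trig_add.IH] show ?case by (simp add: distrib_left)
  qed
next
  case (trig_add g h)
  from trig_functions.trig_add[OF trig_add.IH] show ?case by (simp add: distrib_right)
qed

lemma trig_functions_continuous_bounded:
  assumes "g \<in> trig_functions"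
  shows "continuous_on UNIV g \<and> bounded (range g)"
  using assms
proof (induction rule: trig_functions.induct)
  case (trig_base a f b)
  have "\<bar>a * cos (blinfun_apply f x) + b * sin (blinfun_apply f x)\<bar> \<le> \<bar>a\<bar> + \<bar>b\<bar>" for x
    by (intro order_trans[OF abs_triangle_ineq] add_mono) (auto simp: abs_mult intro: mult_left_le)
  then show ?case by (auto intro!: continuous_intros simp: bounded_iff)
next
  case (trig_add g h)
  then show ?case by (auto intro!: continuous_intros bounded_plus_comp)
qed

text \<open>A norming functional for \<open>x - y\<close>, rescaled to have difference 1, separates
  the points: 1 lies strictly between 0 and pi, so the sine of the difference is positive.\<close>

lemma trig_functions_separate:
  fixes x y :: "'a::real_normed_vector"
  assumes "x \<noteq> y"
  shows "\<exists>f\<in>trig_functions. f x \<noteq> f y"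
proof -
  obtain f :: "'a \<Rightarrow>\<^sub>L real" where f: "blinfun_apply f (x - y) = norm (x - y)"
    using hahn_banach_norm by blast
  define k where "k = (1 / norm (x - y)) *\<^sub>R f"
  have k: "blinfun_apply k x - blinfun_apply k y = 1"
    using f assms by (simp add: k_def blinfun.scaleR_left blinfun.diff_right field_simps)
  define g where "g z = (- sin (blinfun_apply k y)) * cos (blinfun_apply k z) + cos (blinfun_apply k y) * sin (blinfun_apply k z)" for z
  have g: "g z = sin (blinfun_apply k z - blinfun_apply k y)" for z
    by (simp add: g_def sin_diff algebra_simps)
  have "sin (1::real) > 0" using pi_gt3 by (intro sin_gt_zero) auto
  then have "g x \<noteq> g y" by (simp add: g k)
  moreover have "g \<in> trig_functions" unfolding g_def by (rule trig_base)
  ultimately show ?thesis by blast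
qed

theorem tight_measure_eqI:
  fixes M N :: "'a::banach measure"
  assumes M: "tight_measure M" and N: "tight_measure N"
    and int: "\<And>f :: 'a \<Rightarrow>\<^sub>L real. integrable M (\<lambda>x. exp (blinfun_apply f x))"
       "\<And>f :: 'a \<Rightarrow>\<^sub>L real. integrable N (\<lambda>x. exp (blinfun_apply f x))"
    and eq: "\<And>f :: 'a \<Rightarrow>\<^sub>L real. (\<integral>x. exp (blinfun_apply f x) \<partial>M) = (\<integral>x. exp (blinfun_apply f x) \<partial>N)"
  shows "M = N"
proof -
  have M': "finite_measure M" "sets M = sets borel" and N': "finite_measure N" "sets N = sets borel"
    using M N by (auto simp: tight_measure_def)
  have meas: "blinfun_apply f \<in> borel_measurable L" if "sets L = sets borel" for f :: "'a \<Rightarrow>\<^sub>L real" and L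
    unfolding measurable_cong_sets[OF that refl] by (intro borel_measurable_continuous_onI continuous_intros)
  have bint: "integrable L g" if "finite_measure L" "sets L = sets borel" "g \<in> trig_functions" for L and g :: "'a \<Rightarrow> real"
  proof -
    from trig_functions_continuous_bounded[OF that(3)] obtain B where "\<And>x. \<bar>g x\<bar> \<le> B" by (auto simp: bounded_iff)
    moreover have "g \<in> borel_measurable L"
      unfolding measurable_cong_sets[OF that(2) refl] using trig_functions_continuous_bounded[OF that(3)]
      by (intro borel_measurable_continuous_onI) auto
    ultimately show ?thesis by (intro finite_measure.integrable_const_bound[OF that(1), where B = B]) auto
  qed
  have trig: "(\<integral>x. g x \<partial>M) = (\<integral>x. g x \<partial>N)" if "g \<in> trig_functions" for g
    using that
  proof (induction rule: trig_functions.induct)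
    case (trig_base a f b)
    have e: "t * blinfun_apply f x = blinfun_apply (t *\<^sub>R f) x" for t x by (simp add: blinfun.scaleR_left)
    have cs: "(\<integral>x. cos (blinfun_apply f x) \<partial>M) = (\<integral>x. cos (blinfun_apply f x) \<partial>N)"
      "(\<integral>x. sin (blinfun_apply f x) \<partial>M) = (\<integral>x. sin (blinfun_apply f x) \<partial>N)"
      using M' N' int eq meas by (auto intro!: integral_cos_sin_eq_of_laplace simp: e)
    have i: "integrable L (\<lambda>x. cos (blinfun_apply f x))" "integrable L (\<lambda>x. sin (blinfun_apply f x))"
      if "finite_measure L" "sets L = sets borel" for L
      using bint[OF that trig_functions.trig_base[of 1 f 0]] bint[OF that trig_functions.trig_base[of 0 f 1]] by auto
    show ?case using i[OF M'] i[OF N'] cs by simp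
  next
    case (trig_add g h)
    then show ?case using bint[OF M'] bint[OF N'] by simp
  qed
  show ?thesis
  proof (rule measure_eqI_continuous[OF M' N'], rule integral_eq_of_algebra[OF M N, where R = trig_functions])
    show "(\<lambda>x. c) \<in> trig_functions" for c
      using trig_base[of c 0 0] by simp
  qed (simp_all add: trig_functions_continuous_bounded trig_add trig_mult trig_functions_separate trig)
qed

section \<open>Orthonormal bases and adjoints\<close>

definition onb_proj :: "nat set \<Rightarrow> (nat \<Rightarrow> 'h::{real_inner,banach}) \<Rightarrow> nat \<Rightarrow> 'h \<Rightarrow> 'h" where
  "onb_proj J e N x = (\<Sum>i\<in>J \<inter> {..<N}. inner x (e i) *\<^sub>R e i)"

lemma inner_onb_proj: "inner (onb_proj J e N x) y = (\<Sum>i\<in>J \<inter> {..<N}. inner x (e i) * inner y (e i))"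
  by (simp add: onb_proj_def inner_sum_left inner_commute[of y])

lemma orthonormal_basis_on_inner:
  "orthonormal_basis_on J e \<Longrightarrow> i \<in> J \<Longrightarrow> k \<in> J \<Longrightarrow> inner (e i) (e k) = (if i = k then 1 else 0)"
  by (simp add: orthonormal_basis_on_def)

lemma inner_sum_onb:
  assumes "orthonormal_basis_on J e" "finite F" "F \<subseteq> J" "k \<in> J"
  shows "inner (\<Sum>i\<in>F. a i *\<^sub>R e i) (e k) = (if k \<in> F then a k else 0)"
proof -
  have "inner (\<Sum>i\<in>F. a i *\<^sub>R e i) (e k) = (\<Sum>i\<in>F. if i = k then a i else 0)"
    using assms(3,4) by (auto simp: inner_sum_left orthonormal_basis_on_inner[OF assms(1)] intro!: sum.cong)
  then show ?thesis using assms(2) by simp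
qed

lemma norm_sum_onb:
  assumes "orthonormal_basis_on J e" "finite F" "F \<subseteq> J"
  shows "(norm (\<Sum>i\<in>F. a i *\<^sub>R e i))\<^sup>2 = (\<Sum>i\<in>F. (a i)\<^sup>2)"
proof -
  have "(norm (\<Sum>i\<in>F. a i *\<^sub>R e i))\<^sup>2 = (\<Sum>k\<in>F. a k * inner (\<Sum>i\<in>F. a i *\<^sub>R e i) (e k))"
    by (simp add: power2_norm_eq_inner inner_sum_right)
  also have "\<dots> = (\<Sum>k\<in>F. a k * a k)"
    using assms(3) by (intro sum.cong refl) (simp add: inner_sum_onb[OF assms] subset_iff)
  finally show ?thesis by (simp add: power2_eq_square)
qed

text \<open>By density some finite combination of basis vectors is close to \<open>x\<close>; once
  all its indices lie below \<open>n\<close>, the orthogonal projection is at least as close, by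
  Pythagoras.\<close>

lemma onb_proj_tendsto:
  assumes onb: "orthonormal_basis_on J e"
  shows "(\<lambda>N. onb_proj J e N x) \<longlonglongrightarrow> x"
proof (rule LIMSEQ_I)
  fix r :: real assume r: "0 < r"
  have "x \<in> closure (span (e ` J))" using onb by (simp add: orthonormal_basis_on_def)
  then obtain u where u: "u \<in> span (e ` J)" "dist u x < r" using r closure_approachable by blast
  from u(1) have "\<exists>N. u \<in> span (e ` (J \<inter> {..<N}))"
  proof (induction rule: span_induct_alt)
    case base
    then show ?case by (auto intro: span_zero)
  next
    case (step c y z)
    then obtain i N where i: "i \<in> J" "y = e i" "z \<in> span (e ` (J \<inter> {..<N}))" by blast
    have "z \<in> span (e ` (J \<inter> {..<max N (Suc i)}))"
      using span_mono[of "e ` (J \<inter> {..<N})" "e ` (J \<inter> {..<max N (Suc i)})"] i(3) by fastforce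
    moreover have "y \<in> span (e ` (J \<inter> {..<max N (Suc i)}))" using i by (auto intro: span_base)
    ultimately show ?case by (auto intro: span_add span_scale)
  qed
  then obtain N where N: "u \<in> span (e ` (J \<inter> {..<N}))" by blast
  have "norm (onb_proj J e n x - x) < r" if n: "N \<le> n" for n
  proof -
    let ?P = "onb_proj J e n x"
    let ?S = "e ` (J \<inter> {..<n})"
    have "u \<in> span ?S" using N n span_mono[of "e ` (J \<inter> {..<N})" ?S] by fastforce
    moreover have "?P \<in> span ?S" unfolding onb_proj_def by (intro span_sum span_scale span_base) auto
    ultimately have d: "?P - u \<in> span ?S" by (rule span_diff[rotated])
    have o: "inner (x - ?P) (e k) = 0" if "k \<in> J \<inter> {..<n}" for k
      using that inner_sum_onb[OF onb, of "J \<inter> {..<n}" k "\<lambda>i. inner x (e i)"]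
      by (simp add: onb_proj_def inner_diff_left)
    have "inner (x - ?P) (?P - u) = 0"
      using d by (induction rule: span_induct_alt) (auto simp: inner_add_right o)
    then have "(norm (x - u))\<^sup>2 = (norm (x - ?P))\<^sup>2 + (norm (?P - u))\<^sup>2"
      using norm_add_Pythagorean[of "x - ?P" "?P - u"] by (simp add: orthogonal_def)
    then have "(norm (x - ?P))\<^sup>2 \<le> (norm (x - u))\<^sup>2" by simp
    then have "norm (x - ?P) \<le> norm (x - u)" by (rule power2_le_imp_le) simp
    then show ?thesis using u(2) by (simp add: dist_norm norm_minus_commute)
  qed
  then show "\<exists>no. \<forall>n\<ge>no. norm (onb_proj J e n x - x) < r" by blast
qed

text \<open>The representing vector is the sum of the \<open>f (e i) *\<^sub>R e i\<close>.
  Evaluating \<open>f\<close> at a partial sum gives the square of its norm, so boundedness of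
  \<open>f\<close> bounds the partial sums.\<close>

lemma riesz_representation_onb:
  fixes f :: "'h::{real_inner,banach} \<Rightarrow> real" and e :: "nat \<Rightarrow> 'h"
  assumes onb: "orthonormal_basis_on J e" and f: "bounded_linear f"
  shows "\<exists>h. \<forall>g. f g = inner g h"
proof -
  interpret f: bounded_linear f by fact
  obtain K where K: "\<And>x. norm (f x) \<le> norm x * K" "K \<ge> 0" using f.nonneg_bounded by blast
  define h where "h N = (\<Sum>i\<in>J \<inter> {..<N}. f (e i) *\<^sub>R e i)" for N
  define s where "s N = (\<Sum>i\<in>J \<inter> {..<N}. (f (e i))\<^sup>2)" for N
  have hs: "(norm (h N))\<^sup>2 = s N" for N unfolding h_def s_def by (rule norm_sum_onb[OF onb]) auto
  have fh: "f (h N) = s N" for N by (simp add: h_def s_def f.sum f.scaleR power2_eq_square)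
  have hK: "norm (h N) \<le> K" for N
  proof (cases "norm (h N) = 0")
    case False
    have "norm (h N) * norm (h N) \<le> norm (h N) * K" using K(1)[of "h N"] hs[of N] by (simp add: fh power2_eq_square)
    then show ?thesis using False by (simp add: mult_le_cancel_left)
  qed (use K(2) in simp)
  \<comment> \<open>Increments of \<open>s\<close> are squared distances between the
    \<open>h N\<close>, so convergence of the real sequence makes \<open>h\<close> Cauchy.\<close>
  have "incseq s" unfolding s_def incseq_def by (auto intro!: sum_mono2)
  moreover have "s N \<le> K\<^sup>2" for N using hK[of N] by (simp flip: hs add: power_mono)
  ultimately obtain L where "s \<longlonglongrightarrow> L" using incseq_convergent by blast
  then have cs: "Cauchy s" by (rule LIMSEQ_imp_Cauchy)
  have diff: "(norm (h n - h m))\<^sup>2 = s n - s m" if "m \<le> n" for m n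
  proof -
    have sp: "J \<inter> {..<n} = (J \<inter> {..<m}) \<union> (J \<inter> {m..<n})" using that by auto
    have "h n - h m = (\<Sum>i\<in>J \<inter> {m..<n}. f (e i) *\<^sub>R e i)" unfolding h_def sp by (subst sum.union_disjoint) auto
    moreover have "s n - s m = (\<Sum>i\<in>J \<inter> {m..<n}. (f (e i))\<^sup>2)" unfolding s_def sp by (subst sum.union_disjoint) auto
    ultimately show ?thesis using norm_sum_onb[OF onb, of "J \<inter> {m..<n}"] by simp
  qed
  have "Cauchy h"
  proof (rule metric_CauchyI)
    fix r :: real assume r: "0 < r"
    then obtain M where M: "\<And>m n. m \<ge> M \<Longrightarrow> n \<ge> M \<Longrightarrow> dist (s m) (s n) < r\<^sup>2"
      using metric_CauchyD[OF cs, of "r\<^sup>2"] by auto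
    have *: "dist (h m) (h n) < r" if "m \<ge> M" "n \<ge> m" for m n
    proof -
      have "(norm (h n - h m))\<^sup>2 < r\<^sup>2" using M[of n m] that diff[of m n] by (simp add: dist_real_def abs_if split: if_splits)
      then have "norm (h n - h m) < r" using r by (simp add: power_less_imp_less_base)
      then show ?thesis by (simp add: dist_norm norm_minus_commute)
    qed
    have "dist (h m) (h n) < r" if "m \<ge> M" "n \<ge> M" for m n
      using *[of m n] *[of n m] that by (cases "m \<le> n") (auto simp: dist_commute)
    then show "\<exists>M. \<forall>m\<ge>M. \<forall>n\<ge>M. dist (h m) (h n) < r" by blast
  qed
  then obtain h0 where h0: "h \<longlonglongrightarrow> h0" using Cauchy_convergent convergent_def by blast
  have e: "inner (e i) h0 = f (e i)" if "i \<in> J" for i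
  proof -
    have "(\<lambda>N. inner (e i) (h N)) \<longlonglongrightarrow> inner (e i) h0" by (intro tendsto_intros h0)
    moreover have "inner (e i) (h N) = f (e i)" if "N > i" for N
      using inner_sum_onb[OF onb, of "J \<inter> {..<N}" i "\<lambda>i. f (e i)"] that \<open>i \<in> J\<close>
      by (simp add: h_def inner_commute)
    then have "(\<lambda>N. inner (e i) (h N)) \<longlonglongrightarrow> f (e i)"
      by (intro tendsto_eventually eventually_sequentiallyI[of "Suc i"]) auto
    ultimately show ?thesis by (rule LIMSEQ_unique)
  qed
  have "f g = inner g h0" for g
  proof -
    have "f (onb_proj J e N g) = inner (onb_proj J e N g) h0" for N
      by (auto simp: onb_proj_def f.sum f.scaleR inner_sum_left e intro!: sum.cong)
    moreover have "(\<lambda>N. f (onb_proj J e N g)) \<longlonglongrightarrow> f g" by (intro f.tendsto onb_proj_tendsto onb)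
    moreover have "(\<lambda>N. inner (onb_proj J e N g) h0) \<longlonglongrightarrow> inner g h0"
      by (intro tendsto_sum tendsto_mult tendsto_inner tendsto_const onb_proj_tendsto onb)
    ultimately show ?thesis using LIMSEQ_unique by simp
  qed
  then show ?thesis by blast
qed

text \<open>\<open>adjoint\<close> chooses some map satisfying the adjoint equation; Riesz
  representation shows that one exists. Contractivity comes from pairing
  \<open>T (adjoint T y)\<close> with \<open>y\<close>.\<close>

lemma
  fixes T :: "'h::{real_inner,banach} \<Rightarrow> 'k::{real_inner,banach}" and e :: "nat \<Rightarrow> 'h"
  assumes onb: "orthonormal_basis_on J e" and T: "linear T" "\<And>h. norm (T h) \<le> norm h"
  shows inner_adjoint: "inner (T x) y = inner x (adjoint T y)"
    and linear_adjoint: "linear (adjoint T)"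
    and norm_adjoint_le: "norm (adjoint T y) \<le> norm y"
proof -
  have "bounded_linear (\<lambda>x. inner (T x) y)" for y
  proof (rule bounded_linear_intro[where K = "norm y"])
    show "norm (inner (T x) y) \<le> norm x * norm y" for x
      using Cauchy_Schwarz_ineq2[of "T x" y] T(2)[of x] by (simp add: mult_right_mono order_trans)
  qed (simp_all add: linear_add[OF T(1)] linear_scale[OF T(1)] inner_add_left)
  then have "\<forall>y. \<exists>h. \<forall>g. inner (T g) y = inner g h" by (intro allI riesz_representation_onb[OF onb])
  from choice[OF this] have "\<exists>f'. \<forall>x y. inner (T x) y = inner x (f' y)" by blast
  from someI_ex[OF this] show adj: "inner (T x) y = inner x (adjoint T y)" for x y
    unfolding adjoint_def by blast
  show "linear (adjoint T)"
    by (rule linearI; rule vector_eq_ldot[THEN iffD1])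
      (simp_all add: adj[symmetric] inner_add_right)
  have "norm (adjoint T y) * norm (adjoint T y) = inner (T (adjoint T y)) y"
    by (simp add: adj flip: power2_norm_eq_inner power2_eq_square)
  also have "\<dots> \<le> norm (T (adjoint T y)) * norm y" by (rule norm_cauchy_schwarz)
  also have "\<dots> \<le> norm (adjoint T y) * norm y" by (intro mult_right_mono T) simp
  finally show "norm (adjoint T y) \<le> norm y"
    by (cases "adjoint T y = 0") (auto simp: mult_le_cancel_left)
qed

section \<open>Positive kernels and operators defined on a total family\<close>

text \<open>For a difference of Gram kernels this says exactly that \<open>x a \<mapsto> y a\<close>
  does not increase the norm of any finite linear combination.\<close>

definition positive_kernel :: "('i \<Rightarrow> 'i \<Rightarrow> real) \<Rightarrow> bool" where
  "positive_kernel K \<longleftrightarrow> (\<forall>F c. finite F \<longrightarrow> 0 \<le> (\<Sum>a\<in>F. \<Sum>b\<in>F. c a * c b * K a b))"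

lemma gram_sum:
  "(\<Sum>a\<in>F. \<Sum>b\<in>F. c a * c b * inner (x a) (x b)) = (norm (\<Sum>a\<in>F. c a *\<^sub>R x a))\<^sup>2"
  unfolding power2_norm_eq_inner inner_sum_left
  by (simp only: inner_scaleR_left inner_sum_right inner_scaleR_right sum_distrib_left mult.assoc)
    (intro sum.cong refl mult.left_commute)

lemma positive_kernel_gram: "positive_kernel (\<lambda>a b. inner (x a) (x b))"
  by (simp add: positive_kernel_def gram_sum)

lemma positive_kernel_add:
  "positive_kernel K \<Longrightarrow> positive_kernel L \<Longrightarrow> positive_kernel (\<lambda>a b. K a b + L a b)"
  by (simp add: positive_kernel_def distrib_left sum.distrib)

lemma positive_kernel_scale:
  assumes "positive_kernel K"
  shows "positive_kernel (\<lambda>a b. r a * r b * K a b)"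
  unfolding positive_kernel_def
proof (intro allI impI)
  fix F c assume F: "finite (F :: 'a set)"
  have "(\<Sum>a\<in>F. \<Sum>b\<in>F. c a * c b * (r a * r b * K a b)) = (\<Sum>a\<in>F. \<Sum>b\<in>F. (c a * r a) * (c b * r b) * K a b)"
    by (intro sum.cong refl) (simp only: mult_ac)
  then show "0 \<le> (\<Sum>a\<in>F. \<Sum>b\<in>F. c a * c b * (r a * r b * K a b))"
    using assms F by (simp add: positive_kernel_def)
qed

text \<open>By Parseval, the Gram factor is a limit of sums of rank one kernels.\<close>

lemma positive_kernel_mult_gram:
  fixes x :: "'i \<Rightarrow> 'h::{real_inner,banach}" and e :: "nat \<Rightarrow> 'h"
  assumes onb: "orthonormal_basis_on J e" and K: "positive_kernel K"
  shows "positive_kernel (\<lambda>a b. inner (x a) (x b) * K a b)"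
  unfolding positive_kernel_def
proof (intro allI impI)
  fix F c assume F: "finite (F :: 'i set)"
  have "(\<lambda>N. \<Sum>a\<in>F. \<Sum>b\<in>F. c a * c b * (inner (onb_proj J e N (x a)) (x b) * K a b)) \<longlonglongrightarrow>
     (\<Sum>a\<in>F. \<Sum>b\<in>F. c a * c b * (inner (x a) (x b) * K a b))"
    by (intro tendsto_sum tendsto_mult tendsto_inner tendsto_const onb_proj_tendsto onb)
  moreover have "0 \<le> (\<Sum>a\<in>F. \<Sum>b\<in>F. c a * c b * (inner (onb_proj J e N (x a)) (x b) * K a b))" for N
  proof -
    have "(\<Sum>a\<in>F. \<Sum>b\<in>F. c a * c b * (inner (onb_proj J e N (x a)) (x b) * K a b)) =
      (\<Sum>a\<in>F. \<Sum>b\<in>F. \<Sum>i\<in>J \<inter> {..<N}. (c a * inner (x a) (e i)) * (c b * inner (x b) (e i)) * K a b)"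
      unfolding inner_onb_proj sum_distrib_left sum_distrib_right
      by (intro sum.cong refl) (simp only: mult_ac)
    also have "\<dots> = (\<Sum>i\<in>J \<inter> {..<N}. \<Sum>a\<in>F. \<Sum>b\<in>F. (c a * inner (x a) (e i)) * (c b * inner (x b) (e i)) * K a b)"
      by (simp only: sum.swap[of _ "J \<inter> {..<N}" F])
    also have "\<dots> \<ge> 0"
      using K F by (intro sum_nonneg[of "J \<inter> {..<N}"]) (simp add: positive_kernel_def)
    finally show ?thesis .
  qed
  ultimately show "0 \<le> (\<Sum>a\<in>F. \<Sum>b\<in>F. c a * c b * (inner (x a) (x b) * K a b))"
    by (intro LIMSEQ_le_const) auto
qed

lemma positive_kernel_prod_gram:
  fixes x :: "'i \<Rightarrow> nat \<Rightarrow> 'h::{real_inner,banach}" and e :: "nat \<Rightarrow> 'h"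
  assumes onb: "orthonormal_basis_on J e" and K: "positive_kernel K"
  shows "positive_kernel (\<lambda>a b. (\<Prod>i<n. inner (x a i) (x b i)) * K a b)"
proof (induction n)
  case (Suc n)
  have "inner (x a n) (x b n) * ((\<Prod>i<n. inner (x a i) (x b i)) * K a b) =
      (\<Prod>i<Suc n. inner (x a i) (x b i)) * K a b" for a b
    by (simp only: prod.lessThan_Suc mult.assoc mult.left_commute)
  with positive_kernel_mult_gram[OF onb Suc.IH, of "\<lambda>a. x a n"] show ?case by (simp only:)
qed (use K in simp)

lemma positive_kernel_contraction:
  assumes R: "linear R" "\<And>h. norm (R h) \<le> norm h"
  shows "positive_kernel (\<lambda>a b. inner (x a) (x b) - inner (R (x a)) (R (x b)))"
  unfolding positive_kernel_def
proof (intro allI impI)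
  fix F c assume F: "finite (F :: 'c set)"
  have "(\<Sum>a\<in>F. \<Sum>b\<in>F. c a * c b * (inner (x a) (x b) - inner (R (x a)) (R (x b)))) =
     (norm (\<Sum>a\<in>F. c a *\<^sub>R x a))\<^sup>2 - (norm (\<Sum>a\<in>F. c a *\<^sub>R R (x a)))\<^sup>2"
    by (simp add: right_diff_distrib sum_subtractf gram_sum)
  also have "(\<Sum>a\<in>F. c a *\<^sub>R R (x a)) = R (\<Sum>a\<in>F. c a *\<^sub>R x a)"
    by (simp add: linear_sum[OF R(1)] linear_scale[OF R(1)])
  finally show "0 \<le> (\<Sum>a\<in>F. \<Sum>b\<in>F. c a * c b * (inner (x a) (x b) - inner (R (x a)) (R (x b))))"
    using R(2) by (simp add: power_mono)
qed

text \<open>Contractivity of a tensor power of \<open>R\<close>. The induction telescopes: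
  \<open>p * u - q * v = u * (p - q) + q * (u - v)\<close>, and each summand is a product of a
  positive kernel with Gram kernels.\<close>

lemma positive_kernel_tensor_contraction:
  fixes x :: "'i \<Rightarrow> nat \<Rightarrow> 'h::{real_inner,banach}" and R :: "'h \<Rightarrow> 'k::{real_inner,banach}"
    and e :: "nat \<Rightarrow> 'h" and e' :: "nat \<Rightarrow> 'k"
  assumes onb: "orthonormal_basis_on J e" "orthonormal_basis_on J' e'"
    and R: "linear R" "\<And>h. norm (R h) \<le> norm h"
  shows "positive_kernel (\<lambda>a b. (\<Prod>i<n. inner (x a i) (x b i)) - (\<Prod>i<n. inner (R (x a i)) (R (x b i))))"
proof (induction n)
  case 0
  then show ?case by (simp add: positive_kernel_def)
next
  case (Suc n)
  have "positive_kernel (\<lambda>a b. inner (x a n) (x b n) * ((\<Prod>i<n. inner (x a i) (x b i)) - (\<Prod>i<n. inner (R (x a i)) (R (x b i))))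
     + (\<Prod>i<n. inner (R (x a i)) (R (x b i))) * (inner (x a n) (x b n) - inner (R (x a n)) (R (x b n))))"
    by (rule positive_kernel_add[OF positive_kernel_mult_gram[OF onb(1) Suc.IH]
          positive_kernel_prod_gram[OF onb(2) positive_kernel_contraction[OF R]]])
  moreover have "inner (x a n) (x b n) * ((\<Prod>i<n. inner (x a i) (x b i)) - (\<Prod>i<n. inner (R (x a i)) (R (x b i))))
     + (\<Prod>i<n. inner (R (x a i)) (R (x b i))) * (inner (x a n) (x b n) - inner (R (x a n)) (R (x b n))) =
     (\<Prod>i<Suc n. inner (x a i) (x b i)) - (\<Prod>i<Suc n. inner (R (x a i)) (R (x b i)))" for a b
  proof -
    have "u * (p - q) + q * (u - v) = p * u - q * v" for u v p q :: real by (simp add: algebra_simps)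
    then show ?thesis by (simp only: prod.lessThan_Suc)
  qed
  ultimately show ?case by (simp only:)
qed

lemma subspace_closure:
  fixes S :: "'a::real_normed_vector set"
  assumes "subspace S"
  shows "subspace (closure S)"
proof (rule subspaceI)
  show "0 \<in> closure S" using subspace_0[OF assms] closure_subset by blast
  show "x + y \<in> closure S" if "x \<in> closure S" "y \<in> closure S" for x y
  proof -
    from that obtain p q where "\<forall>n. p n \<in> S" "p \<longlonglongrightarrow> x" "\<forall>n. q n \<in> S" "q \<longlonglongrightarrow> y"
      unfolding closure_sequential by blast
    then have "\<forall>n. p n + q n \<in> S" "(\<lambda>n. p n + q n) \<longlonglongrightarrow> x + y"
      using subspace_add[OF assms] tendsto_add[of p x sequentially q y] by simp_all
    then show ?thesis unfolding closure_sequential by (intro exI conjI)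
  qed
  show "c *\<^sub>R x \<in> closure S" if "x \<in> closure S" for c x
  proof -
    from that obtain p where "\<forall>n. p n \<in> S" "p \<longlonglongrightarrow> x"
      unfolding closure_sequential by blast
    then have "\<forall>n. c *\<^sub>R p n \<in> S" "(\<lambda>n. c *\<^sub>R p n) \<longlonglongrightarrow> c *\<^sub>R x"
      using subspace_scale[OF assms] tendsto_scaleR[OF tendsto_const, of p x sequentially c] by simp_all
    then show ?thesis unfolding closure_sequential by (intro exI conjI)
  qed
qed

lemma span_range_explicit:
  assumes "u \<in> span (range f)"
  shows "\<exists>F c. finite F \<and> u = (\<Sum>a\<in>F. c a *\<^sub>R f a)"
proof -
  from assms obtain t r where t: "finite t" "t \<subseteq> range f" "u = (\<Sum>a\<in>t. r a *\<^sub>R a)"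
    unfolding span_explicit by blast
  \<comment> \<open>The family may repeat vectors; an injective set of indices makes reindexing
    legitimate.\<close>
  from t(2) obtain F where F: "inj_on f F" "t = f ` F"
    by (auto simp: subset_image_inj)
  then have "finite F" "u = (\<Sum>a\<in>F. r (f a) *\<^sub>R f a)"
    using t by (simp_all add: sum.reindex finite_image_iff)
  then show ?thesis by (intro exI conjI)
qed

lemma blinfun_eq_of_total:
  assumes "closure (span (range x)) = UNIV" "\<And>a. blinfun_apply A (x a) = blinfun_apply B (x a)"
  shows "A = B"
proof (rule blinfun_eqI)
  fix u
  have "closed {u. blinfun_apply A u = blinfun_apply B u}"
    by (intro closed_Collect_eq continuous_intros)
  moreover have "span (range x) \<subseteq> {u. blinfun_apply A u = blinfun_apply B u}"
    using assms(2) by (intro span_minimal) (auto simp: subspace_def blinfun.bilinear_simps)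
  ultimately have "closure (span (range x)) \<subseteq> {u. blinfun_apply A u = blinfun_apply B u}"
    by (rule closure_minimal[rotated])
  then show "blinfun_apply A u = blinfun_apply B u" using assms(1) by blast
qed

text \<open>The closure of the span of the pairs \<open>(x a, y a)\<close> is the graph of the operator.\<close>

lemma blinfun_of_total:
  fixes x :: "'i \<Rightarrow> 'f::{real_inner,banach}" and y :: "'i \<Rightarrow> 'g::{real_inner,banach}"
  assumes tot: "closure (span (range x)) = UNIV"
    and K: "positive_kernel (\<lambda>a b. inner (x a) (x b) - inner (y a) (y b))"
  shows "\<exists>A. (\<forall>a. blinfun_apply A (x a) = y a) \<and> (\<forall>u. norm (blinfun_apply A u) \<le> norm u)"
proof -
  define G0 where "G0 = span (range (\<lambda>a. (x a, y a)))"
  define G where "G = closure G0"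
  have sG0: "subspace G0" by (simp add: G0_def subspace_span)
  have sG: "subspace G" unfolding G_def by (intro subspace_closure sG0)
  have le0: "norm v \<le> norm u" if uv: "(u, v) \<in> G0" for u v
  proof -
    obtain F c where F: "finite F" "(u, v) = (\<Sum>a\<in>F. c a *\<^sub>R (x a, y a))"
      using span_range_explicit[OF uv[unfolded G0_def]] by (elim exE conjE)
    have u: "u = (\<Sum>a\<in>F. c a *\<^sub>R x a)" and v: "v = (\<Sum>a\<in>F. c a *\<^sub>R y a)"
      using arg_cong[OF F(2), of fst] arg_cong[OF F(2), of snd]
      by (simp_all only: fst_sum snd_sum fst_conv snd_conv fst_scaleR snd_scaleR)
    have "0 \<le> (norm u)\<^sup>2 - (norm v)\<^sup>2"
    proof -
      have "0 \<le> (\<Sum>a\<in>F. \<Sum>b\<in>F. c a * c b * (inner (x a) (x b) - inner (y a) (y b)))"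
        using K F(1) unfolding positive_kernel_def by blast
      then show ?thesis by (simp only: right_diff_distrib sum_subtractf gram_sum u v)
    qed
    then have "(norm v)\<^sup>2 \<le> (norm u)\<^sup>2" by linarith
    then show ?thesis by (rule power2_le_imp_le) simp
  qed
  have le: "norm v \<le> norm u" if uv: "(u, v) \<in> G" for u v
  proof -
    have "closed {p :: 'f \<times> 'g. norm (snd p) \<le> norm (fst p)}" by (intro closed_Collect_le continuous_intros)
    moreover have "G0 \<subseteq> {p. norm (snd p) \<le> norm (fst p)}" using le0 by auto
    ultimately have "G \<subseteq> {p. norm (snd p) \<le> norm (fst p)}" unfolding G_def by (intro closure_minimal)
    then show ?thesis using uv by auto
  qed
  have total: "\<exists>v. (u, v) \<in> G" for u
  proof -
    have "u \<in> closure (span (range x))" using tot by simp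
    then obtain s where s: "\<And>n. s n \<in> span (range x)" "s \<longlonglongrightarrow> u" unfolding closure_sequential by blast
    have "span (range x) = fst ` G0"
      using linear_span_image[OF linear_fst, of "range (\<lambda>a. (x a, y a))"] by (simp add: G0_def image_image)
    then have fG: "s n \<in> fst ` G0" for n using s(1)[of n] by simp
    have "\<exists>p. p \<in> G0 \<and> fst p = s n" for n
      using fG[of n] by (elim imageE, intro exI conjI) simp_all
    then have "\<forall>n. \<exists>p. p \<in> G0 \<and> fst p = s n" ..
    from choice[OF this] obtain p where "\<forall>n. p n \<in> G0 \<and> fst (p n) = s n" by (elim exE)
    then have p: "p n \<in> G0" "fst (p n) = s n" for n by simp_all
    have d: "dist (snd (p m)) (snd (p n)) \<le> dist (s m) (s n)" for m n
      using le0[of "fst (p m - p n)" "snd (p m - p n)", unfolded prod.collapse, OF subspace_diff[OF sG0 p(1) p(1)]]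
      by (simp add: dist_norm p(2))
    have "Cauchy (\<lambda>n. snd (p n))"
    proof (rule metric_CauchyI)
      fix r :: real assume "0 < r"
      then obtain M where "\<And>m n. m \<ge> M \<Longrightarrow> n \<ge> M \<Longrightarrow> dist (s m) (s n) < r"
        using metric_CauchyD[OF LIMSEQ_imp_Cauchy[OF s(2)]] by blast
      then show "\<exists>M. \<forall>m\<ge>M. \<forall>n\<ge>M. dist (snd (p m)) (snd (p n)) < r"
        using d le_less_trans by blast
    qed
    then obtain v where v: "(\<lambda>n. snd (p n)) \<longlonglongrightarrow> v" using Cauchy_convergent convergent_def by blast
    have "(\<lambda>n. (s n, snd (p n))) = p" by (simp add: p(2)[symmetric])
    with tendsto_Pair[OF s(2) v] have "p \<longlonglongrightarrow> (u, v)" by simp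
    then have "(u, v) \<in> G" using p(1) unfolding G_def closure_sequential by blast
    then show ?thesis ..
  qed
  have uniq: "v = w" if "(u, v) \<in> G" "(u, w) \<in> G" for u v w
    using le[of 0 "v - w"] subspace_diff[OF sG that] by simp
  define f where "f u = (THE v. (u, v) \<in> G)" for u
  have f: "(u, f u) \<in> G" for u unfolding f_def using total[of u] uniq by (metis theI)
  have fI: "f u = v" if "(u, v) \<in> G" for u v using uniq[OF f that] .
  have "bounded_linear f"
  proof (rule bounded_linear_intro[where K = 1])
    show "f (a + b) = f a + f b" for a b using fI subspace_add[OF sG f[of a] f[of b]] by simp
    show "f (c *\<^sub>R a) = c *\<^sub>R f a" for a c using fI subspace_scale[OF sG f[of a], of c] by simp
    show "norm (f a) \<le> norm a * 1" for a using le[OF f[of a]] by simp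
  qed
  moreover have "f (x a) = y a" for a
  proof (rule fI)
    have "(x a, y a) \<in> G0" unfolding G0_def by (intro span_base) simp
    then show "(x a, y a) \<in> G" unfolding G_def using closure_subset by blast
  qed
  ultimately show ?thesis using le[OF f]
    by (intro exI[of _ "Blinfun f"]) (simp add: bounded_linear_Blinfun_apply)
qed

section \<open>Tensor powers\<close>

lemma inner_tens:
  assumes "hilbert_tensor_powers tens"
  shows "inner (tens hs) (tens gs) =
    (if length hs = length gs then \<Prod>i<length hs. inner (hs ! i) (gs ! i) else 0)"
  using assms by (simp add: hilbert_tensor_powers_def)

lemma inner_tens_prod_list:
  assumes "hilbert_tensor_powers tens"
  shows "inner (tens hs) (tens gs) =
    (if length hs = length gs then prod_list (map2 inner hs gs) else 0)"
  by (simp add: inner_tens[OF assms] prod.list_conv_set_nth atLeast0LessThan)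

lemma tens_total:
  assumes "hilbert_tensor_powers tens"
  shows "closure (span (range tens)) = UNIV"
  using assms by (simp add: hilbert_tensor_powers_def)

lemma eq_zero_if_orthogonal_tens:
  assumes ht: "hilbert_tensor_powers tens" and o: "\<And>gs. inner d (tens gs) = 0"
  shows "d = 0"
proof -
  have "closed {u. inner d u = 0}" by (intro closed_Collect_eq continuous_intros)
  moreover have "span (range tens) \<subseteq> {u. inner d u = 0}"
    using o by (intro span_minimal) (auto simp: subspace_def inner_add_right)
  ultimately have "closure (span (range tens)) \<subseteq> {u. inner d u = 0}" by (intro closure_minimal)
  then have "inner d d = 0" using tens_total[OF ht] by blast
  then show ?thesis by simp
qed

text \<open>Isolating the slot of \<open>x\<close> exhibits linearity in it. Tested against all
  elementary tensors, this yields the multilinearity of \<open>tens\<close>.\<close>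

lemma inner_tens_split:
  assumes ht: "hilbert_tensor_powers tens" and len: "length gs = length us + 1 + length ws"
  shows "inner (tens (us @ x # ws)) (tens gs) =
    prod_list (map2 inner us (take (length us) gs)) * inner x (gs ! length us) *
    prod_list (map2 inner ws (drop (Suc (length us)) gs))"
proof -
  have gs: "gs = take (length us) gs @ gs ! length us # drop (Suc (length us)) gs"
    using len by (intro id_take_nth_drop) simp
  show ?thesis
    using len by (subst gs) (simp add: inner_tens_prod_list[OF ht] min_def del: append_take_drop_id)
qed

lemma tens_add:
  assumes ht: "hilbert_tensor_powers tens"
  shows "tens (us @ (x + y) # ws) = tens (us @ x # ws) + tens (us @ y # ws)"
proof -
  have "inner (tens (us @ (x + y) # ws) - (tens (us @ x # ws) + tens (us @ y # ws))) (tens gs) = 0" for gs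
  proof (cases "length gs = length us + 1 + length ws")
    case True
    then show ?thesis
      by (simp add: inner_diff_left inner_add_left inner_tens_split[OF ht] algebra_simps)
  qed (simp add: inner_diff_left inner_add_left inner_tens[OF ht])
  from eq_zero_if_orthogonal_tens[OF ht this] show ?thesis by simp
qed

lemma tens_scaleR:
  assumes ht: "hilbert_tensor_powers tens"
  shows "tens (us @ (c *\<^sub>R x) # ws) = c *\<^sub>R tens (us @ x # ws)"
proof -
  have "inner (tens (us @ (c *\<^sub>R x) # ws) - c *\<^sub>R tens (us @ x # ws)) (tens gs) = 0" for gs
  proof (cases "length gs = length us + 1 + length ws")
    case True
    then show ?thesis
      by (simp add: inner_diff_left inner_tens_split[OF ht] algebra_simps)
  qed (simp add: inner_diff_left inner_tens[OF ht])
  from eq_zero_if_orthogonal_tens[OF ht this] show ?thesis by simp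
qed

lemma norm_tens_replicate_diff:
  assumes ht: "hilbert_tensor_powers tens"
  shows "(norm (tens (replicate n h) - tens (replicate n g)))\<^sup>2 =
    inner h h ^ n - 2 * inner h g ^ n + inner g g ^ n"
  by (simp add: power2_norm_eq_inner inner_diff_left inner_diff_right inner_tens[OF ht] inner_commute[of g h])

text \<open>The inner product formula writes the squared distance of two powers as a polynomial in
  inner products, so no multilinear estimate is involved.\<close>

lemma tendsto_tens_replicate:
  assumes ht: "hilbert_tensor_powers tens" and h: "h \<longlonglongrightarrow> g"
  shows "(\<lambda>m. tens (replicate n (h m))) \<longlonglongrightarrow> tens (replicate n g)"
proof -
  have "(\<lambda>m. inner (h m) (h m) ^ n - 2 * inner (h m) g ^ n + inner g g ^ n) \<longlonglongrightarrow>
      inner g g ^ n - 2 * inner g g ^ n + inner g g ^ n"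
    by (intro tendsto_intros h)
  then have "(\<lambda>m. (norm (tens (replicate n (h m)) - tens (replicate n g)))\<^sup>2) \<longlonglongrightarrow> 0"
    by (simp add: norm_tens_replicate_diff[OF ht])
  from tendsto_real_sqrt[OF this] have "(\<lambda>m. norm (tens (replicate n (h m)) - tens (replicate n g))) \<longlonglongrightarrow> 0"
    by simp
  then show ?thesis by (simp add: LIM_zero_iff tendsto_norm_zero_iff)
qed

subsection \<open>The symmetriser\<close>

text \<open>Resolves the descriptions behind \<open>symmetriser\<close> and
  \<open>tensor_power_map\<close> once an operator is exhibited; totality gives uniqueness.\<close>

lemma the_blinfun_of_total:
  assumes "closure (span (range x)) = UNIV" "\<And>a. blinfun_apply A (x a) = y a"
  shows "(THE A. \<forall>a. blinfun_apply A (x a) = y a) = A"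
proof (rule the_equality)
  fix B assume "\<forall>a. blinfun_apply B (x a) = y a"
  then show "B = A" by (intro blinfun_eq_of_total[OF assms(1)]) (simp add: assms(2))
qed (simp add: assms(2))

lemma prod_inner_permute_list:
  assumes "\<sigma> permutes {..<n}" "length hs = n" "length gs = n"
  shows "(\<Prod>i<n. inner (permute_list \<sigma> hs ! i) (permute_list \<sigma> gs ! i)) = (\<Prod>i<n. inner (hs ! i) (gs ! i))"
proof -
  have "(\<Prod>i<n. inner (permute_list \<sigma> hs ! i) (permute_list \<sigma> gs ! i)) = (\<Prod>i<n. inner (hs ! \<sigma> i) (gs ! \<sigma> i))"
    using assms by (intro prod.cong refl) (simp add: permute_list_nth)
  also have "\<dots> = (\<Prod>i<n. inner (hs ! i) (gs ! i))"
    by (rule prod.permute[OF assms(1), of "\<lambda>i. inner (hs ! i) (gs ! i)", symmetric, unfolded o_def])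
  finally show ?thesis .
qed

text \<open>Permuting factors preserves inner products within the \<open>n\<close>-th power, and the
  other powers are sent to 0. What is lost is therefore the Gram kernel of the family
  \<open>z\<close> of tensors of other lengths, which is positive.\<close>

lemma tens_permutation_operator:
  fixes tens :: "'h::{real_inner,banach} list \<Rightarrow> 'f::{real_inner,banach}"
  assumes ht: "hilbert_tensor_powers tens" and p: "\<sigma> permutes {..<n}"
  shows "\<exists>A :: 'f \<Rightarrow>\<^sub>L 'f. \<forall>hs. blinfun_apply A (tens hs) = (if length hs = n then tens (permute_list \<sigma> hs) else 0)"
proof -
  define y where "y hs = (if length hs = n then tens (permute_list \<sigma> hs) else 0)" for hs
  define z where "z hs = (if length hs = n then 0 else tens hs)" for hs
  have "inner (tens hs) (tens gs) - inner (y hs) (y gs) = inner (z hs) (z gs)" for hs gs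
    using prod_inner_permute_list[OF p, of hs gs]
    by (cases "length hs = n"; cases "length gs = n") (simp_all add: y_def z_def inner_tens[OF ht])
  then have "positive_kernel (\<lambda>hs gs. inner (tens hs) (tens gs) - inner (y hs) (y gs))"
    using positive_kernel_gram[of z] by simp
  from blinfun_of_total[OF tens_total[OF ht] this] show ?thesis
    unfolding y_def by (elim exE conjE) (intro exI)
qed

text \<open>The average of the permutation operators is the witness for the description.\<close>

lemma symmetriser_tens:
  fixes tens :: "'h::{real_inner,banach} list \<Rightarrow> 'f::{real_inner,banach}"
  assumes ht: "hilbert_tensor_powers tens"
  shows "blinfun_apply (symmetriser tens n) (tens hs) =
    (if length hs = n then (1 / fact n) *\<^sub>R (\<Sum>\<sigma> | \<sigma> permutes {..<n}. tens (permute_list \<sigma> hs)) else 0)"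
proof -
  have "\<forall>\<sigma>\<in>{\<sigma>. \<sigma> permutes {..<n}}. \<exists>A :: 'f \<Rightarrow>\<^sub>L 'f. \<forall>hs. blinfun_apply A (tens hs) =
      (if length hs = n then tens (permute_list \<sigma> hs) else 0)"
    using tens_permutation_operator[OF ht] by simp
  from bchoice[OF this] obtain U :: "(nat \<Rightarrow> nat) \<Rightarrow> 'f \<Rightarrow>\<^sub>L 'f" where "\<forall>\<sigma>\<in>{\<sigma>. \<sigma> permutes {..<n}}. \<forall>hs.
      blinfun_apply (U \<sigma>) (tens hs) = (if length hs = n then tens (permute_list \<sigma> hs) else 0)"
    by (elim exE)
  then have U: "blinfun_apply (U \<sigma>) (tens hs) = (if length hs = n then tens (permute_list \<sigma> hs) else 0)"
    if "\<sigma> permutes {..<n}" for \<sigma> hs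
    using that by simp
  define A where "A = (1 / fact n) *\<^sub>R (\<Sum>\<sigma> | \<sigma> permutes {..<n}. U \<sigma>)"
  have A: "blinfun_apply A (tens hs) =
    (if length hs = n then (1 / fact n) *\<^sub>R (\<Sum>\<sigma> | \<sigma> permutes {..<n}. tens (permute_list \<sigma> hs)) else 0)" for hs
    by (auto simp: A_def blinfun.scaleR_left blinfun.sum_left U intro!: sum.neutral)
  have "symmetriser tens n = A"
    unfolding symmetriser_def by (rule the_blinfun_of_total[OF tens_total[OF ht] A])
  then show ?thesis by (simp add: A)
qed

text \<open>Lists with the same multiset differ by a permutation, which is absorbed by the average
  over the group.\<close>

lemma symmetriser_tens_cong_mset:
  assumes ht: "hilbert_tensor_powers tens" and m: "mset hs = mset gs"
  shows "blinfun_apply (symmetriser tens n) (tens hs) = blinfun_apply (symmetriser tens n) (tens gs)"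
proof (cases "length gs = n")
  case True
  from m obtain \<tau> where \<tau>: "\<tau> permutes {..<length gs}" "permute_list \<tau> gs = hs" by (rule mset_eq_permutation)
  have lh: "length hs = n" using True m mset_eq_length by blast
  have "(\<Sum>\<sigma> | \<sigma> permutes {..<n}. tens (permute_list \<sigma> hs)) =
      (\<Sum>\<sigma> | \<sigma> permutes {..<n}. tens (permute_list (\<tau> \<circ> \<sigma>) gs))"
    using True \<tau> by (intro sum.cong refl arg_cong[where f = tens]) (auto simp: permute_list_compose)
  also have "\<dots> = (\<Sum>\<sigma> | \<sigma> permutes {..<n}. tens (permute_list \<sigma> gs))"
    using \<tau>(1) True by (intro setum_permutations_compose_left[symmetric]) simp
  finally show ?thesis using True lh by (simp add: symmetriser_tens[OF ht])
next
  case False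
  moreover have "length hs = length gs" using m mset_eq_length by blast
  ultimately show ?thesis by (simp add: symmetriser_tens[OF ht])
qed

lemma symmetriser_tens_replicate:
  assumes ht: "hilbert_tensor_powers tens"
  shows "blinfun_apply (symmetriser tens n) (tens (replicate n h)) = tens (replicate n h)"
proof -
  have "permute_list \<sigma> (replicate n h) = replicate n h" if "\<sigma> permutes {..<n}" for \<sigma>
    using that permutes_in_image[OF that] by (intro nth_equalityI) (auto simp: permute_list_nth)
  then have "(\<Sum>\<sigma> | \<sigma> permutes {..<n}. tens (permute_list \<sigma> (replicate n h))) = fact n *\<^sub>R tens (replicate n h)"
    by (simp add: card_permutations sum_constant_scaleR)
  then show ?thesis by (simp add: symmetriser_tens[OF ht])
qed

lemma symmetriser_idem:
  assumes ht: "hilbert_tensor_powers tens"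
  shows "blinfun_apply (symmetriser tens n) (blinfun_apply (symmetriser tens n) u) = blinfun_apply (symmetriser tens n) u"
proof -
  have "symmetriser tens n o\<^sub>L symmetriser tens n = symmetriser tens n"
  proof (rule blinfun_eq_of_total[OF tens_total[OF ht]])
    fix hs
    show "blinfun_apply (symmetriser tens n o\<^sub>L symmetriser tens n) (tens hs) = blinfun_apply (symmetriser tens n) (tens hs)"
    proof (cases "length hs = n")
      case True
      have "blinfun_apply (symmetriser tens n) (tens (permute_list \<sigma> hs)) = blinfun_apply (symmetriser tens n) (tens hs)"
        if "\<sigma> permutes {..<n}" for \<sigma>
        using that True by (intro symmetriser_tens_cong_mset[OF ht]) simp
      then have "(\<Sum>\<sigma> | \<sigma> permutes {..<n}. blinfun_apply (symmetriser tens n) (tens (permute_list \<sigma> hs))) =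
          fact n *\<^sub>R blinfun_apply (symmetriser tens n) (tens hs)"
        by (simp add: card_permutations sum_constant_scaleR)
      moreover have "blinfun_apply (symmetriser tens n) (blinfun_apply (symmetriser tens n) (tens hs)) =
          (1 / fact n) *\<^sub>R (\<Sum>\<sigma> | \<sigma> permutes {..<n}. blinfun_apply (symmetriser tens n) (tens (permute_list \<sigma> hs)))"
        unfolding symmetriser_tens[OF ht, of n hs] using True
        by (simp only: if_True refl blinfun.scaleR_right blinfun.sum_right)
      ultimately show ?thesis by simp
    qed (simp add: symmetriser_tens[OF ht] blinfun.zero_right)
  qed
  from arg_cong[OF this, of "\<lambda>B. blinfun_apply B u"] show ?thesis by simp
qed

lemma subspace_sym_power: "subspace (sym_power tens n)"
  unfolding sym_power_def
  by (rule linear_subspace_image[OF _ subspace_UNIV]) (auto intro: bounded_linear.linear blinfun.bounded_linear_right)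

subsection \<open>Tensor powers of a contraction\<close>

text \<open>The operator exists, and is a contraction, because tensor powers of a contraction have a
  positive kernel defect.\<close>

lemma
  fixes tens :: "'h::{real_inner,banach} list \<Rightarrow> 'f::{real_inner,banach}"
    and tens' :: "'k::{real_inner,banach} list \<Rightarrow> 'g::{real_inner,banach}"
    and e :: "nat \<Rightarrow> 'h" and e' :: "nat \<Rightarrow> 'k"
  assumes ht: "hilbert_tensor_powers tens" "hilbert_tensor_powers tens'"
    and onb: "orthonormal_basis_on J e" "orthonormal_basis_on J' e'"
    and R: "linear R" "\<And>h. norm (R h) \<le> norm h"
  shows tensor_power_map_tens: "blinfun_apply (tensor_power_map tens tens' n R) (tens hs) =
      (if length hs = n then tens' (map R hs) else 0)"
    and norm_tensor_power_map: "norm (blinfun_apply (tensor_power_map tens tens' n R) u) \<le> norm u"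
proof -
  define y where "y hs = (if length hs = n then tens' (map R hs) else 0)" for hs
  define z where "z hs = (if length hs = n then 0 else tens hs)" for hs
  define r where "r hs = (if length hs = n then 1 else 0 :: real)" for hs :: "'h list"
  \<comment> \<open>The defect splits by length: \<open>z\<close> accounts for the lists sent to 0,
    and \<open>r\<close> cuts the contraction kernel down to lists of length
    \<open>n\<close>.\<close>
  have "inner (tens hs) (tens gs) - inner (y hs) (y gs) = inner (z hs) (z gs) + r hs * r gs *
      ((\<Prod>i<n. inner (hs ! i) (gs ! i)) - (\<Prod>i<n. inner (R (hs ! i)) (R (gs ! i))))" for hs gs
    by (auto simp: y_def z_def r_def inner_tens[OF ht(1)] inner_tens[OF ht(2)])
  then have "positive_kernel (\<lambda>hs gs. inner (tens hs) (tens gs) - inner (y hs) (y gs))"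
    using positive_kernel_add[OF positive_kernel_gram[of z] positive_kernel_scale[OF
          positive_kernel_tensor_contraction[OF onb R, of "\<lambda>hs i. hs ! i" n], of r]]
    by (simp only:)
  from blinfun_of_total[OF tens_total[OF ht(1)] this]
  obtain A where A: "\<And>hs. blinfun_apply A (tens hs) = y hs" "\<And>u. norm (blinfun_apply A u) \<le> norm u" by blast
  have "tensor_power_map tens tens' n R = A"
    unfolding tensor_power_map_def by (rule the_blinfun_of_total[OF tens_total[OF ht(1)] A(1)[unfolded y_def]])
  then show "blinfun_apply (tensor_power_map tens tens' n R) (tens hs) =
      (if length hs = n then tens' (map R hs) else 0)"
    "norm (blinfun_apply (tensor_power_map tens tens' n R) u) \<le> norm u"
    using A by (simp_all add: y_def)
qed

lemma tensor_power_map_symmetriser: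
  fixes tens :: "'h::{real_inner,banach} list \<Rightarrow> 'f::{real_inner,banach}"
    and tens' :: "'k::{real_inner,banach} list \<Rightarrow> 'g::{real_inner,banach}"
    and e :: "nat \<Rightarrow> 'h" and e' :: "nat \<Rightarrow> 'k"
  assumes ht: "hilbert_tensor_powers tens" "hilbert_tensor_powers tens'"
    and onb: "orthonormal_basis_on J e" "orthonormal_basis_on J' e'"
    and R: "linear R" "\<And>h. norm (R h) \<le> norm h"
  shows "blinfun_apply (tensor_power_map tens tens' n R) (blinfun_apply (symmetriser tens n) u) =
    blinfun_apply (symmetriser tens' n) (blinfun_apply (tensor_power_map tens tens' n R) u)"
proof -
  note A = tensor_power_map_tens[OF ht onb R, of n]
  have "tensor_power_map tens tens' n R o\<^sub>L symmetriser tens n = symmetriser tens' n o\<^sub>L tensor_power_map tens tens' n R"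
  proof (rule blinfun_eq_of_total[OF tens_total[OF ht(1)]])
    fix hs
    show "blinfun_apply (tensor_power_map tens tens' n R o\<^sub>L symmetriser tens n) (tens hs) =
        blinfun_apply (symmetriser tens' n o\<^sub>L tensor_power_map tens tens' n R) (tens hs)"
      by (auto simp: symmetriser_tens[OF ht(1)] symmetriser_tens[OF ht(2)] A blinfun.scaleR_right blinfun.sum_right
          blinfun.zero_right permute_list_map intro!: sum.cong)
  qed
  from arg_cong[OF this, of "\<lambda>B. blinfun_apply B u"] show ?thesis by simp
qed

subsection \<open>Symmetric multilinear maps\<close>

text \<open>The model is the symmetriser applied to \<open>tens\<close>. It vanishes on lists of
  other lengths, so the axioms can be stated without fixing a length.\<close>

locale symmetric_multilinear =
  fixes s :: "'h::real_vector list \<Rightarrow> 'f::real_normed_vector"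
  assumes add: "s (us @ (x + y) # ws) = s (us @ x # ws) + s (us @ y # ws)"
    and scaleR: "s (us @ (c *\<^sub>R x) # ws) = c *\<^sub>R s (us @ x # ws)"
    and cong_mset: "mset hs = mset gs \<Longrightarrow> s hs = s gs"
begin

lemma scaleR_replicate: "s (us @ replicate k (c *\<^sub>R x) @ ws) = c ^ k *\<^sub>R s (us @ replicate k x @ ws)"
proof (induction k arbitrary: us)
  case (Suc k)
  have "s (us @ replicate (Suc k) (c *\<^sub>R x) @ ws) = c *\<^sub>R s ((us @ [x]) @ replicate k (c *\<^sub>R x) @ ws)"
    using scaleR[of us c x "replicate k (c *\<^sub>R x) @ ws"] by simp
  also have "\<dots> = c ^ Suc k *\<^sub>R s (us @ replicate (Suc k) x @ ws)"
    unfolding Suc.IH by simp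
  finally show ?case .
qed simp

text \<open>Pascal's rule; the prefix \<open>us\<close> stores the factor already chosen, and
  symmetry moves it back among the others.\<close>

lemma binomial:
  "s (us @ replicate n (x + y)) =
     (\<Sum>k\<le>n. real (n choose k) *\<^sub>R s (us @ replicate k x @ replicate (n - k) y))"
proof (induction n arbitrary: us)
  case (Suc n)
  let ?t = "\<lambda>k. s (us @ replicate k x @ replicate (Suc n - k) y)"
  have 1: "s ((us @ [x]) @ replicate k x @ replicate (n - k) y) = ?t (Suc k)" for k
    by (rule cong_mset) simp
  have 2: "s ((us @ [y]) @ replicate k x @ replicate (n - k) y) = ?t k" if "k \<in> {..n}" for k
    using that by (intro cong_mset) (simp add: Suc_diff_le)
  have "s (us @ replicate (Suc n) (x + y)) = s ((us @ [x]) @ replicate n (x + y)) + s ((us @ [y]) @ replicate n (x + y))"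
    using add[of us x y "replicate n (x + y)"] by simp
  also have "s ((us @ [x]) @ replicate n (x + y)) = (\<Sum>k\<le>n. real (n choose k) *\<^sub>R ?t (Suc k))"
    unfolding Suc.IH by (intro sum.cong refl) (simp only: 1)
  also have "s ((us @ [y]) @ replicate n (x + y)) = (\<Sum>k\<le>n. real (n choose k) *\<^sub>R ?t k)"
    unfolding Suc.IH by (intro sum.cong refl) (simp only: 2)
  \<comment> \<open>The extra summand carries \<open>n choose Suc n\<close>, which is 0.\<close>
  also have "(\<Sum>k\<le>n. real (n choose k) *\<^sub>R ?t k) = (\<Sum>k\<le>Suc n. real (n choose k) *\<^sub>R ?t k)" by simp
  also have "\<dots> = ?t 0 + (\<Sum>k\<le>n. real (n choose Suc k) *\<^sub>R ?t (Suc k))"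
    by (subst sum.atMost_Suc_shift) simp
  also have "(\<Sum>k\<le>n. real (n choose k) *\<^sub>R ?t (Suc k)) + (?t 0 + (\<Sum>k\<le>n. real (n choose Suc k) *\<^sub>R ?t (Suc k)))
      = ?t 0 + (\<Sum>k\<le>n. real (Suc n choose Suc k) *\<^sub>R ?t (Suc k))"
    by (simp only: sum.distrib[symmetric] scaleR_left_distrib[symmetric] binomial_Suc_Suc of_nat_add
        add.left_commute[of _ "?t 0"])
  also have "\<dots> = (\<Sum>k\<le>Suc n. real (Suc n choose k) *\<^sub>R ?t k)"
    by (subst sum.atMost_Suc_shift) simp
  finally show ?case .
qed simp

end

text \<open>The coefficient is the derivative at 0: the difference quotients \<open>p t\<close> lie
  in \<open>V\<close> for \<open>t \<noteq> 0\<close>, and \<open>V\<close> is closed.\<close>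

lemma polynomial_coeff_1_in_closed_subspace:
  fixes x :: "nat \<Rightarrow> 'f::real_normed_vector"
  assumes V: "subspace V" "closed V" and x: "\<And>t :: real. (\<Sum>k\<le>Suc n. t ^ k *\<^sub>R x k) \<in> V"
  shows "x 1 \<in> V"
proof -
  define p where "p t = (\<Sum>k\<le>n. t ^ k *\<^sub>R x (Suc k))" for t :: real
  have split: "(\<Sum>k\<le>Suc n. t ^ k *\<^sub>R x k) = x 0 + t *\<^sub>R p t" for t
    by (subst sum.atMost_Suc_shift) (simp add: p_def scaleR_sum_right)
  have x0: "x 0 \<in> V" using x[of 0] unfolding split by simp
  have pV: "p t \<in> V" if "t \<noteq> 0" for t
  proof -
    have "t *\<^sub>R p t \<in> V" using subspace_diff[OF V(1) x[of t] x0] unfolding split by simp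
    from subspace_scale[OF V(1) this, of "1 / t"] show ?thesis using that by simp
  qed
  have "isCont p 0" unfolding p_def by (intro continuous_intros)
  then have "(p \<longlongrightarrow> p 0) (at 0)" by (rule isContD)
  moreover have "p 0 = x 1"
    unfolding p_def by (subst sum.atMost_shift) simp
  ultimately show ?thesis
    using Lim_in_closed_set[OF V(2), of p "at 0" "x 1"] pV by (simp add: eventually_at_filter)
qed

text \<open>The mixed values are derivatives of \<open>t \<mapsto> s [h + t w, \<dots>, h + t w]\<close>.\<close>

lemma (in symmetric_multilinear) polarisation:
  assumes V: "subspace V" "closed V" and D: "subspace D"
    and diag: "\<And>h. h \<in> D \<Longrightarrow> s (replicate n h) \<in> V"
    and hs: "set hs \<subseteq> D" "length hs = n"
  shows "s hs \<in> V"
proof -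
  \<comment> \<open>Factors are freed one at a time. The remaining slots hold copies of a single
    \<open>h\<close>, kept general so that \<open>t *\<^sub>R w + h\<close> can be
    substituted.\<close>
  have "s (ws @ replicate (n - length ws) h) \<in> V" if "set ws \<subseteq> D" "h \<in> D" "length ws \<le> n" for ws h
    using that
  proof (induction ws arbitrary: h rule: rev_induct)
    case Nil
    then show ?case using diag by simp
  next
    case (snoc w ws)
    obtain m where m: "n - length ws = Suc m" using snoc.prems(3) by (cases "n - length ws") auto
    have "(\<Sum>k\<le>Suc m. t ^ k *\<^sub>R (real (Suc m choose k) *\<^sub>R s (ws @ replicate k w @ replicate (Suc m - k) h))) \<in> V" for t
    proof -
      have "t *\<^sub>R w + h \<in> D" using snoc.prems(1,2) by (intro subspace_add[OF D] subspace_scale[OF D]) auto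
      then have "s (ws @ replicate (Suc m) (t *\<^sub>R w + h)) \<in> V"
        using snoc.IH[of "t *\<^sub>R w + h"] snoc.prems(1,3) unfolding m by simp
      moreover have "s (ws @ replicate (Suc m) (t *\<^sub>R w + h)) =
          (\<Sum>k\<le>Suc m. t ^ k *\<^sub>R (real (Suc m choose k) *\<^sub>R s (ws @ replicate k w @ replicate (Suc m - k) h)))"
        unfolding binomial by (intro sum.cong refl) (simp only: scaleR_replicate scaleR_left_commute)
      ultimately show ?thesis by (simp only:)
    qed
    from subspace_scale[OF V(1) polynomial_coeff_1_in_closed_subspace[OF V this], of "1 / real (Suc m)"]
    have "s (ws @ w # replicate m h) \<in> V" by (simp del: of_nat_Suc)
    moreover have "n - length (ws @ [w]) = m" using m by simp
    ultimately show ?case by (simp only: append_assoc append_Cons append_Nil)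
  qed
  \<comment> \<open>With \<open>n\<close> free factors no copy of the diagonal vector is left, so 0
    can be taken for it.\<close>
  from this[OF hs(1) subspace_0[OF D]] hs(2) show ?thesis by simp
qed

lemma symmetric_multilinear_symmetriser:
  assumes ht: "hilbert_tensor_powers tens"
  shows "symmetric_multilinear (\<lambda>hs. blinfun_apply (symmetriser tens n) (tens hs))"
proof
  show "blinfun_apply (symmetriser tens n) (tens hs) = blinfun_apply (symmetriser tens n) (tens gs)"
    if "mset hs = mset gs" for hs gs
    by (rule symmetriser_tens_cong_mset[OF ht that])
qed (simp_all add: tens_add[OF ht] tens_scaleR[OF ht] blinfun.add_right blinfun.scaleR_right)

section \<open>Square integrable functions\<close>

lemma L2spaceD: "f \<in> L2space M \<Longrightarrow> f \<in> borel_measurable M" "f \<in> L2space M \<Longrightarrow> integrable M (\<lambda>x. (f x)\<^sup>2)"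
  by (auto simp: L2space_def)

lemma power2_sum_le: "(a + b)\<^sup>2 \<le> 2 * a\<^sup>2 + 2 * (b::real)\<^sup>2"
  using sum_squares_bound[of a b] by (simp add: power2_sum)

lemma L2space_add:
  assumes "f \<in> L2space M" "g \<in> L2space M"
  shows "(\<lambda>x. f x + g x) \<in> L2space M"
proof -
  have "integrable M (\<lambda>x. (f x + g x)\<^sup>2)"
  proof (rule Bochner_Integration.integrable_bound)
    show "integrable M (\<lambda>x. 2 * (f x)\<^sup>2 + 2 * (g x)\<^sup>2)" using assms by (auto simp: L2space_def)
  qed (use assms power2_sum_le in \<open>auto simp: L2space_def\<close>)
  then show ?thesis using assms by (auto simp: L2space_def)
qed

lemma L2space_mult: "f \<in> L2space M \<Longrightarrow> (\<lambda>x. c * f x) \<in> L2space M"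
  by (auto simp: L2space_def power_mult_distrib)

lemma L2space_diff: "f \<in> L2space M \<Longrightarrow> g \<in> L2space M \<Longrightarrow> (\<lambda>x. f x - g x) \<in> L2space M"
  using L2space_add[of f M "\<lambda>x. (-1) * g x"] L2space_mult[of g M "-1"] by simp

lemma L2space_sum: "(\<And>i. i \<in> A \<Longrightarrow> f i \<in> L2space M) \<Longrightarrow> (\<lambda>x. \<Sum>i\<in>A. f i x) \<in> L2space M"
proof (induction A rule: infinite_finite_induct)
  case (insert i A)
  then have "(\<lambda>x. f i x + (\<Sum>i\<in>A. f i x)) \<in> L2space M" by (intro L2space_add) auto
  then show ?case using insert.hyps by simp
qed (simp_all add: L2space_def)

lemma L2norm_nonneg: "0 \<le> L2norm M f"
  by (simp add: L2norm_def)

lemma L2norm_power2: "(L2norm M f)\<^sup>2 = (\<integral>x. (f x)\<^sup>2 \<partial>M)"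
  by (simp add: L2norm_def)

lemma L2norm_cong_AE:
  assumes "f \<in> borel_measurable M" "g \<in> borel_measurable M" "AE x in M. f x = g x"
  shows "L2norm M f = L2norm M g"
proof -
  have "(\<integral>x. (f x)\<^sup>2 \<partial>M) = (\<integral>x. (g x)\<^sup>2 \<partial>M)"
    using assms by (intro integral_cong_AE) auto
  then show ?thesis by (simp add: L2norm_def)
qed

text \<open>The factor 2 avoids Minkowski's inequality; it is harmless in limit arguments.\<close>

lemma L2norm_add_le:
  assumes "f \<in> L2space M" "g \<in> L2space M"
  shows "L2norm M (\<lambda>x. f x + g x) \<le> 2 * L2norm M f + 2 * L2norm M g"
proof (rule power2_le_imp_le)
  have "(L2norm M (\<lambda>x. f x + g x))\<^sup>2 \<le> (\<integral>x. 2 * (f x)\<^sup>2 + 2 * (g x)\<^sup>2 \<partial>M)"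
    unfolding L2norm_power2 using power2_sum_le L2spaceD[OF assms(1)] L2spaceD[OF assms(2)] L2spaceD(2)[OF L2space_add[OF assms]]
    by (intro integral_mono) auto
  also have "\<dots> = 2 * (L2norm M f)\<^sup>2 + 2 * (L2norm M g)\<^sup>2"
    using L2spaceD[OF assms(1)] L2spaceD[OF assms(2)] by (simp add: L2norm_power2)
  also have "\<dots> \<le> (2 * L2norm M f + 2 * L2norm M g)\<^sup>2"
    using mult_nonneg_nonneg[OF L2norm_nonneg L2norm_nonneg, of M f M g]
    by (simp add: power2_sum power_mult_distrib)
  finally show "(L2norm M (\<lambda>x. f x + g x))\<^sup>2 \<le> (2 * L2norm M f + 2 * L2norm M g)\<^sup>2" .
qed (simp add: L2norm_nonneg)

lemma L2norm_uminus: "L2norm M (\<lambda>x. - f x) = L2norm M f"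
  by (simp add: L2norm_def)

lemma L2norm_diff_le:
  assumes "f \<in> L2space M" "g \<in> L2space M"
  shows "L2norm M (\<lambda>x. f x - g x) \<le> 2 * L2norm M f + 2 * L2norm M g"
  using L2norm_add_le[of f M "\<lambda>x. - g x"] L2space_mult[of g M "-1"] assms by (simp add: L2norm_uminus)

lemma AE_zero_if_L2norm_zero:
  assumes "f \<in> L2space M" "L2norm M f \<le> 0"
  shows "AE x in M. f x = 0"
proof -
  have "(\<integral>x. (f x)\<^sup>2 \<partial>M) = 0" using assms L2norm_power2[of M f] L2norm_nonneg[of M f] by simp
  then have "AE x in M. (f x)\<^sup>2 = 0"
    using assms by (subst (asm) integral_nonneg_eq_0_iff_AE) (auto simp: L2space_def)
  then show ?thesis by simp
qed

lemma AE_zero_if_L2norm_le_tendsto: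
  assumes "f \<in> L2space M" "\<And>n. L2norm M f \<le> d n" "d \<longlonglongrightarrow> 0"
  shows "AE x in M. f x = 0"
  using assms(1) LIMSEQ_le_const[OF assms(3)] assms(2) by (intro AE_zero_if_L2norm_zero) auto

text \<open>The squared differences tend to 0 in \<open>L\<^sup>1\<close>, which yields almost
  everywhere convergence along a subsequence.\<close>

lemma AE_tendsto_subseq:
  assumes f: "\<And>n. f n \<in> L2space M" "g \<in> L2space M" and lim: "(\<lambda>n. L2norm M (\<lambda>x. f n x - g x)) \<longlonglongrightarrow> 0"
  shows "\<exists>r::nat \<Rightarrow> nat. strict_mono r \<and> (AE x in M. (\<lambda>n. f (r n) x) \<longlonglongrightarrow> g x)"
proof -
  have "(\<lambda>n. (L2norm M (\<lambda>x. f n x - g x))\<^sup>2) \<longlonglongrightarrow> 0\<^sup>2" by (intro tendsto_power lim)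
  then have "(\<lambda>n. \<integral>x. norm ((f n x - g x)\<^sup>2) \<partial>M) \<longlonglongrightarrow> 0"
    by (simp add: L2norm_power2)
  with tendsto_L1_AE_subseq[of M "\<lambda>n x. (f n x - g x)\<^sup>2"] L2spaceD(2)[OF L2space_diff[OF f]]
  obtain r where r: "strict_mono r" "AE x in M. (\<lambda>n. (f (r n) x - g x)\<^sup>2) \<longlonglongrightarrow> 0" by blast
  from r(2) have "AE x in M. (\<lambda>n. f (r n) x) \<longlonglongrightarrow> g x"
  proof eventually_elim
    case (elim x)
    from tendsto_real_sqrt[OF elim] have "(\<lambda>n. \<bar>f (r n) x - g x\<bar>) \<longlonglongrightarrow> 0" by simp
    then show ?case by (simp add: tendsto_rabs_zero_iff LIM_zero_iff)
  qed
  with r(1) show ?thesis by blast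
qed

lemma L2_linear_onD:
  assumes "L2_linear_on S M F"
  shows "u \<in> S \<Longrightarrow> F u \<in> L2space M"
    "u \<in> S \<Longrightarrow> v \<in> S \<Longrightarrow> AE x in M. F (u + v) x = F u x + F v x"
    "u \<in> S \<Longrightarrow> AE x in M. F (c *\<^sub>R u) x = c * F u x"
  using assms by (auto simp: L2_linear_on_def)

lemma L2_linear_on_zero:
  assumes "L2_linear_on S M F" "subspace S"
  shows "AE x in M. F 0 x = 0"
  using L2_linear_onD(3)[OF assms(1) subspace_0[OF assms(2)], of 0] by simp

lemma L2_linear_on_sum:
  assumes F: "L2_linear_on S M F" and S: "subspace S" and A: "finite A" "\<And>i. i \<in> A \<Longrightarrow> u i \<in> S"
  shows "AE x in M. F (\<Sum>i\<in>A. c i *\<^sub>R u i) x = (\<Sum>i\<in>A. c i * F (u i) x)"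
  using A
proof (induction rule: finite_induct)
  case empty
  then show ?case using L2_linear_on_zero[OF F S] by simp
next
  case (insert i A)
  have "(\<Sum>i\<in>A. c i *\<^sub>R u i) \<in> S" "c i *\<^sub>R u i \<in> S"
    using insert.prems by (auto intro!: subspace_sum[OF S] subspace_scale[OF S])
  from L2_linear_onD(2)[OF F this(2,1)] L2_linear_onD(3)[OF F, of "u i" "c i"] insert
  have "AE x in M. F (c i *\<^sub>R u i + (\<Sum>i\<in>A. c i *\<^sub>R u i)) x = F (c i *\<^sub>R u i) x + F (\<Sum>i\<in>A. c i *\<^sub>R u i) x"
    "AE x in M. F (c i *\<^sub>R u i) x = c i * F (u i) x"
    "AE x in M. F (\<Sum>i\<in>A. c i *\<^sub>R u i) x = (\<Sum>i\<in>A. c i * F (u i) x)" by auto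
  then show ?case
  proof eventually_elim
    case (elim x)
    then show ?case using insert.hyps by simp
  qed
qed

lemma L2_linear_on_diff:
  assumes F: "L2_linear_on S M F" and S: "subspace S" and uv: "u \<in> S" "v \<in> S"
  shows "AE x in M. F (u - v) x = F u x - F v x"
  using L2_linear_onD(2)[OF F subspace_diff[OF S uv] uv(2)] by (auto elim: eventually_mono)

lemma L2_contractionD:
  assumes "L2_contraction N M P" "f \<in> L2space N"
  shows "P f \<in> L2space M" "L2norm M (P f) \<le> L2norm N f"
    "g \<in> L2space N \<Longrightarrow> AE x in M. P (\<lambda>y. f y + g y) x = P f x + P g x"
    "AE x in M. P (\<lambda>y. c * f y) x = c * P f x"
  using assms by (auto simp: L2_contraction_def)

lemma L2_contraction_diff:
  assumes P: "L2_contraction N M P" and f: "f \<in> L2space N" "g \<in> L2space N"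
  shows "AE x in M. P (\<lambda>y. f y - g y) x = P f x - P g x"
  using L2_contractionD(3)[OF P L2space_diff[OF f] f(2)] by (auto elim: eventually_mono)

lemma L2_contraction_cong_AE:
  assumes P: "L2_contraction N M P" and f: "f \<in> L2space N" "g \<in> L2space N" and eq: "AE x in N. f x = g x"
  shows "AE x in M. P f x = P g x"
proof -
  have "L2norm N (\<lambda>y. f y - g y) = L2norm N (\<lambda>y. 0)"
    using eq L2spaceD(1)[OF f(1)] L2spaceD(1)[OF f(2)] by (intro L2norm_cong_AE) auto
  then have "L2norm M (P (\<lambda>y. f y - g y)) \<le> 0"
    using L2_contractionD(2)[OF P L2space_diff[OF f]] by (simp add: L2norm_def)
  from AE_zero_if_L2norm_zero[OF L2_contractionD(1)[OF P L2space_diff[OF f]] this] L2_contraction_diff[OF P f]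
  show ?thesis by eventually_elim simp
qed

lemma L2_contraction_sum:
  assumes P: "L2_contraction N M P" and f: "finite A" "\<And>i. i \<in> A \<Longrightarrow> f i \<in> L2space N"
  shows "AE x in M. P (\<lambda>y. \<Sum>i\<in>A. c i * f i y) x = (\<Sum>i\<in>A. c i * P (f i) x)"
  using f
proof (induction rule: finite_induct)
  case empty
  have "(\<lambda>y. 0) \<in> L2space N" by (simp add: L2space_def)
  from L2_contractionD(4)[OF P this, of 0] show ?case by simp
next
  case (insert i A)
  have "(\<lambda>y. c i * f i y) \<in> L2space N" "(\<lambda>y. \<Sum>i\<in>A. c i * f i y) \<in> L2space N"
    using insert.prems by (auto intro!: L2space_sum L2space_mult)
  from L2_contractionD(3)[OF P this] L2_contractionD(4)[OF P, of "f i" "c i"] insert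
  have "AE x in M. P (\<lambda>y. c i * f i y + (\<Sum>i\<in>A. c i * f i y)) x = P (\<lambda>y. c i * f i y) x + P (\<lambda>y. \<Sum>i\<in>A. c i * f i y) x"
    "AE x in M. P (\<lambda>y. c i * f i y) x = c i * P (f i) x"
    "AE x in M. P (\<lambda>y. \<Sum>i\<in>A. c i * f i y) x = (\<Sum>i\<in>A. c i * P (f i) x)" by auto
  then show ?case
  proof eventually_elim
    case (elim x)
    then show ?case using insert.hyps by simp
  qed
qed

text \<open>Lets density arguments run in the vector space although the values of \<open>B\<close>
  are determined only almost everywhere.\<close>

lemma
  fixes B :: "'v::real_normed_vector \<Rightarrow> 'a \<Rightarrow> real"
  assumes B: "L2_linear_on UNIV M B" and C: "\<And>u. L2norm M (B u) \<le> C * norm u"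
  shows subspace_AE_zero: "subspace {u. AE x in M. B u x = 0}"
    and closed_AE_zero: "closed {u. AE x in M. B u x = 0}"
proof -
  show "subspace {u. AE x in M. B u x = 0}"
  proof (rule subspaceI)
    show "0 \<in> {u. AE x in M. B u x = 0}" using L2_linear_on_zero[OF B subspace_UNIV] by simp
    show "u + v \<in> {u. AE x in M. B u x = 0}" if "u \<in> {u. AE x in M. B u x = 0}" "v \<in> {u. AE x in M. B u x = 0}" for u v
    proof -
      from that have "AE x in M. B u x = 0" "AE x in M. B v x = 0" by auto
      with L2_linear_onD(2)[OF B, of u v] have "AE x in M. B (u + v) x = 0" by auto
      then show ?thesis by simp
    qed
    show "c *\<^sub>R u \<in> {u. AE x in M. B u x = 0}" if "u \<in> {u. AE x in M. B u x = 0}" for u c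
    proof -
      from that have "AE x in M. B u x = 0" by auto
      with L2_linear_onD(3)[OF B, of u c] have "AE x in M. B (c *\<^sub>R u) x = 0" by auto
      then show ?thesis by simp
    qed
  qed
  show "closed {u. AE x in M. B u x = 0}"
    unfolding closed_sequential_limits
  proof (intro allI impI, elim conjE)
    fix w u assume w: "\<forall>n. w n \<in> {u. AE x in M. B u x = 0}" "w \<longlonglongrightarrow> u"
    have "AE x in M. B u x = 0"
    proof (rule AE_zero_if_L2norm_le_tendsto)
      show L2: "B u \<in> L2space M" using L2_linear_onD(1)[OF B] by simp
      show "L2norm M (B u) \<le> C * norm (u - w n)" for n
      proof -
        have "AE x in M. B (w n) x = 0" using w(1) by simp
        with L2_linear_on_diff[OF B subspace_UNIV, of u "w n"] have "AE x in M. B u x = B (u - w n) x" by auto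
        then have "L2norm M (B u) = L2norm M (B (u - w n))"
          using L2_linear_onD(1)[OF B] by (intro L2norm_cong_AE L2spaceD) auto
        then show ?thesis using C by simp
      qed
      have "(\<lambda>n. C * norm (u - w n)) \<longlonglongrightarrow> C * norm (u - u)" by (intro tendsto_intros w(2))
      then show "(\<lambda>n. C * norm (u - w n)) \<longlonglongrightarrow> 0" by simp
    qed
    then show "u \<in> {u. AE x in M. B u x = 0}" by simp
  qed
qed

section \<open>Stochastic integrals of powers\<close>

lemma tendsto_scaled_hermite:
  assumes "a \<longlonglongrightarrow> a0" "y \<longlonglongrightarrow> y0"
  shows "(\<lambda>m. scaled_hermite (a m) n (y m)) \<longlonglongrightarrow> scaled_hermite a0 n y0"
proof -
  have "(\<lambda>m. gauss_coeff (a m) i) \<longlonglongrightarrow> gauss_coeff a0 i" for i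
    by (cases "even i") (auto simp: gauss_coeff_def intro!: tendsto_intros assms)
  then show ?thesis unfolding scaled_hermite_def by (intro tendsto_intros assms) auto
qed

lemma wiener_mapD:
  assumes "wiener_map M j \<phi>"
  shows "L2_linear_on UNIV M \<phi>" "L2norm M (\<phi> h) = norm h" "\<phi> h \<in> L2space M"
    "AE x in M. \<phi> (dual_map j xs) x = blinfun_apply xs x"
  using assms by (auto simp: wiener_map_def L2_linear_on_def)

text \<open>Induction along the basis vectors: those in \<open>js\<close> already have their
  exponents \<open>ks\<close>, and the remaining power \<open>m\<close> belongs to a combination of
  the later ones. The binomial formulas for symmetric tensors and for Hermite polynomials split off
  the next vector in parallel.\<close>

lemma stochastic_integral_mixed:
  fixes e :: "nat \<Rightarrow> 'h::{real_inner,banach}" and tens :: "'h list \<Rightarrow> 'f::{real_inner,banach}"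
  assumes ht: "hilbert_tensor_powers tens" and si: "stochastic_integral M tens J e \<phi> n I"
  shows "sorted_wrt (<) (js @ is) \<Longrightarrow> set (js @ is) \<subseteq> J \<Longrightarrow> length ks = length js \<Longrightarrow> sum_list ks + m = n \<Longrightarrow>
    AE x in M. I (blinfun_apply (symmetriser tens n)
       (tens (concat (map2 (\<lambda>i k. replicate k (e i)) js ks) @ replicate m (\<Sum>i\<leftarrow>is. a i *\<^sub>R e i)))) x =
     (\<Prod>l<length js. poly (hermite (ks ! l)) (\<phi> (e (js ! l)) x)) *
       scaled_hermite (\<Sum>i\<leftarrow>is. (a i)\<^sup>2) m (\<Sum>i\<leftarrow>is. a i * \<phi> (e i) x)"
proof (induction "is" arbitrary: js ks m)
  case Nil
  interpret s: symmetric_multilinear "\<lambda>hs. blinfun_apply (symmetriser tens n) (tens hs)"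
    by (rule symmetric_multilinear_symmetriser[OF ht])
  have lin: "L2_linear_on (sym_power tens n) M I" using si by (simp add: stochastic_integral_def)
  show ?case
  \<comment> \<open>The remaining vector is now 0. Its zeroth power leaves the prescribed product,
    and every higher power makes both sides vanish.\<close>
  proof (cases m)
    case 0
    then show ?thesis using si Nil by (simp add: stochastic_integral_def scaled_hermite_0_0)
  next
    case (Suc m')
    have "blinfun_apply (symmetriser tens n) (tens (concat (map2 (\<lambda>i k. replicate k (e i)) js ks) @ replicate m 0)) = 0"
      using s.scaleR_replicate[of "concat (map2 (\<lambda>i k. replicate k (e i)) js ks)" m 0 0 "[]"] Suc by simp
    then show ?thesis using L2_linear_on_zero[OF lin subspace_sym_power] Suc by (simp add: scaled_hermite_0_0)
  qed
next
  case (Cons j "is")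
  interpret s: symmetric_multilinear "\<lambda>hs. blinfun_apply (symmetriser tens n) (tens hs)"
    by (rule symmetric_multilinear_symmetriser[OF ht])
  have lin: "L2_linear_on (sym_power tens n) M I" using si by (simp add: stochastic_integral_def)
  define us where "us = concat (map2 (\<lambda>i k. replicate k (e i)) js ks)"
  define v where "v = (\<Sum>i\<leftarrow>is. a i *\<^sub>R e i)"
  define u where "u k = blinfun_apply (symmetriser tens n) (tens (us @ replicate k (e j) @ replicate (m - k) v))" for k
  have u: "u k \<in> sym_power tens n" for k by (simp add: u_def sym_power_def)
  have "blinfun_apply (symmetriser tens n) (tens (us @ replicate m (a j *\<^sub>R e j + v))) =
      (\<Sum>k\<le>m. (real (m choose k) * a j ^ k) *\<^sub>R u k)"
    unfolding s.binomial s.scaleR_replicate u_def by simp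
  moreover have "AE x in M. I (\<Sum>k\<le>m. (real (m choose k) * a j ^ k) *\<^sub>R u k) x =
      (\<Sum>k\<le>m. (real (m choose k) * a j ^ k) * I (u k) x)"
    by (rule L2_linear_on_sum[OF lin subspace_sym_power finite_atMost]) (rule u)
  ultimately have 1: "AE x in M. I (blinfun_apply (symmetriser tens n) (tens (us @ replicate m (a j *\<^sub>R e j + v)))) x =
      (\<Sum>k\<le>m. (real (m choose k) * a j ^ k) * I (u k) x)"
    by (simp only:)
  have 2: "AE x in M. \<forall>k\<in>{..m}. I (u k) x = (\<Prod>l<length js. poly (hermite (ks ! l)) (\<phi> (e (js ! l)) x)) *
      poly (hermite k) (\<phi> (e j) x) * scaled_hermite (\<Sum>i\<leftarrow>is. (a i)\<^sup>2) (m - k) (\<Sum>i\<leftarrow>is. a i * \<phi> (e i) x)"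
  \<comment> \<open>The \<open>k\<close> copies of \<open>e j\<close> become a new last exponent.
    The case \<open>k = 0\<close> is included, as exponents may vanish.\<close>
  proof (rule AE_finite_allI)
    fix k assume k: "k \<in> {..m}"
    have p: "(\<Prod>l<length js. poly (hermite ((ks @ [k]) ! l)) (\<phi> (e ((js @ [j]) ! l)) x)) =
        (\<Prod>l<length js. poly (hermite (ks ! l)) (\<phi> (e (js ! l)) x))" for x
      using Cons.prems(3) by (intro prod.cong refl) (simp add: nth_append)
    have q: "(ks @ [k]) ! length js = k" "(js @ [j]) ! length js = j"
      using Cons.prems(3) by (simp_all add: nth_append)
    from k Cons.prems show "AE x in M. I (u k) x = (\<Prod>l<length js. poly (hermite (ks ! l)) (\<phi> (e (js ! l)) x)) *
      poly (hermite k) (\<phi> (e j) x) * scaled_hermite (\<Sum>i\<leftarrow>is. (a i)\<^sup>2) (m - k) (\<Sum>i\<leftarrow>is. a i * \<phi> (e i) x)"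
      using Cons.IH[of "js @ [j]" "ks @ [k]" "m - k"] by (simp add: u_def us_def v_def p q)
  qed simp
  from 1 2 show ?case
  proof eventually_elim
    case (elim x)
    let ?p = "\<Prod>l<length js. poly (hermite (ks ! l)) (\<phi> (e (js ! l)) x)"
    let ?z = "\<Sum>i\<leftarrow>is. a i * \<phi> (e i) x" and ?c = "\<Sum>i\<leftarrow>is. (a i)\<^sup>2"
    have "(\<Sum>k\<le>m. (real (m choose k) * a j ^ k) * I (u k) x) =
      (\<Sum>k\<le>m. ?p * (real (m choose k) * a j ^ k * scaled_hermite 1 k (\<phi> (e j) x) * scaled_hermite ?c (m - k) ?z))"
      using elim(2) by (intro sum.cong refl) (simp add: poly_hermite)
    also have "\<dots> = ?p * scaled_hermite ((a j)\<^sup>2 + ?c) m (a j * \<phi> (e j) x + ?z)"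
      by (simp only: scaled_hermite_binomial sum_distrib_left)
    finally show ?case using elim(1) by (simp add: us_def v_def)
  qed
qed

text \<open>Projections of \<open>h\<close> to finitely many basis vectors are covered by the
  expansion. Both sides depend continuously on the vector in \<open>L\<^sup>2\<close> or in norm, so
  the formula survives the limit along a subsequence.\<close>

lemma stochastic_integral_replicate:
  fixes e :: "nat \<Rightarrow> 'h::{real_inner,banach}" and tens :: "'h list \<Rightarrow> 'f::{real_inner,banach}"
  assumes ht: "hilbert_tensor_powers tens" and si: "stochastic_integral M tens J e \<phi> n I"
    and onb: "orthonormal_basis_on J e" and w: "wiener_map M j \<phi>"
  shows "AE x in M. I (tens (replicate n h)) x = scaled_hermite ((norm h)\<^sup>2) n (\<phi> h x)"
proof -
  have lin: "L2_linear_on (sym_power tens n) M I" using si by (simp add: stochastic_integral_def)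
  obtain C where C: "\<And>u. u \<in> sym_power tens n \<Longrightarrow> L2norm M (I u) \<le> C * norm u"
    using si by (auto simp: stochastic_integral_def)
  have mem: "tens (replicate n g) \<in> sym_power tens n" for g
    unfolding sym_power_def by (metis symmetriser_tens_replicate[OF ht] rangeI)
  define g where "g N = onb_proj J e N h" for N
  have g: "g \<longlonglongrightarrow> h" unfolding g_def by (rule onb_proj_tendsto[OF onb])
  have fin: "AE x in M. I (tens (replicate n (g N))) x = scaled_hermite ((norm (g N))\<^sup>2) n (\<phi> (g N) x)" for N
  proof -
    define A where "A = J \<inter> {..<N}"
    have A: "finite A" "A \<subseteq> J" by (auto simp: A_def)
    define a where "a i = inner h (e i)" for i
    have gN: "g N = (\<Sum>i\<in>A. a i *\<^sub>R e i)" by (simp add: g_def onb_proj_def A_def a_def)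
    have sl: "(\<Sum>i\<leftarrow>sorted_list_of_set A. f i) = (\<Sum>i\<in>A. f i)" for f :: "nat \<Rightarrow> 'c::comm_monoid_add"
      using A(1) by (simp add: sum_list_distinct_conv_sum_set)
    have "AE x in M. I (tens (replicate n (g N))) x = scaled_hermite (\<Sum>i\<in>A. (a i)\<^sup>2) n (\<Sum>i\<in>A. a i * \<phi> (e i) x)"
      using stochastic_integral_mixed[OF ht si, of "[]" "sorted_list_of_set A" "[]" n a] A
      by (simp add: sl gN symmetriser_tens_replicate[OF ht])
    moreover have "AE x in M. \<phi> (g N) x = (\<Sum>i\<in>A. a i * \<phi> (e i) x)"
      unfolding gN by (rule L2_linear_on_sum[OF wiener_mapD(1)[OF w] subspace_UNIV A(1)]) simp
    moreover have "(norm (g N))\<^sup>2 = (\<Sum>i\<in>A. (a i)\<^sup>2)" unfolding gN by (rule norm_sum_onb[OF onb A])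
    ultimately show ?thesis by auto
  qed
  have "L2norm M (\<lambda>x. \<phi> (g N) x - \<phi> h x) = norm (g N - h)" for N
  proof -
    have "L2norm M (\<lambda>x. \<phi> (g N) x - \<phi> h x) = L2norm M (\<phi> (g N - h))"
      using L2_linear_on_diff[OF wiener_mapD(1)[OF w] subspace_UNIV, of "g N" h] wiener_mapD(3)[OF w]
      by (intro L2norm_cong_AE L2spaceD L2space_diff) auto
    then show ?thesis by (simp add: wiener_mapD(2)[OF w])
  qed
  then have "(\<lambda>N. L2norm M (\<lambda>x. \<phi> (g N) x - \<phi> h x)) \<longlonglongrightarrow> 0"
    using g by (simp add: LIM_zero_iff tendsto_norm_zero_iff)
  from AE_tendsto_subseq[OF wiener_mapD(3)[OF w] wiener_mapD(3)[OF w] this]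
  obtain r where r: "strict_mono r" "AE x in M. (\<lambda>k. \<phi> (g (r k)) x) \<longlonglongrightarrow> \<phi> h x" by blast
  let ?t = "\<lambda>g. tens (replicate n g)"
  have gr: "(\<lambda>k. g (r k)) \<longlonglongrightarrow> h" using LIMSEQ_subseq_LIMSEQ[OF g r(1)] by (simp add: o_def)
  have "(\<lambda>k. L2norm M (\<lambda>x. I (?t (g (r k))) x - I (?t h) x)) \<longlonglongrightarrow> 0"
  proof (rule tendsto_sandwich[OF _ _ tendsto_const])
    have "L2norm M (\<lambda>x. I (?t (g (r k))) x - I (?t h) x) \<le> C * norm (?t (g (r k)) - ?t h)" for k
    proof -
      have "L2norm M (\<lambda>x. I (?t (g (r k))) x - I (?t h) x) = L2norm M (I (?t (g (r k)) - ?t h))"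
        using L2_linear_on_diff[OF lin subspace_sym_power mem mem, of "g (r k)" h]
          L2_linear_onD(1)[OF lin mem] L2_linear_onD(1)[OF lin subspace_diff[OF subspace_sym_power mem mem]]
        by (intro L2norm_cong_AE L2spaceD L2space_diff) auto
      then show ?thesis using C[OF subspace_diff[OF subspace_sym_power mem mem]] by simp
    qed
    then show "eventually (\<lambda>k. L2norm M (\<lambda>x. I (?t (g (r k))) x - I (?t h) x) \<le> C * norm (?t (g (r k)) - ?t h)) sequentially"
      by simp
    have "(\<lambda>k. C * norm (?t (g (r k)) - ?t h)) \<longlonglongrightarrow> C * norm (?t h - ?t h)"
      by (intro tendsto_intros tendsto_tens_replicate[OF ht] gr)
    then show "(\<lambda>k. C * norm (?t (g (r k)) - ?t h)) \<longlonglongrightarrow> 0" by simp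
  qed (simp add: L2norm_nonneg)
  \<comment> \<open>The second subsequence is taken inside the first, so \<open>\<phi>\<close> and
    \<open>I\<close> converge simultaneously.\<close>
  from AE_tendsto_subseq[OF L2_linear_onD(1)[OF lin mem] L2_linear_onD(1)[OF lin mem] this]
  obtain r' where r': "strict_mono r'" "AE x in M. (\<lambda>k. I (?t (g (r (r' k)))) x) \<longlonglongrightarrow> I (?t h) x" by blast
  have "AE x in M. \<forall>k. I (?t (g (r (r' k)))) x = scaled_hermite ((norm (g (r (r' k))))\<^sup>2) n (\<phi> (g (r (r' k))) x)"
    using fin by (simp add: AE_all_countable)
  with r(2) r'(2) show ?thesis
  proof eventually_elim
    case (elim x)
    have "(\<lambda>k. (norm (g (r (r' k))))\<^sup>2) \<longlonglongrightarrow> (norm h)\<^sup>2"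
      using LIMSEQ_subseq_LIMSEQ[OF gr r'(1)] by (intro tendsto_intros) (simp add: o_def)
    moreover have "(\<lambda>k. \<phi> (g (r (r' k))) x) \<longlonglongrightarrow> \<phi> h x"
      using LIMSEQ_subseq_LIMSEQ[OF elim(1) r'(1)] by (simp add: o_def)
    ultimately have "(\<lambda>k. I (?t (g (r (r' k)))) x) \<longlonglongrightarrow> scaled_hermite ((norm h)\<^sup>2) n (\<phi> h x)"
      using elim(3) tendsto_scaled_hermite by simp
    then show ?case using elim(2) LIMSEQ_unique by blast
  qed
qed

section \<open>Gaussian measures\<close>

text \<open>Using the second moment as variance gives one formula for normal laws and for the point
  mass at 0.\<close>

lemma gaussian_law_laplace:
  assumes law: "gaussian_law \<nu>" and mean: "(\<integral>x. x \<partial>\<nu>) = 0"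
  shows "integrable \<nu> (\<lambda>x. exp (t * x))" "(\<integral>x. exp (t * x) \<partial>\<nu>) = exp (t\<^sup>2 * (\<integral>x. x\<^sup>2 \<partial>\<nu>) / 2)"
proof -
  have "integrable \<nu> (\<lambda>x. exp (t * x)) \<and> (\<integral>x. exp (t * x) \<partial>\<nu>) = exp (t\<^sup>2 * (\<integral>x. x\<^sup>2 \<partial>\<nu>) / 2)"
    using law unfolding gaussian_law_def
  proof (elim disjE exE conjE)
    fix m assume \<nu>: "\<nu> = return borel m"
    have m: "m = 0" using mean unfolding \<nu> by (subst (asm) integral_return) auto
    have "integrable \<nu> (\<lambda>x. exp (t * x))"
      unfolding \<nu> by (rule integrableI_bounded) (auto simp: nn_integral_return)
    then show ?thesis by (simp add: \<nu> m integral_return)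
  next
    fix m s :: real assume s: "s > 0" and \<nu>: "\<nu> = density lborel (\<lambda>x. ennreal (normal_density m s x))"
    have m: "m = 0" using mean integral_normal_moment_nz_1[OF s, of m] unfolding \<nu>
      by (simp add: integral_density mult.commute)
    have "(\<integral>x. x\<^sup>2 \<partial>\<nu>) = (\<integral>x. normal_density 0 s x * (x - 0) ^ (2 * 1) \<partial>lborel)"
      unfolding \<nu> m by (simp add: integral_density)
    also have "\<dots> = s\<^sup>2"
      using s by (subst integral_normal_moment_even) (simp_all add: fact_numeral)
    finally have v: "(\<integral>x. x\<^sup>2 \<partial>\<nu>) = s\<^sup>2" .
    \<comment> \<open>Completing the square: exponential tilting moves the mean by
      \<open>t * s\<^sup>2\<close>.\<close>
    have d: "normal_density 0 s x * exp (t * x) = exp (t\<^sup>2 * s\<^sup>2 / 2) * normal_density (t * s\<^sup>2) s x" for x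
    proof -
      have "- (x - 0)\<^sup>2 / (2 * s\<^sup>2) + t * x = t\<^sup>2 * s\<^sup>2 / 2 + - (x - t * s\<^sup>2)\<^sup>2 / (2 * s\<^sup>2)"
        using s by (simp add: field_simps power2_eq_square)
      then have "exp (- (x - 0)\<^sup>2 / (2 * s\<^sup>2)) * exp (t * x) = exp (t\<^sup>2 * s\<^sup>2 / 2) * exp (- (x - t * s\<^sup>2)\<^sup>2 / (2 * s\<^sup>2))"
        by (simp only: exp_add[symmetric])
      then show ?thesis by (simp add: normal_density_def)
    qed
    have "integrable \<nu> (\<lambda>x. exp (t * x))"
      unfolding \<nu> m using integrable_normal_density[OF s] by (subst integrable_density) (simp_all add: d)
    moreover have "(\<integral>x. exp (t * x) \<partial>\<nu>) = exp (t\<^sup>2 * s\<^sup>2 / 2)"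
      unfolding \<nu> m using integral_normal_density[OF s] by (subst integral_density) (simp_all add: d)
    ultimately show ?thesis by (simp add: v)
  qed
  then show "integrable \<nu> (\<lambda>x. exp (t * x))" "(\<integral>x. exp (t * x) \<partial>\<nu>) = exp (t\<^sup>2 * (\<integral>x. x\<^sup>2 \<partial>\<nu>) / 2)" by auto
qed

lemma radon_prob_tight:
  fixes M :: "'a::banach measure"
  assumes "radon_prob M"
  shows "tight_measure M"
  unfolding tight_measure_def
proof (intro conjI allI impI)
  have ps: "prob_space M" and sM: "sets M = sets borel" using assms by (auto simp: radon_prob_def)
  interpret prob_space M by fact
  show "finite_measure M" "sets M = sets borel" by unfold_locales (rule sM)
  have sp: "space M = UNIV" using sets_eq_imp_space_eq[OF sM] by simp
  fix e :: real assume e: "0 < e"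
  have "emeasure M UNIV = (SUP K\<in>{K. compact K \<and> K \<subseteq> UNIV}. emeasure M K)"
    using assms by (simp add: radon_prob_def)
  moreover have "ennreal (1 - e) < ennreal 1" using e by (intro ennreal_lessI) auto
  moreover have "emeasure M UNIV = ennreal 1" using emeasure_space_1 sp by simp
  ultimately have "ennreal (1 - e) < (SUP K\<in>{K. compact K \<and> K \<subseteq> UNIV}. emeasure M K)" by simp
  then obtain K where K: "compact K" "ennreal (1 - e) < emeasure M K" by (auto simp: less_SUP_iff)
  have "K \<in> sets M" using K by (simp add: sM compact_imp_closed)
  then have "measure M (- K) = 1 - measure M K" using prob_compl by (simp add: sp Compl_eq_Diff_UNIV)
  moreover have "1 - e < measure M K"
  proof (rule ccontr)
    assume "\<not> 1 - e < measure M K"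
    then have "emeasure M K \<le> ennreal (1 - e)" unfolding emeasure_eq_measure by (intro ennreal_leI) simp
    then show False using K(2) by simp
  qed
  ultimately show "\<exists>K. compact K \<and> measure M (- K) < e" using K(1) by (intro exI[of _ K]) simp
qed

text \<open>By AM-GM, \<open>w 1\<^bsub>- K\<^esub> \<le> \<eta> w\<^sup>2 + 1\<^bsub>- K\<^esub> / \<eta>\<close>.\<close>

lemma tight_measure_density:
  fixes M :: "'a::metric_space measure"
  assumes M: "tight_measure M" and w: "w \<in> L2space M" "\<And>x. 0 \<le> w x"
  shows "tight_measure (density M (\<lambda>x. ennreal (w x)))"
  unfolding tight_measure_def
proof (intro conjI allI impI)
  have fM: "finite_measure M" and sM: "sets M = sets borel" using M by (auto simp: tight_measure_def)
  interpret finite_measure M by fact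
  have w1: "integrable M w" using w(1) by (auto simp: L2space_def intro: square_integrable_imp_integrable)
  have [measurable]: "w \<in> borel_measurable M" using w by (auto simp: L2space_def)
  have w2: "integrable M (\<lambda>x. (w x)\<^sup>2)" using w by (auto simp: L2space_def)
  let ?D = "density M (\<lambda>x. ennreal (w x))"
  show fD: "finite_measure ?D"
    using w1 w(2) by (intro finite_measureI) (simp add: emeasure_density nn_integral_eq_integral)
  show "sets ?D = sets borel" by (simp add: sM)
  fix e :: real assume e: "0 < e"
  \<comment> \<open>Adding 1 keeps \<open>A\<close> positive even if \<open>w\<close> vanishes
    almost everywhere. The choices of \<open>\<eta>\<close> and \<open>K\<close> then give each term
    of the AM-GM bound at most \<open>e / 2\<close>.\<close>
  define A where "A = (\<integral>x. (w x)\<^sup>2 \<partial>M) + 1"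
  have A: "A > 0" unfolding A_def by (intro add_nonneg_pos) auto
  define \<eta> where "\<eta> = e / (2 * A)"
  have \<eta>: "\<eta> > 0" using e A by (simp add: \<eta>_def)
  obtain K where K: "compact K" "measure M (- K) < \<eta> * e / 2"
    using M e \<eta> unfolding tight_measure_def by (meson divide_pos_pos mult_pos_pos zero_less_numeral)
  have Ks: "- K \<in> sets M" using K by (simp add: sM compact_imp_closed borel_comp)
  have ind: "integrable M (\<lambda>x. indicator (- K) x :: real)"
    using Ks by (intro integrable_real_indicator) (auto simp: less_top[symmetric])
  have "measure ?D (- K) = (\<integral>x. indicator (- K) x \<partial>?D)" using Ks fD
    by (simp add: Int_absorb2 sets.sets_into_space)
  also have "\<dots> = (\<integral>x. w x * indicator (- K) x \<partial>M)"
    using w(2) Ks by (subst integral_density) auto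
  also have "\<dots> \<le> (\<integral>x. \<eta> * (w x)\<^sup>2 + (1 / \<eta>) * indicator (- K) x \<partial>M)"
  proof (rule integral_mono)
    show "integrable M (\<lambda>x. w x * indicator (- K) x)"
      using w1 Ks by (intro integrable_real_mult_indicator)
    show "integrable M (\<lambda>x. \<eta> * (w x)\<^sup>2 + (1 / \<eta>) * indicator (- K) x)" using w2 ind by auto
    show "w x * indicator (- K) x \<le> \<eta> * (w x)\<^sup>2 + 1 / \<eta> * indicator (- K) x" for x
    proof (cases "x \<in> - K")
      case True
      have "0 \<le> (\<eta> * w x - 1)\<^sup>2 + \<eta> * w x" using w(2)[of x] \<eta> by simp
      then have "\<eta> * w x \<le> \<eta> * (\<eta> * (w x)\<^sup>2) + 1" by (simp add: power2_eq_square algebra_simps)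
      then have "w x \<le> (\<eta> * (\<eta> * (w x)\<^sup>2) + 1) / \<eta>" using \<eta> by (simp add: pos_le_divide_eq mult.commute)
      then show ?thesis using True \<eta> by (simp add: add_divide_distrib)
    qed (use \<eta> in simp)
  qed
  also have "\<dots> = \<eta> * (\<integral>x. (w x)\<^sup>2 \<partial>M) + (1 / \<eta>) * measure M (- K)"
    using w2 ind Ks by (simp add: Int_absorb2 sets.sets_into_space)
  also have "\<dots> < e / 2 + e / 2"
  proof (rule add_le_less_mono)
    have "\<eta> * (\<integral>x. (w x)\<^sup>2 \<partial>M) \<le> \<eta> * A" using \<eta> by (simp add: A_def)
    then show "\<eta> * (\<integral>x. (w x)\<^sup>2 \<partial>M) \<le> e / 2" using A by (simp add: \<eta>_def)
    show "1 / \<eta> * measure M (- K) < e / 2" using K(2) \<eta> by (simp add: divide_less_eq mult.commute)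
  qed
  finally show "\<exists>K. compact K \<and> measure ?D (- K) < e" using K(1) by auto
qed

lemma tight_measure_distr:
  fixes M :: "'a::metric_space measure" and T :: "'a \<Rightarrow> 'a"
  assumes M: "tight_measure M" and T: "continuous_on UNIV T"
  shows "tight_measure (distr M borel T)"
  unfolding tight_measure_def
proof (intro conjI allI impI)
  have fM: "finite_measure M" and sM: "sets M = sets borel" using M by (auto simp: tight_measure_def)
  interpret finite_measure M by fact
  have mT[measurable]: "T \<in> measurable M borel"
    unfolding measurable_cong_sets[OF sM refl] by (rule borel_measurable_continuous_onI[OF T])
  show fD: "finite_measure (distr M borel T)" by (rule finite_measure_distr) simp
  fix e :: real assume "0 < e"
  then obtain K where K: "compact K" "measure M (- K) < e" using M unfolding tight_measure_def by meson
  have cT: "compact (T ` K)" using K(1) T by (meson compact_continuous_image continuous_on_subset subset_UNIV)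
  have "measure (distr M borel T) (- (T ` K)) = measure M (T -` (- (T ` K)) \<inter> space M)"
    using cT by (intro measure_distr) (auto intro!: borel_comp simp: compact_imp_closed)
  also have "\<dots> \<le> measure M (- K)"
    using K(1) by (intro finite_measure_mono) (auto simp: sM compact_imp_closed borel_comp)
  finally show "\<exists>K. compact K \<and> measure (distr M borel T) (- K) < e" using cT K(2) by (intro exI[of _ "T ` K"]) simp
qed simp

locale gaussian_space =
  fixes \<mu> :: "'a::banach measure" and j :: "'h::{real_inner,banach} \<Rightarrow>\<^sub>L 'a" and \<phi> :: "'h \<Rightarrow> 'a \<Rightarrow> real"
  assumes centred: "centred_gaussian_radon \<mu>" and rkhs: "rkhs \<mu> j" and wiener: "wiener_map \<mu> j \<phi>"
begin

lemma radon: "radon_prob \<mu>"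
  using centred by (simp add: centred_gaussian_radon_def gaussian_radon_def)

sublocale prob_space \<mu>
  using radon by (simp add: radon_prob_def)

lemma sets_eq[measurable_cong]: "sets \<mu> = sets borel"
  using radon by (simp add: radon_prob_def)

lemma tight: "tight_measure \<mu>"
  by (rule radon_prob_tight[OF radon])

lemma measurable_blinfun[measurable]:
  fixes xs :: "'a \<Rightarrow>\<^sub>L real"
  shows "blinfun_apply xs \<in> borel_measurable borel"
  by (intro borel_measurable_continuous_onI continuous_intros)

abbreviation d :: "('a \<Rightarrow>\<^sub>L real) \<Rightarrow> 'h" where "d \<equiv> dual_map j"

text \<open>The witness for \<open>dual_map\<close> is \<open>inv j (Q xs)\<close>. Its defining
  identity holds on the range of \<open>Q\<close> by the formula for the inner product and extends
  by density.\<close>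

lemma
  shows inner_dual_map: "inner g (d xs) = blinfun_apply xs (blinfun_apply j g)"
    and closure_range_dual_map: "closure (range d) = UNIV"
proof -
  let ?i = "inv (blinfun_apply j)"
  obtain Q where inj: "inj (blinfun_apply j)" and Q: "range Q \<subseteq> range (blinfun_apply j)"
    "\<And>xs ys. inner (?i (Q xs)) (?i (Q ys)) = blinfun_apply ys (Q xs)" "closure (?i ` range Q) = UNIV"
    using rkhs unfolding rkhs_def by blast
  have ji: "blinfun_apply j (?i (Q xs)) = Q xs" for xs using Q(1) by (simp add: f_inv_into_f range_subsetD)
  have pr: "inner g (?i (Q xs)) = blinfun_apply xs (blinfun_apply j g)" for g xs
  proof -
    have "closed {g. inner g (?i (Q xs)) = blinfun_apply xs (blinfun_apply j g)}"
      by (intro closed_Collect_eq continuous_intros)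
    moreover have "?i ` range Q \<subseteq> {g. inner g (?i (Q xs)) = blinfun_apply xs (blinfun_apply j g)}"
      using Q(2) by (auto simp: ji)
    ultimately have "closure (?i ` range Q) \<subseteq> {g. inner g (?i (Q xs)) = blinfun_apply xs (blinfun_apply j g)}"
      by (intro closure_minimal)
    then show ?thesis using Q(3) by blast
  qed
  have d: "d xs = ?i (Q xs)" for xs
    unfolding dual_map_def
  proof (rule the_equality)
    fix h assume "\<forall>g. inner g h = blinfun_apply xs (blinfun_apply j g)"
    then have "\<forall>g. inner g h = inner g (?i (Q xs))" by (simp add: pr)
    then show "h = ?i (Q xs)" by (simp add: vector_eq_ldot)
  qed (simp add: pr)
  show "inner g (d xs) = blinfun_apply xs (blinfun_apply j g)" by (simp add: d pr)
  have "range d = ?i ` range Q" by (auto simp: d)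
  then show "closure (range d) = UNIV" using Q(3) by simp
qed

lemma dual_map_add: "d (xs + ys) = d xs + d ys"
  by (rule vector_eq_ldot[THEN iffD1]) (simp add: inner_dual_map inner_add_right blinfun.add_left)

lemma dual_map_scaleR: "d (c *\<^sub>R xs) = c *\<^sub>R d xs"
  by (rule vector_eq_ldot[THEN iffD1]) (simp add: inner_dual_map blinfun.scaleR_left)

lemma integral_square: "(\<integral>x. (blinfun_apply xs x)\<^sup>2 \<partial>\<mu>) = (norm (d xs))\<^sup>2"
proof -
  have "L2norm \<mu> (blinfun_apply xs) = L2norm \<mu> (\<phi> (d xs))"
  proof (rule L2norm_cong_AE)
    show "AE x in \<mu>. blinfun_apply xs x = \<phi> (d xs) x" using wiener_mapD(4)[OF wiener, of xs] by eventually_elim simp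
  qed (use L2spaceD(1)[OF wiener_mapD(3)[OF wiener]] in measurable)
  then show ?thesis by (simp add: wiener_mapD(2)[OF wiener] flip: L2norm_power2)
qed

lemma exp_functional:
  shows integrable_exp: "integrable \<mu> (\<lambda>x. exp (blinfun_apply xs x))"
    and integral_exp: "(\<integral>x. exp (blinfun_apply xs x) \<partial>\<mu>) = exp ((norm (d xs))\<^sup>2 / 2)"
proof -
  let ?\<nu> = "distr \<mu> borel (blinfun_apply xs)"
  have law: "gaussian_law ?\<nu>" using centred by (simp add: centred_gaussian_radon_def gaussian_radon_def)
  have mean: "(\<integral>x. x \<partial>?\<nu>) = 0" using centred by (simp add: integral_distr centred_gaussian_radon_def)
  have sq: "(\<integral>x. x\<^sup>2 \<partial>?\<nu>) = (norm (d xs))\<^sup>2" by (simp add: integral_distr integral_square)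
  show "integrable \<mu> (\<lambda>x. exp (blinfun_apply xs x))"
    using gaussian_law_laplace(1)[OF law mean, of 1] by (simp add: integrable_distr_eq)
  show "(\<integral>x. exp (blinfun_apply xs x) \<partial>\<mu>) = exp ((norm (d xs))\<^sup>2 / 2)"
    using gaussian_law_laplace(2)[OF law mean, of 1] by (simp add: integral_distr sq)
qed

section \<open>Cameron--Martin formula and shift-invariant functions\<close>

definition cm_density :: "('a \<Rightarrow>\<^sub>L real) \<Rightarrow> 'a \<Rightarrow> real" where
  "cm_density ys x = exp (blinfun_apply ys x - (norm (d ys))\<^sup>2 / 2)"

lemma cm_density_L2: "cm_density ys \<in> L2space \<mu>"
proof -
  have "(cm_density ys x)\<^sup>2 = exp (- (norm (d ys))\<^sup>2) * exp (blinfun_apply (2 *\<^sub>R ys) x)" for x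
    by (simp add: cm_density_def blinfun.scaleR_left flip: exp_double exp_add)
  then show ?thesis by (simp add: L2space_def cm_density_def[abs_def] integrable_exp)
qed

lemma measurable_cm_density[measurable]: "cm_density ys \<in> borel_measurable borel"
  unfolding cm_density_def[abs_def] by measurable

text \<open>Against \<open>exp f\<close> the shift produces the factor
  \<open>exp (inner (d ys) (d f))\<close>, while the density turns \<open>f\<close> into
  \<open>ys + f\<close>. Expanding the squared norm of \<open>d ys + d f\<close> makes the two
  integrals equal.\<close>

lemma cameron_martin:
  "distr \<mu> borel (\<lambda>x. x + blinfun_apply j (d ys)) = density \<mu> (\<lambda>x. ennreal (cm_density ys x))"
proof (rule tight_measure_eqI)
  have cont: "continuous_on UNIV (\<lambda>x. x + blinfun_apply j (d ys))" by (intro continuous_intros)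
  have [measurable]: "(\<lambda>x. x + blinfun_apply j (d ys)) \<in> measurable \<mu> borel"
    unfolding measurable_cong_sets[OF sets_eq refl] by (rule borel_measurable_continuous_onI[OF cont])
  show "tight_measure (distr \<mu> borel (\<lambda>x. x + blinfun_apply j (d ys)))" by (rule tight_measure_distr[OF tight cont])
  show "tight_measure (density \<mu> (\<lambda>x. ennreal (cm_density ys x)))"
    by (rule tight_measure_density[OF tight cm_density_L2]) (simp add: cm_density_def)
  fix f :: "'a \<Rightarrow>\<^sub>L real"
  have s: "exp (blinfun_apply f (x + blinfun_apply j (d ys))) = exp (inner (d ys) (d f)) * exp (blinfun_apply f x)" for x
    by (simp add: blinfun.add_right inner_dual_map exp_add)
  have t: "cm_density ys x * exp (blinfun_apply f x) = exp (- (norm (d ys))\<^sup>2 / 2) * exp (blinfun_apply (ys + f) x)" for x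
    by (simp add: cm_density_def blinfun.add_left flip: exp_add)
  show "integrable (distr \<mu> borel (\<lambda>x. x + blinfun_apply j (d ys))) (\<lambda>x. exp (blinfun_apply f x))"
    by (subst integrable_distr_eq) (simp_all add: s integrable_exp)
  show "integrable (density \<mu> (\<lambda>x. ennreal (cm_density ys x))) (\<lambda>x. exp (blinfun_apply f x))"
    by (subst integrable_density) (simp_all add: t integrable_exp, simp add: cm_density_def)
  have n: "(norm (d ys + d f))\<^sup>2 = (norm (d ys))\<^sup>2 + 2 * inner (d ys) (d f) + (norm (d f))\<^sup>2"
    by (simp add: power2_norm_eq_inner inner_add_left inner_add_right inner_commute)
  have "(\<integral>x. exp (blinfun_apply f x) \<partial>distr \<mu> borel (\<lambda>x. x + blinfun_apply j (d ys))) =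
      exp (inner (d ys) (d f)) * exp ((norm (d f))\<^sup>2 / 2)"
    by (subst integral_distr) (simp_all add: s integral_exp)
  also have "\<dots> = exp (- (norm (d ys))\<^sup>2 / 2) * exp ((norm (d (ys + f)))\<^sup>2 / 2)"
    by (simp add: dual_map_add n add_divide_distrib flip: exp_add)
  also have "\<dots> = (\<integral>x. exp (blinfun_apply f x) \<partial>density \<mu> (\<lambda>x. ennreal (cm_density ys x)))"
    by (subst integral_density) (simp_all add: t integral_exp, simp add: cm_density_def)
  finally show "(\<integral>x. exp (blinfun_apply f x) \<partial>distr \<mu> borel (\<lambda>x. x + blinfun_apply j (d ys))) =
     (\<integral>x. exp (blinfun_apply f x) \<partial>density \<mu> (\<lambda>x. ennreal (cm_density ys x)))" .
qed

lemma distr_uminus: "distr \<mu> borel uminus = \<mu>"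
proof (rule tight_measure_eqI)
  have cont: "continuous_on UNIV (uminus :: 'a \<Rightarrow> 'a)" by (intro continuous_intros)
  have [measurable]: "(uminus :: 'a \<Rightarrow> 'a) \<in> measurable \<mu> borel"
    unfolding measurable_cong_sets[OF sets_eq refl] by (rule borel_measurable_continuous_onI[OF cont])
  show "tight_measure (distr \<mu> borel uminus)" by (rule tight_measure_distr[OF tight cont])
  show "tight_measure \<mu>" by (rule tight)
  fix f :: "'a \<Rightarrow>\<^sub>L real"
  have s: "exp (blinfun_apply f (- x)) = exp (blinfun_apply (- f) x)" for x
    by (simp add: blinfun.minus_left blinfun.minus_right)
  have n: "d (- f) = - d f" using dual_map_scaleR[of "-1" f] by simp
  show "integrable (distr \<mu> borel uminus) (\<lambda>x. exp (blinfun_apply f x))"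
    by (subst integrable_distr_eq) (simp_all add: s integrable_exp)
  show "integrable \<mu> (\<lambda>x. exp (blinfun_apply f x))" by (rule integrable_exp)
  show "(\<integral>x. exp (blinfun_apply f x) \<partial>distr \<mu> borel uminus) = (\<integral>x. exp (blinfun_apply f x) \<partial>\<mu>)"
    by (subst integral_distr) (simp_all add: s integral_exp n)
qed

lemma measurable_plus_const[measurable]: "(\<lambda>x. x + c) \<in> measurable \<mu> borel" for c :: 'a
  unfolding measurable_cong_sets[OF sets_eq refl] by (intro borel_measurable_continuous_onI continuous_intros)

lemma measurable_neg[measurable]: "(uminus :: 'a \<Rightarrow> 'a) \<in> measurable \<mu> borel"
  unfolding measurable_cong_sets[OF sets_eq refl] by (intro borel_measurable_continuous_onI continuous_intros)

text \<open>The shifted measure has a density, so shifts preserve null sets. This permits shifting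
  functions that are known only almost everywhere.\<close>

lemma AE_shift:
  assumes "AE x in \<mu>. R x"
  shows "AE x in \<mu>. R (x + blinfun_apply j (d ys))"
proof (rule AE_distrD[where M' = borel and f = "\<lambda>x. x + blinfun_apply j (d ys)" and P = R])
  show "AE x in distr \<mu> borel (\<lambda>x. x + blinfun_apply j (d ys)). R x"
    unfolding cameron_martin using assms by (subst AE_density) (auto elim: eventually_mono)
qed measurable

lemma AE_neg:
  assumes "AE x in \<mu>. R x"
  shows "AE x in \<mu>. R (- x)"
proof (rule AE_distrD[where M' = borel and f = uminus and P = R])
  show "AE x in distr \<mu> borel uminus. R x" unfolding distr_uminus by (rule assms)
qed measurable

text \<open>Nonnegativity lets \<open>F\<close> act as a density; boundedness makes it square
  integrable, so that the resulting measure is tight.\<close>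

lemma AE_const_if_shift_invariant:
  fixes F :: "'a \<Rightarrow> real"
  assumes [measurable]: "F \<in> borel_measurable \<mu>" and F: "\<And>x. 0 \<le> F x" "\<And>x. F x \<le> B"
    and inv: "\<And>ys. AE x in \<mu>. F (x + blinfun_apply j (d ys)) = F x"
  shows "AE x in \<mu>. F x = (\<integral>x. F x \<partial>\<mu>)"
proof -
  let ?c = "\<integral>x. F x \<partial>\<mu>"
  have c: "0 \<le> ?c" by (rule Bochner_Integration.integral_nonneg) (rule F(1))
  have Fb[measurable]: "F \<in> borel_measurable borel" using measurable_cong_sets[OF sets_eq refl] by auto
  have bounded_L2: "f \<in> L2space \<mu>" if [measurable]: "f \<in> borel_measurable \<mu>"
    and f: "\<And>x. 0 \<le> f x" "\<And>x. f x \<le> b" for f :: "'a \<Rightarrow> real" and b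
  proof -
    have "integrable \<mu> (\<lambda>x. (f x)\<^sup>2)"
      using f by (intro integrable_const_bound[where B = "b\<^sup>2"]) (auto intro!: power_mono)
    then show ?thesis by (simp add: L2space_def)
  qed
  have expF: "integrable \<mu> (\<lambda>x. F x * exp (blinfun_apply f x))" for f :: "'a \<Rightarrow>\<^sub>L real"
  proof (rule Bochner_Integration.integrable_bound)
    show "integrable \<mu> (\<lambda>x. B * exp (blinfun_apply f x))" using integrable_exp by simp
    have "0 \<le> B" using F by (meson order_trans)
    then show "AE x in \<mu>. norm (F x * exp (blinfun_apply f x)) \<le> norm (B * exp (blinfun_apply f x))"
      using F by (simp add: abs_mult)
  qed measurable
  have key: "(\<integral>x. F x * exp (blinfun_apply f x) \<partial>\<mu>) = ?c * exp ((norm (d f))\<^sup>2 / 2)" for f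
  proof -
    have w: "cm_density f x = exp (- (norm (d f))\<^sup>2 / 2) * exp (blinfun_apply f x)" for x
      by (simp add: cm_density_def flip: exp_add)
    have "?c = (\<integral>x. F (x + blinfun_apply j (d f)) \<partial>\<mu>)"
      using inv[of f] by (intro integral_cong_AE) (auto elim: eventually_mono)
    also have "\<dots> = (\<integral>x. F x \<partial>distr \<mu> borel (\<lambda>x. x + blinfun_apply j (d f)))" by (subst integral_distr) auto
    also have "\<dots> = (\<integral>x. cm_density f x * F x \<partial>\<mu>)"
      unfolding cameron_martin by (subst integral_density) (auto simp: cm_density_def)
    also have "\<dots> = (\<integral>x. exp (- (norm (d f))\<^sup>2 / 2) * (F x * exp (blinfun_apply f x)) \<partial>\<mu>)"
      by (intro Bochner_Integration.integral_cong refl) (simp add: w)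
    also have "\<dots> = exp (- (norm (d f))\<^sup>2 / 2) * (\<integral>x. F x * exp (blinfun_apply f x) \<partial>\<mu>)" by simp
    finally show ?thesis by (simp add: exp_minus field_simps)
  qed
  have "density \<mu> (\<lambda>x. ennreal (F x)) = density \<mu> (\<lambda>x. ennreal ?c)"
  proof (rule tight_measure_eqI)
    show "tight_measure (density \<mu> (\<lambda>x. ennreal (F x)))"
      using F by (intro tight_measure_density tight bounded_L2[OF _ F]) auto
    show "tight_measure (density \<mu> (\<lambda>x. ennreal ?c))"
      using c by (intro tight_measure_density tight bounded_L2) auto
    show "integrable (density \<mu> (\<lambda>x. ennreal (F x))) (\<lambda>x. exp (blinfun_apply f x))" for f :: "'a \<Rightarrow>\<^sub>L real"
      using F by (subst integrable_density) (auto simp: expF)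
    show "integrable (density \<mu> (\<lambda>x. ennreal ?c)) (\<lambda>x. exp (blinfun_apply f x))" for f :: "'a \<Rightarrow>\<^sub>L real"
      using c by (subst integrable_density) (auto simp: integrable_exp)
    show "(\<integral>x. exp (blinfun_apply f x) \<partial>density \<mu> (\<lambda>x. ennreal (F x))) =
        (\<integral>x. exp (blinfun_apply f x) \<partial>density \<mu> (\<lambda>x. ennreal ?c))" for f :: "'a \<Rightarrow>\<^sub>L real"
      using F c by (subst (1 2) integral_density) (auto simp: key integral_exp)
  qed
  then have "AE x in \<mu>. ennreal (F x) = ennreal ?c" by (subst (asm) density_unique_iff) auto
  then show ?thesis by eventually_elim (simp add: ennreal_inj F(1) c)
qed

lemma AE_zero_if_shift_invariant_odd:
  assumes [measurable]: "l \<in> borel_measurable \<mu>"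
    and inv: "\<And>ys. AE x in \<mu>. l (x + blinfun_apply j (d ys)) = l x" and odd: "AE x in \<mu>. l (- x) = - l x"
  shows "AE x in \<mu>. l x = (0 :: real)"
proof -
  \<comment> \<open>The arctangent bounds \<open>l\<close> while keeping oddness and the zero set;
    adding 2, which exceeds pi / 2, makes it nonnegative. An odd constant is 0.\<close>
  define F where "F x = arctan (l x) + 2" for x
  define k where "k = (\<integral>x. F x \<partial>\<mu>) - 2"
  have arctan: "- 2 \<le> arctan y" "arctan y \<le> 2" for y
    using arctan_lbound[of y] arctan_ubound[of y] pi_less_4 by simp_all
  have "AE x in \<mu>. F x = (\<integral>x. F x \<partial>\<mu>)"
  proof (rule AE_const_if_shift_invariant)
    show "F \<in> borel_measurable \<mu>" unfolding F_def by measurable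
    show "0 \<le> F x" "F x \<le> 4" for x using arctan[of "l x"] by (simp_all add: F_def)
    show "AE x in \<mu>. F (x + blinfun_apply j (d ys)) = F x" for ys
      using inv[of ys] by eventually_elim (simp add: F_def)
  qed
  then have k: "AE x in \<mu>. arctan (l x) = k" by (simp add: F_def k_def algebra_simps)
  from AE_neg[OF this] k odd have "AE x in \<mu>. k = - k"
    by eventually_elim (simp add: arctan_minus)
  then have "k = 0" using emeasure_space_1 by (simp add: AE_const)
  with k show ?thesis by (auto simp: arctan_eq_zero_iff elim!: eventually_mono)
qed

section \<open>Shifts and reflections of the Wiener map\<close>

text \<open>Pointwise identities of continuous functionals pass to \<open>\<phi> h\<close> through
  this almost everywhere limit.\<close>

lemma approximating_functionals:
  "\<exists>xs :: nat \<Rightarrow> 'a \<Rightarrow>\<^sub>L real. (\<lambda>n. d (xs n)) \<longlonglongrightarrow> h \<and> (AE x in \<mu>. (\<lambda>n. blinfun_apply (xs n) x) \<longlonglongrightarrow> \<phi> h x)"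
proof -
  have "h \<in> closure (range d)" by (simp add: closure_range_dual_map)
  then obtain g where g: "\<And>n. g n \<in> range d" "g \<longlonglongrightarrow> h" unfolding closure_sequential by blast
  from g(1) have "\<forall>n. \<exists>xs. g n = d xs" by blast
  from choice[OF this] obtain xs where xs: "\<And>n. g n = d (xs n)" by blast
  have "L2norm \<mu> (\<lambda>x. \<phi> (g n) x - \<phi> h x) = norm (g n - h)" for n
  proof -
    have "L2norm \<mu> (\<lambda>x. \<phi> (g n) x - \<phi> h x) = L2norm \<mu> (\<phi> (g n - h))"
      using L2_linear_on_diff[OF wiener_mapD(1)[OF wiener] subspace_UNIV, of "g n" h] wiener_mapD(3)[OF wiener]
      by (intro L2norm_cong_AE L2spaceD L2space_diff) (auto elim: eventually_mono)
    then show ?thesis by (simp add: wiener_mapD(2)[OF wiener])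
  qed
  then have "(\<lambda>n. L2norm \<mu> (\<lambda>x. \<phi> (g n) x - \<phi> h x)) \<longlonglongrightarrow> 0"
    using g(2) by (simp add: LIM_zero_iff tendsto_norm_zero_iff)
  from AE_tendsto_subseq[OF wiener_mapD(3)[OF wiener] wiener_mapD(3)[OF wiener] this]
  obtain r where r: "strict_mono r" "AE x in \<mu>. (\<lambda>n. \<phi> (g (r n)) x) \<longlonglongrightarrow> \<phi> h x" by blast
  have "AE x in \<mu>. \<forall>n. \<phi> (g (r n)) x = blinfun_apply (xs (r n)) x"
    using wiener_mapD(4)[OF wiener] by (simp add: AE_all_countable xs)
  with r(2) have "AE x in \<mu>. (\<lambda>n. blinfun_apply (xs (r n)) x) \<longlonglongrightarrow> \<phi> h x" by eventually_elim simp
  moreover have "(\<lambda>n. d (xs (r n))) \<longlonglongrightarrow> h"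
    using LIMSEQ_subseq_LIMSEQ[OF g(2) r(1)] by (simp add: o_def xs)
  ultimately show ?thesis by (intro exI[of _ "\<lambda>n. xs (r n)"]) simp
qed

lemma wiener_map_shift: "AE x in \<mu>. \<phi> h (x + blinfun_apply j (d ys)) = \<phi> h x + inner (d ys) h"
proof -
  obtain xs :: "nat \<Rightarrow> 'a \<Rightarrow>\<^sub>L real" where xs: "(\<lambda>n. d (xs n)) \<longlonglongrightarrow> h" "AE x in \<mu>. (\<lambda>n. blinfun_apply (xs n) x) \<longlonglongrightarrow> \<phi> h x"
    using approximating_functionals by blast
  from xs(2) AE_shift[OF xs(2), of ys] show ?thesis
  proof eventually_elim
    case (elim x)
    have "(\<lambda>n. blinfun_apply (xs n) x + inner (d ys) (d (xs n))) \<longlonglongrightarrow> \<phi> h x + inner (d ys) h"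
      by (intro tendsto_intros elim(1) xs(1))
    then have "(\<lambda>n. blinfun_apply (xs n) (x + blinfun_apply j (d ys))) \<longlonglongrightarrow> \<phi> h x + inner (d ys) h"
      by (simp add: blinfun.add_right inner_dual_map)
    then show ?case using elim(2) LIMSEQ_unique by blast
  qed
qed

lemma wiener_map_neg: "AE x in \<mu>. \<phi> h (- x) = - \<phi> h x"
proof -
  obtain xs :: "nat \<Rightarrow> 'a \<Rightarrow>\<^sub>L real" where xs: "(\<lambda>n. d (xs n)) \<longlonglongrightarrow> h" "AE x in \<mu>. (\<lambda>n. blinfun_apply (xs n) x) \<longlonglongrightarrow> \<phi> h x"
    using approximating_functionals by blast
  from xs(2) AE_neg[OF xs(2)] show ?thesis
  proof eventually_elim
    case (elim x)
    have "(\<lambda>n. blinfun_apply (xs n) (- x)) \<longlonglongrightarrow> - \<phi> h x"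
      using tendsto_minus[OF elim(1)] by (simp add: blinfun.minus_right)
    then show ?case using elim(2) LIMSEQ_unique by blast
  qed
qed

text \<open>Recognises \<open>\<phi> h\<close> by its increments and its oddness: the difference
  from \<open>l\<close> is shift invariant and odd.\<close>

lemma wiener_map_eqI:
  assumes "l \<in> borel_measurable \<mu>"
    and "\<And>ys. AE x in \<mu>. l (x + blinfun_apply j (d ys)) = l x + inner (d ys) h" and "AE x in \<mu>. l (- x) = - l x"
  shows "AE x in \<mu>. l x = \<phi> h x"
proof -
  have "AE x in \<mu>. l x - \<phi> h x = 0"
  proof (rule AE_zero_if_shift_invariant_odd)
    show "AE x in \<mu>. l (x + blinfun_apply j (d ys)) - \<phi> h (x + blinfun_apply j (d ys)) = l x - \<phi> h x" for ys
      using assms(2)[of ys] wiener_map_shift[of h ys] by eventually_elim simp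
    show "AE x in \<mu>. l (- x) - \<phi> h (- x) = - (l x - \<phi> h x)"
      using assms(3) wiener_map_neg[of h] by eventually_elim simp
  qed (use assms(1) L2spaceD(1)[OF wiener_mapD(3)[OF wiener]] in auto)
  then show ?thesis by eventually_elim simp
qed

end

section \<open>Convolutions\<close>

text \<open>\<open>measure_of\<close> returns the zero measure when the given set function is not a
  measure. Total mass 1 excludes this, so the formula holds.\<close>

lemma emeasure_convolve:
  assumes "prob_space (convolve M N)" "B \<in> sets borel"
  shows "emeasure (convolve M N) B = (\<integral>\<^sup>+x. emeasure N {y. x + y \<in> B} \<partial>M)"
proof -
  let ?f = "\<lambda>B. \<integral>\<^sup>+x. emeasure N {y. x + y \<in> B} \<partial>M"
  have ss: "sigma_sets UNIV (sets borel) = sets (borel :: 'a measure)"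
    using sets.sigma_sets_eq[of "borel :: 'a measure"] by simp
  have e: "emeasure (convolve M N) C =
      (if C \<in> sets borel \<and> measure_space UNIV (sets borel) ?f then ?f C else 0)" for C
    unfolding convolve_def emeasure_measure_of_conv ss by simp
  have "emeasure (convolve M N) (space (convolve M N)) = 1"
    by (rule prob_space.emeasure_space_1[OF assms(1)])
  then have "measure_space UNIV (sets borel) ?f" unfolding e by (simp split: if_splits)
  then show ?thesis using assms(2) by (simp add: e)
qed

lemma measurable_blinfun_borel:
  fixes f :: "'b::banach \<Rightarrow>\<^sub>L real"
  assumes "sets M = sets borel"
  shows "blinfun_apply f \<in> borel_measurable M"
  unfolding measurable_cong_sets[OF assms refl] by (intro borel_measurable_continuous_onI continuous_intros)

text \<open>The integrand depends on one functional, so everything is pushed to the real line, where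
  addition is jointly measurable.\<close>

lemma nn_integral_convolve:
  fixes M N :: "'b::banach measure" and f :: "'b \<Rightarrow>\<^sub>L real"
  assumes M: "prob_space M" "sets M = sets borel" and N: "prob_space N" "sets N = sets borel"
    and L: "prob_space (convolve M N)" "sets (convolve M N) = sets borel"
    and g[measurable]: "g \<in> borel_measurable borel"
  shows "(\<integral>\<^sup>+y. g (blinfun_apply f y) \<partial>convolve M N) =
    (\<integral>\<^sup>+x. \<integral>\<^sup>+y. g (blinfun_apply f x + blinfun_apply f y) \<partial>N \<partial>M)"
proof -
  note [measurable] = measurable_blinfun_borel[OF M(2), of f] measurable_blinfun_borel[OF N(2), of f]
    measurable_blinfun_borel[OF L(2), of f] measurable_blinfun_borel[OF refl, of f]
  let ?M = "distr M borel (blinfun_apply f)" and ?N = "distr N borel (blinfun_apply f)"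
  have fin: "finite_measure ?M" "finite_measure ?N"
    using M N by (auto intro!: prob_space.finite_measure prob_space.prob_space_distr)
  have conv: "(\<integral>\<^sup>+y. h y \<partial>convolution ?M ?N) = (\<integral>\<^sup>+x. \<integral>\<^sup>+y. h (blinfun_apply f x + blinfun_apply f y) \<partial>N \<partial>M)"
    if [measurable]: "h \<in> borel_measurable borel" for h
  proof -
    interpret N: prob_space ?N using N by (intro prob_space.prob_space_distr) auto
    have "(\<integral>\<^sup>+y. h y \<partial>convolution ?M ?N) = (\<integral>\<^sup>+x. \<integral>\<^sup>+y. h (x + y) \<partial>?N \<partial>?M)"
      by (rule nn_integral_convolution[OF fin]) auto
    also have "\<dots> = (\<integral>\<^sup>+x. \<integral>\<^sup>+y. h (blinfun_apply f x + y) \<partial>?N \<partial>M)"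
      by (subst nn_integral_distr) auto
    also have "\<dots> = (\<integral>\<^sup>+x. \<integral>\<^sup>+y. h (blinfun_apply f x + blinfun_apply f y) \<partial>N \<partial>M)"
      by (intro nn_integral_cong, subst nn_integral_distr) auto
    finally show ?thesis .
  qed
  have "distr (convolve M N) borel (blinfun_apply f) = convolution ?M ?N"
  proof (rule measure_eqI)
    fix A assume "A \<in> sets (distr (convolve M N) borel (blinfun_apply f))"
    then have A[measurable]: "A \<in> sets borel" by simp
    have sp: "space (convolve M N) = UNIV" "space N = UNIV"
      using sets_eq_imp_space_eq[OF L(2)] sets_eq_imp_space_eq[OF N(2)] by simp_all
    have pre: "blinfun_apply f -` A \<in> sets borel"
      using measurable_sets[OF measurable_blinfun_borel[OF refl, of f] A] by simp
    have "emeasure (distr (convolve M N) borel (blinfun_apply f)) A = emeasure (convolve M N) (blinfun_apply f -` A)"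
      by (subst emeasure_distr) (auto simp: sp)
    also have "\<dots> = (\<integral>\<^sup>+x. emeasure N {y. x + y \<in> blinfun_apply f -` A} \<partial>M)"
      by (rule emeasure_convolve[OF L(1) pre])
    also have "\<dots> = (\<integral>\<^sup>+x. \<integral>\<^sup>+y. indicator A (blinfun_apply f x + blinfun_apply f y) \<partial>N \<partial>M)"
    proof (intro nn_integral_cong)
      fix x
      have "{y. blinfun_apply f x + blinfun_apply f y \<in> A} = (\<lambda>y. blinfun_apply f x + blinfun_apply f y) -` A \<inter> space N"
        by (auto simp: sp)
      moreover have "(\<lambda>y. blinfun_apply f x + blinfun_apply f y) -` A \<inter> space N \<in> sets N" by measurable
      ultimately have "{y. x + y \<in> blinfun_apply f -` A} \<in> sets N" by (simp add: blinfun.add_right)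
      then have "emeasure N {y. x + y \<in> blinfun_apply f -` A} = (\<integral>\<^sup>+y. indicator {y. x + y \<in> blinfun_apply f -` A} y \<partial>N)"
        by simp
      also have "\<dots> = (\<integral>\<^sup>+y. indicator A (blinfun_apply f x + blinfun_apply f y) \<partial>N)"
        by (intro nn_integral_cong) (simp add: indicator_def blinfun.add_right)
      finally show "emeasure N {y. x + y \<in> blinfun_apply f -` A} = (\<integral>\<^sup>+y. indicator A (blinfun_apply f x + blinfun_apply f y) \<partial>N)" .
    qed
    also have "\<dots> = (\<integral>\<^sup>+y. indicator A y \<partial>convolution ?M ?N)" by (subst conv) auto
    also have "\<dots> = emeasure (convolution ?M ?N) A" by simp
    finally show "emeasure (distr (convolve M N) borel (blinfun_apply f)) A = emeasure (convolution ?M ?N) A" .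
  qed simp
  moreover have "(\<integral>\<^sup>+y. g (blinfun_apply f y) \<partial>convolve M N) =
      (\<integral>\<^sup>+y. g y \<partial>distr (convolve M N) borel (blinfun_apply f))"
    by (subst nn_integral_distr) auto
  ultimately show ?thesis by (simp add: conv)
qed

section \<open>The operator associated with a contraction\<close>

locale gaussian_contraction =
  X: gaussian_space \<mu>1 j1 \<phi>1 + Y: gaussian_space \<mu>2 j2 \<phi>2
  for \<mu>1 :: "'a::banach measure" and j1 :: "'h::{real_inner,banach} \<Rightarrow>\<^sub>L 'a" and \<phi>1
    and \<mu>2 :: "'b::banach measure" and j2 :: "'k::{real_inner,banach} \<Rightarrow>\<^sub>L 'b" and \<phi>2 +
  fixes T :: "'h \<Rightarrow> 'k" and S :: "'a \<Rightarrow> 'b" and \<rho> :: "'b measure"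
    and P :: "('b \<Rightarrow> real) \<Rightarrow> 'a \<Rightarrow> real" and J :: "nat set" and e :: "nat \<Rightarrow> 'h"
  assumes linear_T: "linear T" and T_le: "\<And>h. norm (T h) \<le> norm h"
    and S: "gaussian_extension \<mu>1 j1 \<mu>2 j2 T S \<rho>" and P: "mehler_extension \<mu>1 \<mu>2 S \<rho> P"
    and onb: "orthonormal_basis_on J e"
begin

abbreviation adj :: "('b \<Rightarrow>\<^sub>L real) \<Rightarrow> 'h" where "adj xs \<equiv> adjoint T (Y.d xs)"

lemma contraction_P: "L2_contraction \<mu>2 \<mu>1 P"
  using P by (simp add: mehler_extension_def)

lemma measurable_S[measurable]: "S \<in> borel_measurable borel"
  using S by (simp add: gaussian_extension_def)

lemma measurable_S_\<mu>1[measurable]: "S \<in> borel_measurable \<mu>1"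
  using measurable_S by (simp add: measurable_cong_sets[OF X.sets_eq refl])

lemma radon_image: "gaussian_radon (distr \<mu>1 borel S)" and radon_\<rho>: "gaussian_radon \<rho>"
  and convolve: "convolve (distr \<mu>1 borel S) \<rho> = \<mu>2"
  using S by (auto simp: gaussian_extension_def)

lemma sets_\<rho>[measurable_cong]: "sets \<rho> = sets borel"
  using radon_\<rho> by (simp add: gaussian_radon_def radon_prob_def)

sublocale R: prob_space \<rho>
  using radon_\<rho> by (simp add: gaussian_radon_def radon_prob_def)

text \<open>On \<open>D\<close>, which has full measure and contains the range of \<open>j1\<close>,
  linearity gives oddness and the increment \<open>xs (j2 (T (d ys)))\<close>. Moving
  \<open>j2\<close> and \<open>T\<close> to the other side of the inner product turns this into
  \<open>inner (d ys) (adj xs)\<close>.\<close>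

lemma S_functional: "AE x in \<mu>1. blinfun_apply xs (S x) = \<phi>1 (adj xs) x"
proof (rule X.wiener_map_eqI)
  obtain D where D: "subspace D" "AE x in \<mu>1. x \<in> D" "range (blinfun_apply j1) \<subseteq> D"
    and add: "\<And>x y. x \<in> D \<Longrightarrow> y \<in> D \<Longrightarrow> S (x + y) = S x + S y"
    and scale: "\<And>c x. x \<in> D \<Longrightarrow> S (c *\<^sub>R x) = c *\<^sub>R S x"
    using S unfolding gaussian_extension_def by blast
  have ST: "S (blinfun_apply j1 h) = blinfun_apply j2 (T h)" for h
    using S by (simp add: gaussian_extension_def)
  show "(\<lambda>x. blinfun_apply xs (S x)) \<in> borel_measurable \<mu>1"
    using Y.measurable_blinfun[of xs] by measurable
  show "AE x in \<mu>1. blinfun_apply xs (S (x + blinfun_apply j1 (X.d ys))) =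
      blinfun_apply xs (S x) + inner (X.d ys) (adj xs)" for ys
    using D(2)
  proof eventually_elim
    case (elim x)
    have "S (x + blinfun_apply j1 (X.d ys)) = S x + blinfun_apply j2 (T (X.d ys))"
      using add[OF elim, of "blinfun_apply j1 (X.d ys)"] D(3) by (auto simp: ST)
    then show ?case
      by (simp add: blinfun.add_right Y.inner_dual_map inner_adjoint[OF onb linear_T T_le, symmetric])
  qed
  show "AE x in \<mu>1. blinfun_apply xs (S (- x)) = - blinfun_apply xs (S x)"
    using D(2)
  proof eventually_elim
    case (elim x)
    from scale[OF elim, of "-1"] show ?case by (simp add: blinfun.minus_right)
  qed
qed

lemma S_functional_neg:
  fixes xs :: "'b \<Rightarrow>\<^sub>L real"
  shows "AE x in \<mu>1. blinfun_apply xs (S (- x)) = - blinfun_apply xs (S x)"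
  using S_functional[of xs] X.AE_neg[OF S_functional[of xs]] X.wiener_map_neg[of "adj xs"]
  by eventually_elim simp

text \<open>The image measure is assumed Gaussian but not centred. The reflection symmetry of
  \<open>\<mu>1\<close> gives mean 0, and the isometry \<open>\<phi>1\<close> gives the
  variance.\<close>

lemma exp_image:
  fixes xs :: "'b \<Rightarrow>\<^sub>L real"
  shows integrable_exp_image: "integrable (distr \<mu>1 borel S) (\<lambda>x. exp (blinfun_apply xs x))"
    and integral_exp_image: "(\<integral>x. exp (blinfun_apply xs x) \<partial>distr \<mu>1 borel S) = exp ((norm (adj xs))\<^sup>2 / 2)"
proof -
  note [measurable] = Y.measurable_blinfun[of xs]
  let ?\<nu> = "distr (distr \<mu>1 borel S) borel (blinfun_apply xs)"
  have law: "gaussian_law ?\<nu>" using radon_image by (simp add: gaussian_radon_def)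
  let ?m = "\<integral>x. blinfun_apply xs (S x) \<partial>\<mu>1"
  have "?m = (\<integral>x. blinfun_apply xs (S x) \<partial>distr \<mu>1 borel uminus)" by (simp add: X.distr_uminus)
  also have "\<dots> = (\<integral>x. blinfun_apply xs (S (- x)) \<partial>\<mu>1)" by (subst integral_distr) auto
  also have "\<dots> = (\<integral>x. - blinfun_apply xs (S x) \<partial>\<mu>1)"
    by (rule integral_cong_AE) (use S_functional_neg in auto)
  finally have m: "?m = 0" by simp
  have mean: "(\<integral>x. x \<partial>?\<nu>) = 0" by (simp add: integral_distr m)
  have "L2norm \<mu>1 (\<lambda>x. blinfun_apply xs (S x)) = L2norm \<mu>1 (\<phi>1 (adj xs))"
    by (intro L2norm_cong_AE S_functional L2spaceD(1)[OF wiener_mapD(3)[OF X.wiener]]) measurable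
  then have "(\<integral>x. (blinfun_apply xs (S x))\<^sup>2 \<partial>\<mu>1) = (norm (adj xs))\<^sup>2"
    by (simp add: wiener_mapD(2)[OF X.wiener] flip: L2norm_power2)
  then have sq: "(\<integral>x. x\<^sup>2 \<partial>?\<nu>) = (norm (adj xs))\<^sup>2" by (simp add: integral_distr)
  show "integrable (distr \<mu>1 borel S) (\<lambda>x. exp (blinfun_apply xs x))"
    using gaussian_law_laplace(1)[OF law mean, of 1] by (simp add: integrable_distr_eq)
  show "(\<integral>x. exp (blinfun_apply xs x) \<partial>distr \<mu>1 borel S) = exp ((norm (adj xs))\<^sup>2 / 2)"
    using gaussian_law_laplace(2)[OF law mean, of 1] by (simp add: integral_distr sq)
qed

text \<open>Exponential integrals multiply under convolution, so the one of \<open>\<rho>\<close> is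
  a quotient. The computation uses nonnegative integrals because integrability with respect to
  \<open>\<rho>\<close> is itself a result of it.\<close>

lemma exp_\<rho>:
  fixes xs :: "'b \<Rightarrow>\<^sub>L real"
  shows integrable_exp_\<rho>: "integrable \<rho> (\<lambda>x. exp (blinfun_apply xs x))"
    and integral_exp_\<rho>: "(\<integral>x. exp (blinfun_apply xs x) \<partial>\<rho>) = exp (((norm (Y.d xs))\<^sup>2 - (norm (adj xs))\<^sup>2) / 2)"
proof -
  note [measurable] = Y.measurable_blinfun[of xs]
  let ?\<nu> = "distr \<mu>1 borel S" and ?a = "(norm (Y.d xs))\<^sup>2 / 2" and ?b = "(norm (adj xs))\<^sup>2 / 2"
  let ?I = "\<integral>\<^sup>+y. ennreal (exp (blinfun_apply xs y)) \<partial>\<rho>"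
  have "ennreal (exp ?a) = (\<integral>\<^sup>+y. ennreal (exp (blinfun_apply xs y)) \<partial>\<mu>2)"
    by (simp add: nn_integral_eq_integral Y.integrable_exp Y.integral_exp)
  also have "\<dots> = (\<integral>\<^sup>+y. ennreal (exp (blinfun_apply xs y)) \<partial>convolve ?\<nu> \<rho>)" by (simp only: convolve)
  also have "\<dots> = (\<integral>\<^sup>+x. \<integral>\<^sup>+y. ennreal (exp (blinfun_apply xs x + blinfun_apply xs y)) \<partial>\<rho> \<partial>?\<nu>)"
    using X.prob_space_distr[OF measurable_S_\<mu>1] R.prob_space_axioms Y.prob_space_axioms Y.sets_eq sets_\<rho> convolve
    by (intro nn_integral_convolve[where g = "\<lambda>z. ennreal (exp z)"]) auto
  also have "\<dots> = (\<integral>\<^sup>+x. ennreal (exp (blinfun_apply xs x)) * ?I \<partial>?\<nu>)"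
    by (intro nn_integral_cong) (simp add: exp_add ennreal_mult nn_integral_cmult)
  also have "\<dots> = (\<integral>\<^sup>+x. ennreal (exp (blinfun_apply xs x)) \<partial>?\<nu>) * ?I" by (rule nn_integral_multc) simp
  also have "(\<integral>\<^sup>+x. ennreal (exp (blinfun_apply xs x)) \<partial>?\<nu>) = ennreal (exp ?b)"
    by (simp only: nn_integral_eq_integral[OF integrable_exp_image] integral_exp_image exp_ge_zero eventually_True)
  finally have "ennreal (exp (- ?b)) * ennreal (exp ?a) = (ennreal (exp (- ?b)) * ennreal (exp ?b)) * ?I"
    by (simp only: mult.assoc)
  then have I: "?I = ennreal (exp (((norm (Y.d xs))\<^sup>2 - (norm (adj xs))\<^sup>2) / 2))"
    by (simp add: diff_divide_distrib flip: ennreal_mult exp_add)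
  show "integrable \<rho> (\<lambda>x. exp (blinfun_apply xs x))"
    by (rule integrableI_bounded) (auto simp: I)
  then show "(\<integral>x. exp (blinfun_apply xs x) \<partial>\<rho>) = exp (((norm (Y.d xs))\<^sup>2 - (norm (adj xs))\<^sup>2) / 2)"
    using I by (simp add: nn_integral_eq_integral)
qed

lemma measurable_translate: "f \<in> borel_measurable borel \<Longrightarrow> (\<lambda>y. f (c + y)) \<in> borel_measurable \<rho>"
  for c :: 'b and f :: "'b \<Rightarrow> real"
  unfolding measurable_cong_sets[OF sets_\<rho> refl]
  by (rule measurable_compose[where N = borel and g = f]) (intro borel_measurable_continuous_onI continuous_intros)

section \<open>Mehler's formula on Hermite polynomials\<close>

text \<open>\<open>P\<close> is given by the formula on bounded functions. The truncations
  \<open>g n\<close> converge in \<open>L\<^sup>2\<close> on the side of \<open>P\<close> and under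
  the \<open>\<rho>\<close>-integral by domination; a subsequence identifies the limits.\<close>

lemma P_eq_mehler:
  assumes f[measurable]: "f \<in> borel_measurable borel" and L2: "f \<in> L2space \<mu>2"
    and int: "\<And>x. integrable \<rho> (\<lambda>y. f (S x + y))"
  shows "AE x in \<mu>1. P f x = mehler S \<rho> f x"
proof -
  define g where "g n y = max (- real n) (min (real n) (f y))" for n y
  have gm[measurable]: "g n \<in> borel_measurable borel" for n unfolding g_def[abs_def] by measurable
  have gf: "\<bar>g n y\<bar> \<le> \<bar>f y\<bar>" and gn: "\<bar>g n y\<bar> \<le> real n" for n y
    by (auto simp: g_def max_def min_def)
  have gfm: "\<bar>g n y - f y\<bar> \<le> \<bar>f y\<bar>" for n y by (auto simp: g_def max_def min_def)
  have lim: "(\<lambda>n. g n y) \<longlonglongrightarrow> f y" for y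
  proof (rule tendsto_eventually)
    obtain N where N: "\<bar>f y\<bar> \<le> real N" using real_arch_simple by blast
    show "eventually (\<lambda>n. g n y = f y) sequentially"
      using N by (intro eventually_sequentiallyI[of N]) (auto simp: g_def max_def min_def)
  qed
  have f2: "integrable \<mu>2 (\<lambda>y. (f y)\<^sup>2)" using L2 by (auto simp: L2space_def)
  have gL2: "g n \<in> L2space \<mu>2" for n
  proof -
    have "integrable \<mu>2 (\<lambda>y. (g n y)\<^sup>2)"
      by (rule Bochner_Integration.integrable_bound[OF f2]) (use gf in \<open>auto simp: abs_le_square_iff\<close>)
    then show ?thesis by (simp add: L2space_def)
  qed
  have "(\<lambda>n. \<integral>y. (g n y - f y)\<^sup>2 \<partial>\<mu>2) \<longlonglongrightarrow> (\<integral>y. 0 \<partial>\<mu>2)"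
  proof (rule integral_dominated_convergence[where w = "\<lambda>y. (f y)\<^sup>2"])
    show "AE y in \<mu>2. (\<lambda>n. (g n y - f y)\<^sup>2) \<longlonglongrightarrow> 0"
      using tendsto_power[OF LIM_zero[OF lim], where n = 2] by simp
    show "AE y in \<mu>2. norm ((g n y - f y)\<^sup>2) \<le> (f y)\<^sup>2" for n
      using gfm by (simp add: abs_le_square_iff)
  qed (use f2 in auto)
  then have gfL: "(\<lambda>n. L2norm \<mu>2 (\<lambda>y. g n y - f y)) \<longlonglongrightarrow> 0"
    using tendsto_real_sqrt by (fastforce simp: L2norm_def)
  have "(\<lambda>n. L2norm \<mu>1 (\<lambda>x. P (g n) x - P f x)) \<longlonglongrightarrow> 0"
  proof (rule tendsto_sandwich[OF _ _ tendsto_const gfL])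
    have "L2norm \<mu>1 (\<lambda>x. P (g n) x - P f x) \<le> L2norm \<mu>2 (\<lambda>y. g n y - f y)" for n
    proof -
      have "L2norm \<mu>1 (\<lambda>x. P (g n) x - P f x) = L2norm \<mu>1 (P (\<lambda>y. g n y - f y))"
        using L2_contraction_diff[OF contraction_P gL2 L2, of n]
        by (intro L2norm_cong_AE L2spaceD L2space_diff L2_contractionD(1)[OF contraction_P] gL2 L2)
          (auto elim: eventually_mono)
      then show ?thesis using L2_contractionD(2)[OF contraction_P L2space_diff[OF gL2 L2]] by simp
    qed
    then show "eventually (\<lambda>n. L2norm \<mu>1 (\<lambda>x. P (g n) x - P f x) \<le> L2norm \<mu>2 (\<lambda>y. g n y - f y)) sequentially"
      by simp
  qed (simp add: L2norm_nonneg)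
  from AE_tendsto_subseq[OF L2_contractionD(1)[OF contraction_P gL2] L2_contractionD(1)[OF contraction_P L2] this]
  obtain r where r: "strict_mono r" "AE x in \<mu>1. (\<lambda>n. P (g (r n)) x) \<longlonglongrightarrow> P f x" by blast
  have "AE x in \<mu>1. P (g n) x = mehler S \<rho> (g n) x" for n
  proof -
    have "bounded (range (g n))" using gn[of n] by (auto simp: bounded_iff)
    then show ?thesis using P by (simp add: mehler_extension_def)
  qed
  then have "AE x in \<mu>1. \<forall>n. P (g n) x = mehler S \<rho> (g n) x" by (simp add: AE_all_countable)
  with r(2) show ?thesis
  proof eventually_elim
    case (elim x)
    have "(\<lambda>n. mehler S \<rho> (g n) x) \<longlonglongrightarrow> mehler S \<rho> f x"
      unfolding mehler_def
      by (rule integral_dominated_convergence[where w = "\<lambda>y. \<bar>f (S x + y)\<bar>"])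
        (use int gf lim in \<open>auto intro!: measurable_translate\<close>)
    from LIMSEQ_subseq_LIMSEQ[OF this r(1)] have "(\<lambda>n. P (g (r n)) x) \<longlonglongrightarrow> mehler S \<rho> f x"
      using elim(2) by (simp add: o_def)
    then show ?case using elim(1) LIMSEQ_unique by blast
  qed
qed

lemma integrable_exp_abs:
  assumes "sets M = sets borel" "\<And>xs :: 'b \<Rightarrow>\<^sub>L real. integrable M (\<lambda>y. exp (blinfun_apply xs y))"
  shows "integrable M (\<lambda>y. exp (c * \<bar>blinfun_apply (xs :: 'b \<Rightarrow>\<^sub>L real) y\<bar>))"
proof (rule Bochner_Integration.integrable_bound)
  note [measurable] = measurable_blinfun_borel[OF assms(1), of xs]
  show "integrable M (\<lambda>y. exp (blinfun_apply (c *\<^sub>R xs) y) + exp (blinfun_apply (- c *\<^sub>R xs) y))"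
    by (intro Bochner_Integration.integrable_add assms(2))
  show "(\<lambda>y. exp (c * \<bar>blinfun_apply xs y\<bar>)) \<in> borel_measurable M" by measurable
  have "exp (c * \<bar>z\<bar>) \<le> exp (c * z) + exp (- c * z)" for z :: real by (auto simp: abs_if)
  then show "AE y in M. norm (exp (c * \<bar>blinfun_apply xs y\<bar>)) \<le>
      norm (exp (blinfun_apply (c *\<^sub>R xs) y) + exp (blinfun_apply (- c *\<^sub>R xs) y))"
    by (simp add: blinfun.scaleR_left blinfun.minus_left)
qed

lemma measurable_scaled_hermite[measurable]: "scaled_hermite a n \<in> borel_measurable borel"
  unfolding scaled_hermite_def[abs_def] by measurable

lemma integrable_scaled_hermite_\<rho>: "integrable \<rho> (\<lambda>y. scaled_hermite a n (c + blinfun_apply xs y))"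
proof (rule Bochner_Integration.integrable_bound)
  note [measurable] = Y.measurable_blinfun[of xs]
  show "integrable \<rho> (\<lambda>y. (fact n * exp (\<bar>a\<bar> / 2) * exp \<bar>c\<bar>) * exp (1 * \<bar>blinfun_apply xs y\<bar>))"
    by (intro integrable_mult_right integrable_exp_abs sets_\<rho> integrable_exp_\<rho>)
  have "\<bar>scaled_hermite a n (c + z)\<bar> \<le> fact n * exp (\<bar>a\<bar> / 2) * exp \<bar>c\<bar> * exp \<bar>z\<bar>" for z
  proof -
    have "\<bar>scaled_hermite a n (c + z)\<bar> \<le> fact n * exp (\<bar>a\<bar> / 2) * exp \<bar>c + z\<bar>" by (rule abs_scaled_hermite_le_exp)
    also have "\<dots> \<le> fact n * exp (\<bar>a\<bar> / 2) * (exp \<bar>c\<bar> * exp \<bar>z\<bar>)"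
      by (intro mult_left_mono) (auto simp flip: exp_add)
    finally show ?thesis by (simp add: mult.assoc)
  qed
  then show "AE y in \<rho>. norm (scaled_hermite a n (c + blinfun_apply xs y)) \<le>
      norm (fact n * exp (\<bar>a\<bar> / 2) * exp \<bar>c\<bar> * exp (1 * \<bar>blinfun_apply xs y\<bar>))"
    by (simp add: abs_mult)
qed measurable

lemma scaled_hermite_L2: "(\<lambda>y. scaled_hermite a n (blinfun_apply xs y)) \<in> L2space \<mu>2"
proof -
  note [measurable] = Y.measurable_blinfun[of xs]
  have "integrable \<mu>2 (\<lambda>y. (scaled_hermite a n (blinfun_apply xs y))\<^sup>2)"
  proof (rule Bochner_Integration.integrable_bound)
    show "integrable \<mu>2 (\<lambda>y. (fact n * exp (\<bar>a\<bar> / 2))\<^sup>2 * exp (2 * \<bar>blinfun_apply xs y\<bar>))"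
      by (intro integrable_mult_right integrable_exp_abs Y.sets_eq Y.integrable_exp)
    have "(scaled_hermite a n z)\<^sup>2 \<le> (fact n * exp (\<bar>a\<bar> / 2))\<^sup>2 * exp (2 * \<bar>z\<bar>)" for z
    proof -
      have "\<bar>scaled_hermite a n z\<bar>\<^sup>2 \<le> (fact n * exp (\<bar>a\<bar> / 2) * exp \<bar>z\<bar>)\<^sup>2"
        by (intro power_mono abs_scaled_hermite_le_exp) simp
      then show ?thesis by (simp add: power_mult_distrib exp_double)
    qed
    then show "AE y in \<mu>2. norm ((scaled_hermite a n (blinfun_apply xs y))\<^sup>2) \<le>
        norm ((fact n * exp (\<bar>a\<bar> / 2))\<^sup>2 * exp (2 * \<bar>blinfun_apply xs y\<bar>))" by simp
  qed measurable
  then show ?thesis by (simp add: L2space_def)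
qed

text \<open>Both sides have the same generating function.\<close>

lemma integral_scaled_hermite_\<rho>:
  "(\<integral>y. scaled_hermite ((norm (Y.d xs))\<^sup>2) n (c + blinfun_apply xs y) \<partial>\<rho>) = scaled_hermite ((norm (adj xs))\<^sup>2) n c"
proof (rule scaled_hermite_unique)
  fix t :: real
  note [measurable] = Y.measurable_blinfun[of xs]
  let ?a = "(norm (Y.d xs))\<^sup>2" and ?b = "(norm (adj xs))\<^sup>2"
  have "(\<lambda>n. \<integral>y. t ^ n / fact n * scaled_hermite ?a n (c + blinfun_apply xs y) \<partial>\<rho>) sums
      (\<integral>y. exp (t * (c + blinfun_apply xs y) - ?a * t\<^sup>2 / 2) \<partial>\<rho>)"
  proof (rule integral_sums_dominated)
    show "integrable \<rho> (\<lambda>y. exp (\<bar>t * c\<bar> + \<bar>?a\<bar> * t\<^sup>2 / 2) * exp (\<bar>t\<bar> * \<bar>blinfun_apply xs y\<bar>))"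
      by (intro integrable_mult_right integrable_exp_abs sets_\<rho> integrable_exp_\<rho>)
    fix y N
    have "(\<Sum>n<N. \<bar>t ^ n / fact n * scaled_hermite ?a n (c + blinfun_apply xs y)\<bar>) \<le>
        exp (\<bar>t * (c + blinfun_apply xs y)\<bar> + \<bar>?a\<bar> * t\<^sup>2 / 2)" by (rule sum_abs_scaled_hermite_le)
    also have "\<dots> \<le> exp ((\<bar>t * c\<bar> + \<bar>?a\<bar> * t\<^sup>2 / 2) + \<bar>t\<bar> * \<bar>blinfun_apply xs y\<bar>)"
      using abs_triangle_ineq[of "t * c" "t * blinfun_apply xs y"] by (simp add: distrib_left abs_mult)
    finally show "(\<Sum>n<N. \<bar>t ^ n / fact n * scaled_hermite ?a n (c + blinfun_apply xs y)\<bar>) \<le>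
        exp (\<bar>t * c\<bar> + \<bar>?a\<bar> * t\<^sup>2 / 2) * exp (\<bar>t\<bar> * \<bar>blinfun_apply xs y\<bar>)" by (simp only: exp_add)
  qed (measurable, rule scaled_hermite_sums)
  also have "(\<integral>y. exp (t * (c + blinfun_apply xs y) - ?a * t\<^sup>2 / 2) \<partial>\<rho>) =
      (\<integral>y. exp (t * c - ?a * t\<^sup>2 / 2) * exp (blinfun_apply (t *\<^sub>R xs) y) \<partial>\<rho>)"
    by (intro Bochner_Integration.integral_cong refl)
      (simp add: blinfun.scaleR_left algebra_simps flip: exp_add)
  also have "\<dots> = exp (t * c - ?a * t\<^sup>2 / 2) * exp (((norm (Y.d (t *\<^sub>R xs)))\<^sup>2 - (norm (adj (t *\<^sub>R xs)))\<^sup>2) / 2)"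
    by (simp only: integral_mult_right_zero integral_exp_\<rho>)
  \<comment> \<open>Both squared norms scale with \<open>t\<^sup>2\<close>, so the variance of
    \<open>\<rho>\<close> cancels \<open>?a\<close> and leaves \<open>?b\<close>.\<close>
  also have "\<dots> = exp (t * c - ?b * t\<^sup>2 / 2)"
    by (simp add: Y.dual_map_scaleR linear_scale[OF linear_adjoint[OF onb linear_T T_le]]
        power_mult_distrib diff_divide_distrib mult.commute flip: exp_add)
  finally show "(\<lambda>n. t ^ n / fact n * (\<integral>y. scaled_hermite ?a n (c + blinfun_apply xs y) \<partial>\<rho>)) sums
      exp (t * c - ?b * t\<^sup>2 / 2)" by simp
qed

lemma P_scaled_hermite:
  "AE x in \<mu>1. P (\<lambda>y. scaled_hermite ((norm (Y.d xs))\<^sup>2) n (blinfun_apply xs y)) x =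
    scaled_hermite ((norm (adj xs))\<^sup>2) n (\<phi>1 (adj xs) x)"
proof -
  note [measurable] = Y.measurable_blinfun[of xs]
  let ?f = "\<lambda>y. scaled_hermite ((norm (Y.d xs))\<^sup>2) n (blinfun_apply xs y)"
  have "AE x in \<mu>1. P ?f x = mehler S \<rho> ?f x"
    by (rule P_eq_mehler[OF _ scaled_hermite_L2]) (simp_all add: blinfun.add_right integrable_scaled_hermite_\<rho>)
  with S_functional[of xs] show ?thesis
    by eventually_elim (simp add: mehler_def blinfun.add_right integral_scaled_hermite_\<rho>)
qed

end

section \<open>The identity on one symmetric power\<close>

lemma (in gaussian_contraction) P_stochastic_integral:
  fixes tens1 :: "'h list \<Rightarrow> 'f::{real_inner,banach}" and tens2 :: "'k list \<Rightarrow> 'g::{real_inner,banach}"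
    and e2 :: "nat \<Rightarrow> 'k"
  assumes ht1: "hilbert_tensor_powers tens1" and ht2: "hilbert_tensor_powers tens2"
    and onb2: "orthonormal_basis_on J2 e2"
    and si1: "stochastic_integral \<mu>1 tens1 J e \<phi>1 n I1" and si2: "stochastic_integral \<mu>2 tens2 J2 e2 \<phi>2 n I2"
    and u: "u \<in> sym_power tens2 n"
  shows "AE x in \<mu>1. P (I2 u) x = I1 (blinfun_apply (tensor_power_map tens2 tens1 n (adjoint T)) u) x"
proof -
  define A where "A = tensor_power_map tens2 tens1 n (adjoint T)"
  let ?s1 = "blinfun_apply (symmetriser tens1 n)" and ?s2 = "blinfun_apply (symmetriser tens2 n)"
  note adjT = linear_adjoint[OF onb linear_T T_le] norm_adjoint_le[OF onb linear_T T_le]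
  note A_tens = tensor_power_map_tens[OF ht2 ht1 onb2 onb adjT, of n, folded A_def]
  have lin1: "L2_linear_on (sym_power tens1 n) \<mu>1 I1" and lin2: "L2_linear_on (sym_power tens2 n) \<mu>2 I2"
    using si1 si2 by (simp_all add: stochastic_integral_def)
  from si1 obtain C1 where C1: "\<forall>u\<in>sym_power tens1 n. L2norm \<mu>1 (I1 u) \<le> C1 * norm u"
    unfolding stochastic_integral_def by (elim conjE exE)
  from si2 obtain C2 where C2: "\<forall>u\<in>sym_power tens2 n. L2norm \<mu>2 (I2 u) \<le> C2 * norm u"
    unfolding stochastic_integral_def by (elim conjE exE)
  have mem2: "?s2 w \<in> sym_power tens2 n" for w by (simp add: sym_power_def)
  have mem1: "blinfun_apply A (?s2 w) \<in> sym_power tens1 n" for w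
    unfolding A_def tensor_power_map_symmetriser[OF ht2 ht1 onb2 onb adjT] by (simp add: sym_power_def)
  have L2_2: "I2 (?s2 w) \<in> L2space \<mu>2" and L2_P: "P (I2 (?s2 w)) \<in> L2space \<mu>1"
    and L2_1: "I1 (blinfun_apply A (?s2 w)) \<in> L2space \<mu>1" for w
    using L2_linear_onD(1)[OF lin2 mem2] L2_linear_onD(1)[OF lin1 mem1] L2_contractionD(1)[OF contraction_P] by auto
  \<comment> \<open>Precomposition with the symmetriser turns the difference of the two sides into a
    bounded linear map on the whole tensor space, whose zero set \<open>V\<close> is a closed
    subspace.\<close>
  define B where "B w x = P (I2 (?s2 w)) x - I1 (blinfun_apply A (?s2 w)) x" for w x
  have linB: "L2_linear_on UNIV \<mu>1 B"
    unfolding L2_linear_on_def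
  proof (intro conjI ballI allI)
    show "B w \<in> L2space \<mu>1" for w unfolding B_def[abs_def] by (intro L2space_diff L2_P L2_1)
    show "AE x in \<mu>1. B (v + w) x = B v x + B w x" for v w
    proof -
      have "AE x in \<mu>1. P (I2 (?s2 (v + w))) x = P (\<lambda>y. I2 (?s2 v) y + I2 (?s2 w) y) x"
        using L2_linear_onD(2)[OF lin2 mem2[of v] mem2[of w]]
        by (intro L2_contraction_cong_AE[OF contraction_P] L2_2 L2space_add) (simp add: blinfun.add_right)
      with L2_contractionD(3)[OF contraction_P L2_2[of v] L2_2[of w]] L2_linear_onD(2)[OF lin1 mem1[of v] mem1[of w]]
      show ?thesis by eventually_elim (simp add: B_def blinfun.add_right)
    qed
    show "AE x in \<mu>1. B (c *\<^sub>R w) x = c * B w x" for c w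
    proof -
      have "AE x in \<mu>1. P (I2 (?s2 (c *\<^sub>R w))) x = P (\<lambda>y. c * I2 (?s2 w) y) x"
        using L2_linear_onD(3)[OF lin2 mem2[of w], of c]
        by (intro L2_contraction_cong_AE[OF contraction_P] L2_2 L2space_mult) (simp add: blinfun.scaleR_right)
      with L2_contractionD(4)[OF contraction_P L2_2[of w], of c] L2_linear_onD(3)[OF lin1 mem1[of w], of c]
      show ?thesis by eventually_elim (simp add: B_def blinfun.scaleR_right right_diff_distrib)
    qed
  qed
  define C where "C = (2 * \<bar>C2\<bar> + 2 * \<bar>C1\<bar>) * norm (symmetriser tens2 n)"
  have bdB: "L2norm \<mu>1 (B w) \<le> C * norm w" for w
  proof -
    have "L2norm \<mu>1 (B w) \<le> 2 * L2norm \<mu>1 (P (I2 (?s2 w))) + 2 * L2norm \<mu>1 (I1 (blinfun_apply A (?s2 w)))"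
      unfolding B_def[abs_def] by (rule L2norm_diff_le[OF L2_P L2_1])
    also have "\<dots> \<le> 2 * (\<bar>C2\<bar> * norm (?s2 w)) + 2 * (\<bar>C1\<bar> * norm (?s2 w))"
    proof (intro add_mono mult_left_mono)
      have "L2norm \<mu>1 (P (I2 (?s2 w))) \<le> C2 * norm (?s2 w)"
        using L2_contractionD(2)[OF contraction_P L2_2[of w]] bspec[OF C2 mem2[of w]] by simp
      also have "\<dots> \<le> \<bar>C2\<bar> * norm (?s2 w)" by (intro mult_right_mono) auto
      finally show "L2norm \<mu>1 (P (I2 (?s2 w))) \<le> \<bar>C2\<bar> * norm (?s2 w)" .
      have "L2norm \<mu>1 (I1 (blinfun_apply A (?s2 w))) \<le> C1 * norm (blinfun_apply A (?s2 w))" by (rule bspec[OF C1 mem1])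
      also have "\<dots> \<le> \<bar>C1\<bar> * norm (blinfun_apply A (?s2 w))" by (intro mult_right_mono) auto
      also have "\<dots> \<le> \<bar>C1\<bar> * norm (?s2 w)"
        unfolding A_def by (intro mult_left_mono norm_tensor_power_map[OF ht2 ht1 onb2 onb adjT]) simp
      finally show "L2norm \<mu>1 (I1 (blinfun_apply A (?s2 w))) \<le> \<bar>C1\<bar> * norm (?s2 w)" .
    qed auto
    also have "\<dots> = (2 * \<bar>C2\<bar> + 2 * \<bar>C1\<bar>) * norm (?s2 w)" by (simp add: algebra_simps)
    also have "\<dots> \<le> (2 * \<bar>C2\<bar> + 2 * \<bar>C1\<bar>) * (norm (symmetriser tens2 n) * norm w)"
      by (intro mult_left_mono norm_blinfun) auto
    finally show ?thesis by (simp add: C_def mult.assoc)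
  qed
  define V where "V = {w. AE x in \<mu>1. B w x = 0}"
  have V: "subspace V" "closed V"
    unfolding V_def by (rule subspace_AE_zero[OF linB bdB] closed_AE_zero[OF linB bdB])+
  \<comment> \<open>Only for \<open>h = Y.d xs\<close> is \<open>\<phi>2 h\<close> almost everywhere
    a known continuous functional, to which Mehler's formula applies directly.\<close>
  have diag: "tens2 (replicate n (Y.d xs)) \<in> V" for xs
  proof -
    let ?t = "tens2 (replicate n (Y.d xs))" and ?h = "\<lambda>y. scaled_hermite ((norm (Y.d xs))\<^sup>2) n (blinfun_apply xs y)"
    have "AE y in \<mu>2. I2 ?t y = ?h y"
      using stochastic_integral_replicate[OF ht2 si2 onb2 Y.wiener, of "Y.d xs"] wiener_mapD(4)[OF Y.wiener, of xs]
      by eventually_elim simp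
    then have "AE x in \<mu>1. P (I2 ?t) x = P ?h x"
      using L2_2[of ?t] by (intro L2_contraction_cong_AE[OF contraction_P] scaled_hermite_L2)
        (simp add: symmetriser_tens_replicate[OF ht2])
    with P_scaled_hermite[of xs n] stochastic_integral_replicate[OF ht1 si1 onb X.wiener, of "adj xs"]
    have "AE x in \<mu>1. B ?t x = 0"
      by eventually_elim (simp add: B_def symmetriser_tens_replicate[OF ht2] A_tens)
    then show ?thesis by (simp add: V_def)
  qed
  have diag_all: "tens2 (replicate n h) \<in> V" for h
  proof -
    have "h \<in> closure (range Y.d)" by (simp add: Y.closure_range_dual_map)
    then obtain g where g: "\<And>m. g m \<in> range Y.d" "g \<longlonglongrightarrow> h" unfolding closure_sequential by blast
    have "tens2 (replicate n (g m)) \<in> V" for m using g(1)[of m] diag by auto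
    then show ?thesis by (rule closed_sequentially[OF V(2) _ tendsto_tens_replicate[OF ht2 g(2)]])
  qed
  interpret s: symmetric_multilinear "\<lambda>hs. ?s2 (tens2 hs)" by (rule symmetric_multilinear_symmetriser[OF ht2])
  have "?s2 (tens2 hs) \<in> V" for hs
  proof (cases "length hs = n")
    case True
    show ?thesis
      by (rule s.polarisation[OF V subspace_UNIV _ subset_UNIV True])
        (simp add: symmetriser_tens_replicate[OF ht2] diag_all)
  next
    case False
    then show ?thesis using subspace_0[OF V(1)] by (simp add: symmetriser_tens[OF ht2])
  qed
  then have "range tens2 \<subseteq> {w. ?s2 w \<in> V}" by auto
  moreover have "subspace {w. ?s2 w \<in> V}"
    using V(1) by (auto simp: subspace_def blinfun.zero_right blinfun.add_right blinfun.scaleR_right)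
  ultimately have "span (range tens2) \<subseteq> {w. ?s2 w \<in> V}" by (rule span_minimal)
  moreover have "closed {w. ?s2 w \<in> V}"
    using continuous_closed_vimage[OF V(2), of "?s2"] by (simp add: vimage_def blinfun.isCont linear_continuous_at)
  ultimately have "closure (span (range tens2)) \<subseteq> {w. ?s2 w \<in> V}" by (rule closure_minimal)
  then have all: "?s2 w \<in> V" for w using tens_total[OF ht2] by blast
  \<comment> \<open>\<open>B\<close> symmetrises its argument once more, which idempotence
    undoes.\<close>
  obtain w where w: "u = ?s2 w" using u by (auto simp: sym_power_def)
  have "AE x in \<mu>1. B (?s2 w) x = 0" using all[of w] by (simp add: V_def)
  then show ?thesis by (simp add: B_def symmetriser_idem[OF ht2] w A_def)
qed

section \<open>From single symmetric powers to the Fock space\<close>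

theorem theorem3p5:
  fixes \<mu>1 :: "'a::banach measure" and \<mu>2 :: "'b::banach measure"
    and j1 :: "'h::{real_inner,banach} \<Rightarrow>\<^sub>L 'a" and j2 :: "'k::{real_inner,banach} \<Rightarrow>\<^sub>L 'b"
    and T :: "'h \<Rightarrow> 'k"
    and S :: "'a \<Rightarrow> 'b" and \<rho> :: "'b measure"
    and P :: "('b \<Rightarrow> real) \<Rightarrow> 'a \<Rightarrow> real"
    and tens1 :: "'h list \<Rightarrow> 'f::{real_inner,banach}"
    and tens2 :: "'k list \<Rightarrow> 'g::{real_inner,banach}"
    and J1 J2 :: "nat set" and e1 :: "nat \<Rightarrow> 'h" and e2 :: "nat \<Rightarrow> 'k"
    and \<phi>1 :: "'h \<Rightarrow> 'a \<Rightarrow> real" and \<phi>2 :: "'k \<Rightarrow> 'b \<Rightarrow> real"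
    and I1 :: "nat \<Rightarrow> 'f \<Rightarrow> 'a \<Rightarrow> real" and I2 :: "nat \<Rightarrow> 'g \<Rightarrow> 'b \<Rightarrow> real"
    and W1 :: "(nat \<Rightarrow> 'f) \<Rightarrow> 'a \<Rightarrow> real" and W2 :: "(nat \<Rightarrow> 'g) \<Rightarrow> 'b \<Rightarrow> real"
  assumes "centred_gaussian_radon \<mu>1" and "centred_gaussian_radon \<mu>2"
    and "rkhs \<mu>1 j1" and "rkhs \<mu>2 j2"
    and "linear T" and "\<And>h. norm (T h) \<le> norm h"
    and "gaussian_extension \<mu>1 j1 \<mu>2 j2 T S \<rho>"
    and "mehler_extension \<mu>1 \<mu>2 S \<rho> P"
    and "hilbert_tensor_powers tens1" and "hilbert_tensor_powers tens2"
    and "orthonormal_basis_on J1 e1" and "orthonormal_basis_on J2 e2"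
    and "wiener_map \<mu>1 j1 \<phi>1" and "wiener_map \<mu>2 j2 \<phi>2"
    and "\<And>n. stochastic_integral \<mu>1 tens1 J1 e1 \<phi>1 n (I1 n)"
    and "\<And>n. stochastic_integral \<mu>2 tens2 J2 e2 \<phi>2 n (I2 n)"
    and "wiener_ito \<mu>1 tens1 I1 W1" and "wiener_ito \<mu>2 tens2 I2 W2"
  shows "\<forall>\<xi>\<in>sym_fock tens2.
           AE x in \<mu>1. P (W2 \<xi>) x = W1 (second_quantisation tens2 tens1 (adjoint T) \<xi>) x"
proof
  interpret gaussian_contraction \<mu>1 j1 \<phi>1 \<mu>2 j2 \<phi>2 T S \<rho> P J1 e1
    by (intro gaussian_contraction.intro gaussian_space.intro gaussian_contraction_axioms.intro) (fact assms)+
  note ht1 = assms(9) and ht2 = assms(10) and onb2 = assms(12)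
  note adjT = linear_adjoint[OF onb linear_T T_le] norm_adjoint_le[OF onb linear_T T_le]
  fix \<xi> assume \<xi>: "\<xi> \<in> sym_fock tens2"
  define \<eta> where "\<eta> = second_quantisation tens2 tens1 (adjoint T) \<xi>"
  let ?A = "\<lambda>n. blinfun_apply (tensor_power_map tens2 tens1 n (adjoint T))"
  have \<eta>n: "\<eta> n = ?A n (\<xi> n)" for n by (simp add: \<eta>_def second_quantisation_def)
  have \<xi>n: "\<xi> n \<in> sym_power tens2 n" for n using \<xi> by (simp add: sym_fock_def)
  have \<eta>s: "\<eta> n \<in> sym_power tens1 n" for n
  proof -
    obtain w where "\<xi> n = blinfun_apply (symmetriser tens2 n) w" using \<xi>n[of n] by (auto simp: sym_power_def)
    then show ?thesis
      by (simp add: \<eta>n tensor_power_map_symmetriser[OF ht2 ht1 onb2 onb adjT] sym_power_def)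
  qed
  \<comment> \<open>Tensor powers of the adjoint commute with the symmetrisers and do not increase
    norms, so \<open>\<eta>\<close> is a legitimate argument of \<open>W1\<close>.\<close>
  have \<eta>: "\<eta> \<in> sym_fock tens1"
  proof -
    have "summable (\<lambda>n. (norm (\<eta> n))\<^sup>2)"
    proof (rule summable_comparison_test'[where N = 0])
      show "summable (\<lambda>n. (norm (\<xi> n))\<^sup>2)" using \<xi> by (simp add: sym_fock_def)
      show "norm ((norm (\<eta> n))\<^sup>2) \<le> (norm (\<xi> n))\<^sup>2" for n
        using norm_tensor_power_map[OF ht2 ht1 onb2 onb adjT, of n "\<xi> n"] by (simp add: \<eta>n power_mono)
    qed
    then show ?thesis using \<eta>s by (simp add: sym_fock_def)
  qed
  define f where "f N x = (\<Sum>n<N. 1 / sqrt (fact n) * I2 n (\<xi> n) x)" for N x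
  define g where "g N x = (\<Sum>n<N. 1 / sqrt (fact n) * I1 n (\<eta> n) x)" for N x
  have lin1: "L2_linear_on (sym_power tens1 n) \<mu>1 (I1 n)" and lin2: "L2_linear_on (sym_power tens2 n) \<mu>2 (I2 n)" for n
    using assms(15,16) by (simp_all add: stochastic_integral_def)
  have I2: "I2 n (\<xi> n) \<in> L2space \<mu>2" and I1: "I1 n (\<eta> n) \<in> L2space \<mu>1" for n
    using L2_linear_onD(1)[OF lin2 \<xi>n] L2_linear_onD(1)[OF lin1 \<eta>s] by auto
  have fL2: "f N \<in> L2space \<mu>2" and gL2: "g N \<in> L2space \<mu>1" for N
    unfolding f_def[abs_def] g_def[abs_def] by (intro L2space_sum L2space_mult I1 I2)+
  have W2: "W2 \<xi> \<in> L2space \<mu>2" "(\<lambda>N. L2norm \<mu>2 (\<lambda>x. W2 \<xi> x - f N x)) \<longlonglongrightarrow> 0"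
    using assms(18) \<xi> by (auto simp: wiener_ito_def f_def)
  have W1: "W1 \<eta> \<in> L2space \<mu>1" "(\<lambda>N. L2norm \<mu>1 (\<lambda>x. W1 \<eta> x - g N x)) \<longlonglongrightarrow> 0"
    using assms(17) \<eta> by (auto simp: wiener_ito_def g_def)
  have PW2: "P (W2 \<xi>) \<in> L2space \<mu>1" by (rule L2_contractionD(1)[OF contraction_P W2(1)])
  have Pf: "AE x in \<mu>1. P (f N) x = g N x" for N
  proof -
    have "AE x in \<mu>1. \<forall>n\<in>{..<N}. P (I2 n (\<xi> n)) x = I1 n (\<eta> n) x"
      unfolding \<eta>n by (intro AE_finite_allI finite_lessThan
          P_stochastic_integral[OF ht1 ht2 onb2 assms(15) assms(16) \<xi>n])
    with L2_contraction_sum[where A = "{..<N}" and f = "\<lambda>n. I2 n (\<xi> n)" and c = "\<lambda>n. 1 / sqrt (fact n)", OF contraction_P finite_lessThan I2]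
    show ?thesis by eventually_elim (simp add: f_def[abs_def] g_def)
  qed
  have "AE x in \<mu>1. P (W2 \<xi>) x - W1 \<eta> x = 0"
  proof (rule AE_zero_if_L2norm_le_tendsto)
    show "(\<lambda>x. P (W2 \<xi>) x - W1 \<eta> x) \<in> L2space \<mu>1" by (intro L2space_diff PW2 W1(1))
    \<comment> \<open>The partial sums cancel by \<open>Pf\<close>, leaving two tails; contractivity
      of \<open>P\<close> transfers the first to \<open>\<mu>2\<close>. The factors 2 come from
      \<open>L2norm_diff_le\<close>.\<close>
    show "L2norm \<mu>1 (\<lambda>x. P (W2 \<xi>) x - W1 \<eta> x) \<le>
        2 * L2norm \<mu>2 (\<lambda>x. W2 \<xi> x - f N x) + 2 * L2norm \<mu>1 (\<lambda>x. W1 \<eta> x - g N x)" for N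
    proof -
      have F: "(\<lambda>y. W2 \<xi> y - f N y) \<in> L2space \<mu>2" by (intro L2space_diff W2(1) fL2)
      have PF: "P (\<lambda>y. W2 \<xi> y - f N y) \<in> L2space \<mu>1" by (rule L2_contractionD(1)[OF contraction_P F])
      have G: "(\<lambda>x. W1 \<eta> x - g N x) \<in> L2space \<mu>1" by (intro L2space_diff W1(1) gL2)
      have "AE x in \<mu>1. P (W2 \<xi>) x - W1 \<eta> x = P (\<lambda>y. W2 \<xi> y - f N y) x - (W1 \<eta> x - g N x)"
        using L2_contraction_diff[OF contraction_P W2(1) fL2[of N]] Pf[of N] by eventually_elim simp
      then have "L2norm \<mu>1 (\<lambda>x. P (W2 \<xi>) x - W1 \<eta> x) =
          L2norm \<mu>1 (\<lambda>x. P (\<lambda>y. W2 \<xi> y - f N y) x - (W1 \<eta> x - g N x))"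
        by (intro L2norm_cong_AE L2spaceD(1) L2space_diff PW2 PF G W1(1) gL2)
      also have "\<dots> \<le> 2 * L2norm \<mu>1 (P (\<lambda>y. W2 \<xi> y - f N y)) + 2 * L2norm \<mu>1 (\<lambda>x. W1 \<eta> x - g N x)"
        by (rule L2norm_diff_le[OF PF G])
      also have "\<dots> \<le> 2 * L2norm \<mu>2 (\<lambda>x. W2 \<xi> x - f N x) + 2 * L2norm \<mu>1 (\<lambda>x. W1 \<eta> x - g N x)"
        using L2_contractionD(2)[OF contraction_P F] by simp
      finally show ?thesis .
    qed
    have "(\<lambda>N. 2 * L2norm \<mu>2 (\<lambda>x. W2 \<xi> x - f N x) + 2 * L2norm \<mu>1 (\<lambda>x. W1 \<eta> x - g N x)) \<longlonglongrightarrow> 2 * 0 + 2 * 0"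
      by (intro tendsto_intros W1(2) W2(2))
    then show "(\<lambda>N. 2 * L2norm \<mu>2 (\<lambda>x. W2 \<xi> x - f N x) + 2 * L2norm \<mu>1 (\<lambda>x. W1 \<eta> x - g N x)) \<longlonglongrightarrow> 0" by simp
  qed
  then show "AE x in \<mu>1. P (W2 \<xi>) x = W1 (second_quantisation tens2 tens1 (adjoint T) \<xi>) x"
    by eventually_elim (simp add: \<eta>_def)
qed

end
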